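(* Let the data $(\ell_i)_{i}$, $\ell_*$, $(g_i)_i$, $g_*$ satisfy the standing assumptions listed in the context. Let $(x,t)\in\mathcal G\times[0,T]$ and $y\in\Gamma_t^{\rm opt}[x]$ be such that, for some $t_1,t_2\in[t,T]$ (with $t_1<t_2$) and some $i\in\{1,\dots,N\}$, $y(s)\in J_i\setminus\{0\}$ for all $s\in(t_1,t_2)$. Set $\bar y=|y|$ and $\bar\alpha=\bar y'$. Then: 1. $s\mapsto\partial_a\ell_i(\bar y(s),\bar\alpha(s),s)$ is absolutely continuous on $[t_1,t_2]$; 2. $\frac{d}{ds}\,\partial_a\ell_i(\bar y(s),\bar\alpha(s),s)=\partial_y\ell_i(\bar y(s),\bar\alpha(s),s)$ at a.e. $s\in[t_1,t_2]$; 3. $y$ is Lipschitz continuous on $[t_1,t_2]$; 4. $y$ is $C^1$ on $(t_1,t_2)$.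
   Context: Functions in Lebesgue spaces (such as $\bar\alpha$) are identified when equal a.e.; regularity assertions are for a suitable representative. Junction: $N>1$ is an integer, $(e_i)_{1\le i\le N}$ is the canonical basis of $\mathbb R^N$, $\mathbb R_+=[0,\infty)$, $J_i=\mathbb R_+e_i$ are the edges, $\mathcal G=\bigcup_{i=1}^N J_i\subset\mathbb R^N$, and the origin $0$ is the vertex. Fix $T>0$ and $p>1$. Trajectories: for $x\in\mathcal G$, $t\in[0,T]$, $\Gamma_t[x]$ is the set of $y\in C([t,T];\mathcal G)\cap W^{1,p}(t,T;\mathbb R^N)$ with $y(t)=x$. For such $y$ set $\bar y=|y|\in W^{1,p}(t,T)$; then for a.e. $s$, $y'(s)=\bar y'(s)e_i$ if $y(s)\in J_i\setminus\{0\}$ and $y'(s)=0$ if $y(s)=0$. Data: $g_*\in\mathbb R$; $g_i\in C_b(\mathbb R_+)$ (bounded continuous); $\ell_*\in C([0,T])$; $\ell_i\in C(\mathbb R_+\times\mathbb R\times[0,T])$, $(y,a,s)\mapsto\ell_i(y,a,s)$, differentiable in $(y,a)$ with $\partial_y\ell_i,\partial_a\ell_i$ continuous in $(y,a,s)$. Standing assumptions (for all $i$): (H1) there is $C_0>0$ with $\ell_i(y,a,s)\ge C_0(|a|^p-1)$ and $\ell_*(s)\ge -C_0$ for all $(y,a,s)\in\mathbb R_+\times\mathbb R\times[0,T]$; (H2) for any $r>0$ there is a modulus of continuity $\omega_r$ with $|\ell_i(y,a,t_1)-\ell_i(y,a,t_2)|\le(1+|a|^p)\omega_r(|t_1-t_2|)$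 for $y\in[0,r]$, $a\in\mathbb R$, $t_1,t_2\in[0,T]$; (H3) for any $r>0$ there is $\tilde c(r)\ge0$ with $|\partial_y\ell_i(y,a,s)|\le\tilde c(r)(|a|^p+1)$ and $|\partial_a\ell_i(y,a,s)|\le\tilde c(r)(|a|^{p-1}+1)$ for $(y,a,s)\in[0,r]\times\mathbb R\times[0,T]$; (H4) $a\mapsto\ell_i(y,a,s)$ is strictly convex. Costs: $g(y)=\sum_i g_i(|y|)\mathbf 1_{y\in J_i\setminus\{0\}}+\min\{g_*,\min_i g_i(0)\}\mathbf 1_{y=0}$; $\ell_0(\tau)=\min\{\ell_*(\tau),\min_i\ell_i(0,0,\tau)\}$; $L(y(\tau),y'(\tau),\tau)=\sum_i\ell_i(\bar y(\tau),\bar y'(\tau),\tau)\mathbf 1_{y(\tau)\in J_i\setminus\{0\}}+\ell_0(\tau)\mathbf 1_{y(\tau)=0}$; $J_t(x;y)=\int_t^TL(y(\tau),y'(\tau),\tau)\,d\tau+g(y(T))$ for $y\in\Gamma_t[x]$. Optimal trajectories: $\Gamma_t^{\rm opt}[x]=\{y\in\Gamma_t[x]:J_t(x;y)=\inf_{\hat y\in\Gamma_t[x]}J_t(x;\hat y)\}$. *)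

theory Defs
  imports "HOL-Analysis.Analysis"
begin

section \<open>The junction\<close>

text \<open>
  \<open>\<real>\<^sup>N\<close> is \<open>real ^ 'n\<close> with \<open>N = CARD('n)\<close>; \<open>axis i 1\<close> is the canonical basis vector \<open>e\<^sub>i\<close>.
\<close>

definition edge :: "'n::finite \<Rightarrow> (real ^ 'n) set" where
  "edge i = {r *\<^sub>R axis i 1 | r. 0 \<le> r}"

definition junction :: "(real ^ 'n::finite) set" where
  "junction = (\<Union>i. edge i)"

section \<open>Sobolev functions on an interval\<close>

text \<open>
  Functions on an interval are represented by total functions on \<open>real\<close>; only their values on
  the interval matter.
  Test functions are the \<open>C\<^sup>1\<close> functions with compact support in the open interval (for an
  interval this yields the same weak derivatives as smooth test functions).
\<close>

definition Lp_on :: "real \<Rightarrow> real set \<Rightarrow> (real \<Rightarrow> 'a::euclidean_space) \<Rightarrow> bool" where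
  "Lp_on p S u \<longleftrightarrow>
     u \<in> borel_measurable (lebesgue_on S) \<and> integrable (lebesgue_on S) (\<lambda>s. norm (u s) powr p)"

definition test_function :: "real \<Rightarrow> real \<Rightarrow> (real \<Rightarrow> real) \<Rightarrow> bool" where
  "test_function a b \<phi> \<longleftrightarrow>
     \<phi> C1_differentiable_on UNIV \<and>
     compact (closure {s. \<phi> s \<noteq> 0}) \<and> closure {s. \<phi> s \<noteq> 0} \<subseteq> {a<..<b}"

definition locally_integrable :: "real \<Rightarrow> real \<Rightarrow> (real \<Rightarrow> 'a::euclidean_space) \<Rightarrow> bool" where
  "locally_integrable a b u \<longleftrightarrow>
     (\<forall>K. compact K \<longrightarrow> K \<subseteq> {a<..<b} \<longrightarrow> integrable (lebesgue_on K) u)"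

definition has_weak_deriv ::
    "real \<Rightarrow> real \<Rightarrow> (real \<Rightarrow> 'a::euclidean_space) \<Rightarrow> (real \<Rightarrow> 'a) \<Rightarrow> bool" where
  "has_weak_deriv a b u v \<longleftrightarrow>
     locally_integrable a b u \<and> locally_integrable a b v \<and>
     (\<forall>\<phi>. test_function a b \<phi> \<longrightarrow>
        (LINT s|lebesgue_on {a<..<b}. deriv \<phi> s *\<^sub>R u s) =
        - (LINT s|lebesgue_on {a<..<b}. \<phi> s *\<^sub>R v s))"

definition sobolev_W1p :: "real \<Rightarrow> real \<Rightarrow> real \<Rightarrow> (real \<Rightarrow> 'a::euclidean_space) \<Rightarrow> bool" where
  "sobolev_W1p p a b u \<longleftrightarrow>
     Lp_on p {a<..<b} u \<and> (\<exists>v. Lp_on p {a<..<b} v \<and> has_weak_deriv a b u v)"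

text \<open>
  An arbitrary representative of the weak derivative, which is unique up to null sets of the
  interval; all uses below are insensitive to the choice.
\<close>

definition weak_deriv :: "real \<Rightarrow> real \<Rightarrow> (real \<Rightarrow> 'a::euclidean_space) \<Rightarrow> real \<Rightarrow> 'a" where
  "weak_deriv a b u = (SOME v. has_weak_deriv a b u v)"

text \<open>
  The \<open>\<epsilon>\<close>-\<open>\<delta>\<close> definition: \<open>D\<close> ranges over the finite families of non-overlapping closed
  intervals contained in \<open>S\<close>.
\<close>

definition abs_continuous_on :: "real set \<Rightarrow> (real \<Rightarrow> 'a::real_normed_vector) \<Rightarrow> bool" where
  "abs_continuous_on S f \<longleftrightarrow>
     (\<forall>\<epsilon>>0. \<exists>\<delta>>0. \<forall>D.
        D division_of \<Union>D \<and> \<Union>D \<subseteq> S \<and> (\<Sum>K\<in>D. Sup K - Inf K) < \<delta> \<longrightarrow>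
        (\<Sum>K\<in>D. norm (f (Sup K) - f (Inf K))) < \<epsilon>)"

section \<open>Data\<close>

text \<open>
  The domain of \<open>\<ell>\<^sub>i\<close> is \<open>y \<ge> 0\<close>, so the derivative in \<open>y\<close> is one-sided at \<open>y = 0\<close>.
\<close>

definition partial_y :: "(real \<Rightarrow> real \<Rightarrow> real \<Rightarrow> real) \<Rightarrow> real \<Rightarrow> real \<Rightarrow> real \<Rightarrow> real" where
  "partial_y f y a s = vector_derivative (\<lambda>z. f z a s) (at y within {0..})"

definition partial_a :: "(real \<Rightarrow> real \<Rightarrow> real \<Rightarrow> real) \<Rightarrow> real \<Rightarrow> real \<Rightarrow> real \<Rightarrow> real" where
  "partial_a f y a s = deriv (\<lambda>b. f y b s) a"

text \<open>
  Only the defining property of a modulus of continuity is required; monotonicity or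
  continuity away from \<open>0\<close> is not imposed.
\<close>

definition modulus_of_continuity :: "(real \<Rightarrow> real) \<Rightarrow> bool" where
  "modulus_of_continuity \<omega> \<longleftrightarrow> (\<forall>h\<ge>0. 0 \<le> \<omega> h) \<and> \<omega> 0 = 0 \<and> (\<omega> \<longlongrightarrow> 0) (at_right 0)"

definition strictly_convex :: "(real \<Rightarrow> real) \<Rightarrow> bool" where
  "strictly_convex f \<longleftrightarrow>
     (\<forall>a b u. a \<noteq> b \<longrightarrow> 0 < u \<longrightarrow> u < 1 \<longrightarrow>
        f ((1 - u) * a + u * b) < (1 - u) * f a + u * f b)"

section \<open>The control problem\<close>

definition trajectories :: "real \<Rightarrow> real \<Rightarrow> real \<Rightarrow> real ^ 'n::finite \<Rightarrow> (real \<Rightarrow> real ^ 'n) set" where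
  "trajectories p T t x =
     {y. continuous_on {t..T} y \<and> y ` {t..T} \<subseteq> junction \<and> sobolev_W1p p t T y \<and> y t = x}"

definition terminal_cost :: "('n::finite \<Rightarrow> real \<Rightarrow> real) \<Rightarrow> real \<Rightarrow> real ^ 'n \<Rightarrow> real" where
  "terminal_cost g gstar y =
     (\<Sum>i\<in>UNIV. g i (norm y) * indicator (edge i - {0}) y)
     + min gstar (MIN i. g i 0) * indicator {0} y"

definition vertex_cost ::
    "('n::finite \<Rightarrow> real \<Rightarrow> real \<Rightarrow> real \<Rightarrow> real) \<Rightarrow> (real \<Rightarrow> real) \<Rightarrow> real \<Rightarrow> real" where
  "vertex_cost l lstar \<tau> = min (lstar \<tau>) (MIN i. l i 0 0 \<tau>)"

text \<open>
  \<open>L(y, y', \<tau>)\<close> depends on the velocity only through \<open>a = |y|'\<close>, which is its second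
  argument here.
\<close>

definition running_cost ::
    "('n::finite \<Rightarrow> real \<Rightarrow> real \<Rightarrow> real \<Rightarrow> real) \<Rightarrow> (real \<Rightarrow> real) \<Rightarrow>
     real ^ 'n \<Rightarrow> real \<Rightarrow> real \<Rightarrow> real" where
  "running_cost l lstar y a \<tau> =
     (\<Sum>i\<in>UNIV. l i (norm y) a \<tau> * indicator (edge i - {0}) y)
     + vertex_cost l lstar \<tau> * indicator {0} y"

text \<open>
  Under the growth assumptions on the data the running cost along every trajectory is
  integrable and the total cost is bounded below, so the real-valued integral and infimum
  below have their usual meaning.
\<close>

definition total_cost ::
    "real \<Rightarrow> ('n::finite \<Rightarrow> real \<Rightarrow> real \<Rightarrow> real \<Rightarrow> real) \<Rightarrow> (real \<Rightarrow> real) \<Rightarrow>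
     ('n \<Rightarrow> real \<Rightarrow> real) \<Rightarrow> real \<Rightarrow> real \<Rightarrow> (real \<Rightarrow> real ^ 'n) \<Rightarrow> real" where
  "total_cost T l lstar g gstar t y =
     (LINT \<tau>|lebesgue_on {t..T}.
        running_cost l lstar (y \<tau>) (weak_deriv t T (\<lambda>s. norm (y s)) \<tau>) \<tau>)
     + terminal_cost g gstar (y T)"

definition optimal_trajectories ::
    "real \<Rightarrow> real \<Rightarrow> ('n::finite \<Rightarrow> real \<Rightarrow> real \<Rightarrow> real \<Rightarrow> real) \<Rightarrow> (real \<Rightarrow> real) \<Rightarrow>
     ('n \<Rightarrow> real \<Rightarrow> real) \<Rightarrow> real \<Rightarrow> real \<Rightarrow> real ^ 'n \<Rightarrow> (real \<Rightarrow> real ^ 'n) set" where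
  "optimal_trajectories p T l lstar g gstar t x =
     {y \<in> trajectories p T t x.
        total_cost T l lstar g gstar t y =
        (INF z\<in>trajectories p T t x. total_cost T l lstar g gstar t z)}"

end

theory Submission
  imports Defs
begin

text \<open>
  On \<open>(t\<^sub>1, t\<^sub>2)\<close> the trajectory stays off the vertex, so it can be perturbed by \<open>\<epsilon> \<phi> e\<^sub>i\<close> with a test
  function \<open>\<phi>\<close> supported in \<open>(t\<^sub>1, t\<^sub>2)\<close> and small \<open>\<epsilon>\<close> without leaving the junction.
  Optimality and dominated convergence give the Euler--Lagrange equation in weak form, and the lemma
  of du Bois-Reymond turns it into \<open>\<partial>\<^sub>a \<ell>\<^sub>i = q\<close> a.e. with \<open>q\<close> the indefinite integral of \<open>\<partial>\<^sub>y \<ell>\<^sub>i\<close>.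
  Since \<open>q\<close> is bounded, convexity and the growth of \<open>\<ell>\<^sub>i\<close> bound the velocity; strict convexity makes
  \<open>\<partial>\<^sub>a \<ell>\<^sub>i\<close> injective in \<open>a\<close>, so the set \<open>{(s, a). \<partial>\<^sub>a \<ell>\<^sub>i (|y s|, a, s) = q s}\<close> is compact and is the graph
  of a function on \<open>[t\<^sub>1, t\<^sub>2]\<close>. This function is continuous and agrees a.e. with the velocity.
\<close>

section \<open>Differentiation of indefinite integrals\<close>

text \<open>The obstacle is the gap between what is known and what is claimed. The velocity is an
  arbitrarily chosen representative of a weak derivative, fixed only up to null sets, while
  Lipschitz and C1 regularity are pointwise. Statements valid almost everywhere are therefore
  carried by primitives and by closed sets, for which they can be upgraded to all points. The data
  have first derivatives only, so the equation for the velocity is not open to the implicit function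
  theorem; compactness and injectivity take its place. The trajectory may sit at the vertex at
  \<open>t1\<close> or \<open>t2\<close>. Perturbations must avoid these times, whereas the equation
  for the velocity extends to them because the partial derivatives are continuous up to distance 0
  from the vertex. This is why the Lipschitz bound reaches the end points. Primitives of merely
  integrable functions have to be differentiated almost everywhere at three places: for
  \<open>q\<close>, for the lemma of du Bois-Reymond, and for the uniqueness of weak
  derivatives.\<close>

lemma cball_segment_real:
  fixes x h :: real
  shows "cball (x + h / 2) (\<bar>h\<bar> / 2) = (if 0 \<le> h then {x..x+h} else {x+h..x})"
  by (auto simp: cball_eq_atLeastAtMost field_simps)

text \<open>Near each bad point there are arbitrarily short intervals on which the Riemann sum and the integral
  differ by at least \<open>c\<close> times the length. By Henstock's lemma disjoint such intervals have small total
  length, and by Vitali's theorem they cover almost all bad points.\<close>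

lemma indefinite_integral_bad_set_negligible:
  fixes f :: "real \<Rightarrow> real"
  assumes f: "f integrable_on {a..b}" and c: "c > 0"
  defines "F \<equiv> \<lambda>u. integral {a..u} f"
  shows "negligible {x\<in>{a<..<b}. \<forall>d>0. \<exists>h. 0 < \<bar>h\<bar> \<and> \<bar>h\<bar> < d \<and> \<bar>F (x + h) - F x - h * f x\<bar> \<ge> c * \<bar>h\<bar>}"
    (is "negligible ?E")
  unfolding negligible_outer_le
proof (intro allI impI)
  fix e :: real assume e: "e > 0"
  have "f integrable_on cbox a b" using f by simp
  \<comment> \<open>The accuracy \<open>c * e\<close> anticipates that every bad interval
    contributes at least \<open>c\<close> times its length; dividing by \<open>c\<close> leaves a
    total length of at most \<open>e\<close>.\<close>
  then obtain \<gamma> where \<gamma>: "gauge \<gamma>"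
    and hl: "\<And>p. \<lbrakk>p tagged_partial_division_of (cbox a b); \<gamma> fine p\<rbrakk> \<Longrightarrow>
             sum (\<lambda>(x,k). norm (measure lborel k *\<^sub>R f x - integral k f)) p < c * e"
    using Henstock_lemma[of f a b "c * e"] mult_pos_pos[OF c e] by blast
  \<comment> \<open>Vitali's theorem is about balls, so the segment between \<open>x\<close> and
    \<open>x + h\<close> is written as the ball around its midpoint. The bad point \<open>x\<close>
    is an end point of the segment and serves as its tag, which turns the integral over the segment
    into a difference of values of \<open>F\<close>.\<close>
  define I where "I = (\<lambda>(x::real, h::real). cball (x + h / 2) (\<bar>h\<bar> / 2))"
  define K where "K = {(x, h). x \<in> ?E \<and> h \<noteq> 0 \<and> I (x, h) \<subseteq> {a<..<b} \<inter> \<gamma> x \<and>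
    \<bar>F (x + h) - F x - h * f x\<bar> \<ge> c * \<bar>h\<bar>}"
  have ex: "\<exists>i. i \<in> K \<and> x \<in> cball (fst i + snd i / 2) (\<bar>snd i\<bar> / 2) \<and> \<bar>snd i\<bar> / 2 < d"
    if x: "x \<in> ?E" and d: "0 < d" for x d
  proof -
    have "open ({a<..<b} \<inter> \<gamma> x)" "x \<in> {a<..<b} \<inter> \<gamma> x"
      using \<gamma> x by (auto simp: gauge_def)
    then obtain r where r: "r > 0" "cball x r \<subseteq> {a<..<b} \<inter> \<gamma> x"
      by (meson open_contains_cball)
    obtain h where h: "0 < \<bar>h\<bar>" "\<bar>h\<bar> < min d r" "\<bar>F (x + h) - F x - h * f x\<bar> \<ge> c * \<bar>h\<bar>"
      using x d r by (auto dest!: spec[of _ "min d r"])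
    have "I (x, h) \<subseteq> cball x r"
      using h(2) unfolding I_def prod.case cball_segment_real
      by (auto simp: cball_eq_atLeastAtMost)
    with r have "(x, h) \<in> K"
      using x h by (auto simp: K_def)
    moreover have "x \<in> cball (x + h / 2) (\<bar>h\<bar> / 2)"
      by (auto simp: dist_real_def)
    ultimately show ?thesis
      using h d by (intro exI[of _ "(x, h)"]) auto
  qed
  have pos: "0 < \<bar>snd i\<bar> / 2" if "i \<in> K" for i
    using that by (auto simp: K_def)
  obtain C where C: "countable C" "C \<subseteq> K"
     "pairwise (\<lambda>i j. disjnt (cball (fst i + snd i / 2) (\<bar>snd i\<bar> / 2)) (cball (fst j + snd j / 2) (\<bar>snd j\<bar> / 2))) C"
     "negligible (?E - (\<Union>i \<in> C. cball (fst i + snd i / 2) (\<bar>snd i\<bar> / 2)))"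
    by (rule Vitali_covering_theorem_cballs[of K "\<lambda>i. \<bar>snd i\<bar> / 2" ?E "\<lambda>i. fst i + snd i / 2", OF pos ex])
  have I_eq: "cball (fst i + snd i / 2) (\<bar>snd i\<bar> / 2) = I i" for i
    by (simp add: I_def split_beta)
  note C = C[unfolded I_eq]
  have I_cases: "I (x, h) = (if 0 \<le> h then {x..x+h} else {x+h..x})" for x h
    by (simp only: I_def prod.case cball_segment_real)
  have meas_I: "measure lebesgue (I i) = \<bar>snd i\<bar>" for i
    using I_cases[of "fst i" "snd i"] by simp
  \<comment> \<open>Henstock's lemma applies to finite families only. The bound is the same for
    every finite subfamily, hence it passes to the countable union.\<close>
  have fin: "measure lebesgue (\<Union>i\<in>C'. I i) \<le> e" if C': "C' \<subseteq> C" "finite C'" for C'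
  proof -
    define p where "p = (\<lambda>i. (fst i, I i)) ` C'"
    have CK: "i \<in> K" if "i \<in> C'" for i using that C' C by auto
    have sub: "I i \<subseteq> {a<..<b} \<inter> \<gamma> (fst i)" if "i \<in> C'" for i
      using CK[OF that] by (cases i) (simp add: K_def)
    have disj: "I i \<inter> I j = {}" if "i \<in> C'" "j \<in> C'" "i \<noteq> j" for i j
      using pairwiseD[OF C(3) subsetD[OF C'(1)] subsetD[OF C'(1)]] that by (simp add: disjnt_def)
    have ne: "fst i \<in> I i" for i
      using I_cases[of "fst i" "snd i"] by simp
    have inj: "inj_on (\<lambda>i. (fst i, I i)) C'"
    proof (rule inj_onI)
      fix i j assume ij: "i \<in> C'" "j \<in> C'" and eq: "(fst i, I i) = (fst j, I j)"
      have "fst i \<in> I i \<inter> I j" using ne[of i] eq by simp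
      then show "i = j" using disj[OF ij] by auto
    qed
    have p: "p tagged_partial_division_of cbox a b"
      unfolding tagged_partial_division_of_def
    proof (intro conjI allI impI)
      show "finite p" using C' by (simp add: p_def)
    next
      fix x k assume "(x, k) \<in> p"
      then obtain i where i: "i \<in> C'" "x = fst i" "k = I i" by (auto simp: p_def)
      show "x \<in> k" using ne i by simp
      show "k \<subseteq> cbox a b"
        using sub[OF i(1)] i box_subset_cbox[of a b] by auto
      show "\<exists>u v. k = cbox u v"
        using I_cases[of "fst i" "snd i"] i by (auto split: if_splits)
    next
      fix x1 k1 x2 k2
      assume "(x1, k1) \<in> p \<and> (x2, k2) \<in> p \<and> (x1, k1) \<noteq> (x2, k2)"
      then obtain i j where ij: "i \<in> C'" "j \<in> C'" "k1 = I i" "k2 = I j" "i \<noteq> j"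
        by (auto simp: p_def)
      then show "interior k1 \<inter> interior k2 = {}"
        using disj[of i j] interior_subset[of k1] interior_subset[of k2] by blast
    qed
    have "\<gamma> fine p"
      unfolding fine_def p_def using sub by auto
    from hl[OF p this]
    have "(\<Sum>i\<in>C'. norm (measure lborel (I i) *\<^sub>R f (fst i) - integral (I i) f)) < c * e"
      unfolding p_def by (subst (asm) sum.reindex[OF inj]) (simp add: o_def)
    moreover have "c * \<bar>snd i\<bar> \<le> norm (measure lborel (I i) *\<^sub>R f (fst i) - integral (I i) f)" if i: "i \<in> C'" for i
    proof -
      obtain x h where xh: "i = (x, h)" by fastforce
      have iK: "I (x, h) \<subseteq> {a<..<b}" "\<bar>F (x + h) - F x - h * f x\<bar> \<ge> c * \<bar>h\<bar>"
        using CK[OF i] xh by (auto simp: K_def)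
      show ?thesis
      proof (cases "0 \<le> h")
        case True
        then have "x + h < b" "a < x"
          using iK(1)[THEN subsetD, of x] iK(1)[THEN subsetD, of "x + h"] by (simp_all add: I_cases)
        then have "F x + integral {x..x+h} f = F (x + h)"
          unfolding F_def using True
          by (intro Henstock_Kurzweil_Integration.integral_combine integrable_on_subinterval[OF f]) auto
        then show ?thesis using iK(2) xh True by (simp add: I_cases abs_if split: if_splits)
      next
        case False
        then have "a < x + h" "x < b"
          using iK(1)[THEN subsetD, of x] iK(1)[THEN subsetD, of "x + h"] by (simp_all add: I_cases)
        then have "F (x + h) + integral {x+h..x} f = F x"
          unfolding F_def using False
          by (intro Henstock_Kurzweil_Integration.integral_combine integrable_on_subinterval[OF f]) auto
        then show ?thesis using iK(2) xh False by (simp add: I_cases abs_if split: if_splits)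
      qed
    qed
    then have "(\<Sum>i\<in>C'. c * \<bar>snd i\<bar>) \<le>
        (\<Sum>i\<in>C'. norm (measure lborel (I i) *\<^sub>R f (fst i) - integral (I i) f))"
      by (rule sum_mono)
    ultimately have "c * (\<Sum>i\<in>C'. \<bar>snd i\<bar>) < c * e"
      unfolding sum_distrib_left by linarith
    then have "(\<Sum>i\<in>C'. \<bar>snd i\<bar>) \<le> e" using c by simp
    moreover have "measure lebesgue (\<Union>i\<in>C'. I i) \<le> (\<Sum>i\<in>C'. measure lebesgue (I i))"
      using C' by (intro measure_UNION_le) (auto simp: I_def split_beta)
    ultimately show ?thesis by (simp add: meas_I)
  qed
  have lm: "I i \<in> lmeasurable" for i by (simp add: I_def split_beta)
  have U: "(\<Union>i\<in>C. I i) \<in> lmeasurable" "measure lebesgue (\<Union>i\<in>C. I i) \<le> e"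
    by (rule fmeasurable_UN_bound[OF C(1) lm fin], assumption+) (rule measure_UN_bound[OF C(1) lm fin], assumption+)
  let ?N = "?E - (\<Union>i \<in> C. I i)"
  have N: "?N \<in> lmeasurable" "measure lebesgue ?N = 0"
    by (rule C(4)[unfolded negligible_iff_measure, THEN conjunct1],
        rule C(4)[unfolded negligible_iff_measure, THEN conjunct2])
  have 1: "?N \<union> (\<Union>i\<in>C. I i) \<in> lmeasurable"
    by (rule fmeasurable.Un[OF N(1) U(1)])
  have "measure lebesgue (?N \<union> (\<Union>i\<in>C. I i)) \<le> measure lebesgue ?N + measure lebesgue (\<Union>i\<in>C. I i)"
    by (rule measure_Un_le[OF fmeasurableD[OF N(1)] fmeasurableD[OF U(1)]])
  with U(2) N(2) have 2: "measure lebesgue (?N \<union> (\<Union>i\<in>C. I i)) \<le> e"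
    by linarith
  show "\<exists>T. ?E \<subseteq> T \<and> T \<in> lmeasurable \<and> measure lebesgue T \<le> e"
    by (rule exI[of _ "?N \<union> (\<Union>i\<in>C. I i)"], intro conjI 1 2) (simp only: Un_Diff_cancel2 Un_upper1)
qed

text \<open>If the difference quotients at \<open>x\<close> do not converge to \<open>f x\<close>,
  they miss it by some \<open>1 / (n + 1)\<close> for arbitrarily small \<open>h\<close>. So the
  exceptional points lie in countably many negligible sets of the preceding kind.\<close>

lemma lebesgue_differentiation_real:
  fixes f :: "real \<Rightarrow> real"
  assumes f: "f integrable_on {a..b}"
  shows "negligible {x\<in>{a<..<b}. \<not> ((\<lambda>u. integral {a..u} f) has_real_derivative f x) (at x)}"
proof -
  define F where "F = (\<lambda>u. integral {a..u} f)"
  define E where "E = (\<lambda>n. {x\<in>{a<..<b}. \<forall>d>0. \<exists>h. 0 < \<bar>h\<bar> \<and> \<bar>h\<bar> < d \<and>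
     \<bar>F (x + h) - F x - h * f x\<bar> \<ge> inverse (real (Suc n)) * \<bar>h\<bar>})"
  have "negligible (\<Union>n. E n)"
    unfolding E_def F_def using f
    by (intro negligible_Union_nat indefinite_integral_bad_set_negligible) auto
  moreover have "x \<in> (\<Union>n. E n)" if x: "x \<in> {a<..<b}" and nd: "\<not> (F has_real_derivative f x) (at x)" for x
  proof (rule ccontr)
    assume nx: "x \<notin> (\<Union>n. E n)"
    have "(\<lambda>h. (F (x + h) - F x) / h) \<midarrow>0\<rightarrow> f x"
      unfolding LIM_eq
    proof (intro allI impI)
      fix r :: real assume "0 < r"
      then obtain n where n: "inverse (real (Suc n)) < r" using reals_Archimedean by blast
      have "x \<notin> E n" using nx by blast
      then obtain d where d: "d > 0" "\<And>h. 0 < \<bar>h\<bar> \<Longrightarrow> \<bar>h\<bar> < d \<Longrightarrow> 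
         \<bar>F (x + h) - F x - h * f x\<bar> < inverse (real (Suc n)) * \<bar>h\<bar>"
        using x unfolding E_def by (auto simp: not_le)
      have "norm ((F (x + h) - F x) / h - f x) < r" if "h \<noteq> 0" "\<bar>h\<bar> < d" for h
      proof -
        have "(F (x + h) - F x) / h - f x = (F (x + h) - F x - h * f x) / h"
          using that by (simp add: field_simps)
        then have "\<bar>(F (x + h) - F x) / h - f x\<bar> = \<bar>F (x + h) - F x - h * f x\<bar> / \<bar>h\<bar>" by simp
        also have "\<dots> < inverse (real (Suc n))"
          using d(2)[of h] that by (simp add: pos_divide_less_eq)
        finally show ?thesis using n by simp
      qed
      then show "\<exists>s>0. \<forall>h. h \<noteq> 0 \<and> norm (h - 0) < s \<longrightarrow> norm ((F (x + h) - F x) / h - f x) < r"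
        using d(1) by auto
    qed
    then show False using nd by (simp add: DERIV_def)
  qed
  ultimately show ?thesis
    unfolding F_def by (auto intro: negligible_subset)
qed

text \<open>By truncation: \<open>|f| \<le> n + g n\<close>, where \<open>g n\<close> is the part of
  \<open>|f|\<close> above height \<open>n\<close> and has an integral that tends to 0. Once
  \<open>n\<close> is fixed, the bounded part contributes at most \<open>n\<close> times the total
  length, and the integral of \<open>g n\<close> is small over every union of intervals.\<close>

lemma abs_continuous_on_add_const_indefinite_integral:
  fixes f :: "real \<Rightarrow> real"
  assumes f: "f absolutely_integrable_on {a..b}"
  shows "abs_continuous_on {a..b} (\<lambda>u. c + integral {a..u} f)"
  unfolding abs_continuous_on_def
proof (intro allI impI)
  fix \<epsilon> :: real assume e: "\<epsilon> > 0"
  have af: "(\<lambda>x. \<bar>f x\<bar>) absolutely_integrable_on {a..b}"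
    using absolutely_integrable_abs[OF f] by simp
  define g where "g = (\<lambda>n x. max 0 (\<bar>f x\<bar> - real n))"
  have gi: "g n absolutely_integrable_on {a..b}" for n
    unfolding g_def
    by (intro absolutely_integrable_max_1 set_integral_diff af) auto
  have "(\<lambda>n. integral {a..b} (g n)) \<longlonglongrightarrow> integral {a..b} (\<lambda>x. 0)"
  proof (rule dominated_convergence(2)[where h = "\<lambda>x. \<bar>f x\<bar>"])
    show "g n integrable_on {a..b}" for n
      using gi set_lebesgue_integral_eq_integral(1) by blast
    show "(\<lambda>x. \<bar>f x\<bar>) integrable_on {a..b}"
      using af set_lebesgue_integral_eq_integral(1) by blast
    show "norm (g n x) \<le> \<bar>f x\<bar>" for n x by (auto simp: g_def)
    show "(\<lambda>n. g n x) \<longlonglongrightarrow> 0" for x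
    proof (rule tendsto_eventually)
      obtain N where "\<bar>f x\<bar> \<le> real N" using real_arch_simple by blast
      then show "\<forall>\<^sub>F n in sequentially. g n x = 0"
        unfolding eventually_sequentially g_def by (intro exI[of _ N]) auto
    qed
  qed
  then obtain n where n: "integral {a..b} (g n) < \<epsilon> / 2"
    using e order_tendstoD(2)[of _ 0 sequentially "\<epsilon> / 2"] by (auto simp: eventually_sequentially)
  \<comment> \<open>Using \<open>real n + 1\<close> instead of \<open>real n\<close> covers
    \<open>n = 0\<close> and makes \<open>real n * \<delta> < \<epsilon> / 2\<close> strict.\<close>
  define \<delta> where "\<delta> = \<epsilon> / (2 * (real n + 1))"
  have "(\<Sum>K\<in>D. norm (c + integral {a..Sup K} f - (c + integral {a..Inf K} f))) < \<epsilon>"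
    if D: "D division_of \<Union>D" "\<Union>D \<subseteq> {a..b}" and s: "(\<Sum>K\<in>D. Sup K - Inf K) < \<delta>" for D
  proof -
    have fD: "finite D" using D by blast
    have "\<Union>D \<in> sets lebesgue"
      using division_of_closed[OF D(1)] lebesgue_closedin[of UNIV] by simp
    then have gU: "g n integrable_on \<Union>D"
      using set_integrable_subset[OF gi _ D(2)] set_lebesgue_integral_eq_integral(1) by blast
    have K: "norm (c + integral {a..Sup K} f - (c + integral {a..Inf K} f))
        \<le> real n * (Sup K - Inf K) + integral K (g n)" and sub: "Sup K - Inf K \<ge> 0" 
      if KD: "K \<in> D" for K
    proof -
      obtain u v where uv: "K = cbox u v" "K \<noteq> {}" "K \<subseteq> {a..b}"
        using D KD by (metis Union_upper division_ofD(3,4) order_trans)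
      then have uv': "u \<le> v" "a \<le> u" "v \<le> b" "K = {u..v}" by auto
      have fi: "f integrable_on {p..q}" if "a \<le> p" "q \<le> b" for p q
        using f that integrable_on_subinterval[of f "{a..b}" p q] set_lebesgue_integral_eq_integral(1) by auto
      have gn: "g n absolutely_integrable_on {u..v}" "f absolutely_integrable_on {u..v}"
        using uv' by (auto intro!: absolutely_integrable_on_subinterval[OF gi] absolutely_integrable_on_subinterval[OF f])
      have "integral {a..u} f + integral {u..v} f = integral {a..v} f"
        using uv' by (intro Henstock_Kurzweil_Integration.integral_combine fi) auto
      then have "norm (c + integral {a..Sup K} f - (c + integral {a..Inf K} f)) = norm (integral {u..v} f)"
        using uv' by simp
      also have "\<dots> \<le> integral {u..v} (\<lambda>x. real n + g n x)"
        using gn uv' by (intro integral_norm_bound_integral)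
           (auto simp: g_def intro!: integrable_add integrable_const_ivl set_lebesgue_integral_eq_integral(1))
      also have "\<dots> = real n * (v - u) + integral {u..v} (g n)"
        using gn uv' set_lebesgue_integral_eq_integral(1)[OF gn(1)] by (subst integral_add) auto
      finally show "norm (c + integral {a..Sup K} f - (c + integral {a..Inf K} f))
        \<le> real n * (Sup K - Inf K) + integral K (g n)" using uv' by simp
      show "Sup K - Inf K \<ge> 0" using uv' by simp
    qed
    have "(\<Sum>K\<in>D. norm (c + integral {a..Sup K} f - (c + integral {a..Inf K} f)))
      \<le> (\<Sum>K\<in>D. real n * (Sup K - Inf K) + integral K (g n))"
      by (rule sum_mono) (rule K)
    also have "\<dots> = real n * (\<Sum>K\<in>D. Sup K - Inf K) + (\<Sum>K\<in>D. integral K (g n))"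
      by (simp add: sum.distrib sum_distrib_left)
    also have "(\<Sum>K\<in>D. integral K (g n)) = integral (\<Union>D) (g n)"
      using gU D(1) by (simp add: integral_combine_division_topdown)
    also have "integral (\<Union>D) (g n) \<le> integral {a..b} (g n)"
      using gU D(2) set_lebesgue_integral_eq_integral(1)[OF gi] by (intro integral_subset_le) (auto simp: g_def)
    also have "real n * (\<Sum>K\<in>D. Sup K - Inf K) \<le> real n * \<delta>"
      using s by (intro mult_left_mono) auto
    also have "real n * \<delta> < \<epsilon> / 2"
      using e by (simp add: \<delta>_def field_simps)
    finally show ?thesis using n by simp
  qed
  moreover have "\<delta> > 0" using e by (simp add: \<delta>_def)
  ultimately show "\<exists>\<delta>>0. \<forall>D. D division_of \<Union> D \<and> \<Union> D \<subseteq> {a..b} \<and> (\<Sum>K\<in>D. Sup K - Inf K) < \<delta> \<longrightarrow>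
             (\<Sum>K\<in>D. norm (c + integral {a..Sup K} f - (c + integral {a..Inf K} f))) < \<epsilon>"
    by blast
qed

section \<open>The lemma of du Bois-Reymond\<close>

text \<open>In the third fact \<open>K\<close> is the closed support. Its complement is open, so
  \<open>\<phi>\<close> vanishes near each point of it and the derivative is 0 there too.\<close>

lemma test_functionD:
  assumes "test_function a b \<phi>"
  shows "\<And>s. (\<phi> has_real_derivative deriv \<phi> s) (at s)" "continuous_on UNIV (deriv \<phi>)"
    "\<exists>K. compact K \<and> K \<subseteq> {a<..<b} \<and> (\<forall>s. s \<notin> K \<longrightarrow> \<phi> s = 0 \<and> deriv \<phi> s = 0)"
proof -
  obtain D where D: "\<And>x. (\<phi> has_vector_derivative D x) (at x)" "continuous_on UNIV D"
    using assms by (auto simp: test_function_def C1_differentiable_on_def)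
  then have D': "(\<phi> has_real_derivative D x) (at x)" for x
    by (simp add: has_real_derivative_iff_has_vector_derivative)
  have "deriv \<phi> = D" by (rule ext) (rule DERIV_imp_deriv[OF D'])
  then show "\<And>s. (\<phi> has_real_derivative deriv \<phi> s) (at s)" "continuous_on UNIV (deriv \<phi>)"
    by (simp_all add: D' D(2))
  let ?K = "closure {s. \<phi> s \<noteq> 0}"
  have "\<phi> s = 0 \<and> deriv \<phi> s = 0" if s: "s \<notin> ?K" for s
  proof
    have z: "\<phi> u = 0" if "u \<in> - ?K" for u
      using that subsetD[OF closure_subset[of "{s. \<phi> s \<noteq> 0}"], of u] by auto
    show "\<phi> s = 0" by (rule z) (rule Compl_iff[THEN iffD2, OF s])
    have "(\<phi> has_real_derivative 0) (at s)"
      by (rule has_field_derivative_transform_within_open[OF DERIV_const[of 0] open_Compl[OF closed_closure]])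
         (rule Compl_iff[THEN iffD2, OF s], rule z[symmetric])
    then show "deriv \<phi> s = 0" by (rule DERIV_imp_deriv)
  qed
  then show "\<exists>K. compact K \<and> K \<subseteq> {a<..<b} \<and> (\<forall>s. s \<notin> K \<longrightarrow> \<phi> s = 0 \<and> deriv \<phi> s = 0)"
    using assms unfolding test_function_def by blast
qed

lemma test_function_bounded:
  assumes "test_function a b \<phi>"
  obtains M where "M > 0" "\<And>s. \<bar>\<phi> s\<bar> \<le> M" "\<And>s. \<bar>deriv \<phi> s\<bar> \<le> M"
proof -
  note D = test_functionD[OF assms]
  obtain K where K: "compact K" "\<And>s. s \<notin> K \<Longrightarrow> \<phi> s = 0 \<and> deriv \<phi> s = 0" using D(3) by auto
  have c: "continuous_on K \<phi>" "continuous_on K (deriv \<phi>)"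
    using D(1,2) by (auto intro: DERIV_isCont continuous_at_imp_continuous_on continuous_on_subset)
  have "bounded (\<phi> ` K)" "bounded (deriv \<phi> ` K)"
    using K c by (auto intro: compact_imp_bounded compact_continuous_image)
  then obtain M1 M2 where M: "\<And>s. s \<in> K \<Longrightarrow> \<bar>\<phi> s\<bar> \<le> M1" "\<And>s. s \<in> K \<Longrightarrow> \<bar>deriv \<phi> s\<bar> \<le> M2"
    by (auto simp: bounded_iff)
  show ?thesis
  proof (rule that[of "max 1 (max M1 M2)"])
    show "\<bar>\<phi> s\<bar> \<le> max 1 (max M1 M2)" for s using M(1)[of s] K(2)[of s] by (cases "s \<in> K") auto
    show "\<bar>deriv \<phi> s\<bar> \<le> max 1 (max M1 M2)" for s using M(2)[of s] K(2)[of s] by (cases "s \<in> K") auto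
  qed simp
qed

text \<open>Test functions must be \<open>C\<^sup>1\<close>; combinations of shifted ramps with \<open>\<Sum>A\<^sub>k = \<Sum>A\<^sub>k c\<^sub>k = 0\<close> have
  compactly supported antiderivatives, and ramps converge boundedly to Heaviside functions.\<close>

definition ramp :: "nat \<Rightarrow> real \<Rightarrow> real" where
  "ramp n x = real (Suc n) * (max 0 x - max 0 (x - 1 / real (Suc n)))"

text \<open>The antiderivative of \<open>ramp n\<close> that is 0 on the negative half-line. It is
  continuously differentiable because the square of \<open>max 0 x\<close> is, in contrast to
  \<open>max 0 x\<close> itself.\<close>

definition ramp_int :: "nat \<Rightarrow> real \<Rightarrow> real" where
  "ramp_int n x = real (Suc n) / 2 * ((max 0 x)\<^sup>2 - (max 0 (x - 1 / real (Suc n)))\<^sup>2)"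

lemma has_derivative_max_0_squared:
  "((\<lambda>x::real. (max 0 x)\<^sup>2) has_real_derivative 2 * max 0 x) (at x)"
proof -
  consider "x < 0" | "x = 0" | "x > 0" by linarith
  then show ?thesis
  proof cases
    case 1
    have "((\<lambda>x::real. 0) has_real_derivative 2 * max 0 x) (at x)" using 1 by (simp add: max_def)
    then show ?thesis
      by (rule has_field_derivative_transform_within_open[where S = "{..<0}"]) (use 1 in auto)
  next
    case 3
    have "((\<lambda>x::real. x\<^sup>2) has_real_derivative 2 * max 0 x) (at x)" using 3 by (auto intro!: derivative_eq_intros)
    then show ?thesis
      by (rule has_field_derivative_transform_within_open[where S = "{0<..}"]) (use 3 in auto)
  next
    case 2
    have "((\<lambda>h::real. max 0 h) \<longlongrightarrow> max 0 0) (at 0)" by (intro tendsto_intros)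
    moreover have "(max 0 h)\<^sup>2 / h = max 0 h" for h :: real by (auto simp: max_def power2_eq_square)
    ultimately show ?thesis using 2 by (simp add: DERIV_def)
  qed
qed

lemma has_derivative_ramp_int: "(ramp_int n has_real_derivative ramp n x) (at x)"
proof -
  have *: "((\<lambda>x::real. (max 0 (x - c))\<^sup>2) has_real_derivative 2 * max 0 (x - c) * 1) (at x)" for c
    by (rule DERIV_chain2[OF has_derivative_max_0_squared]) (auto intro!: derivative_eq_intros)
  have "((\<lambda>x. real (Suc n) / 2 * ((max 0 (x - 0))\<^sup>2 - (max 0 (x - 1 / real (Suc n)))\<^sup>2))
     has_real_derivative real (Suc n) / 2 * (2 * max 0 (x - 0) * 1 - 2 * max 0 (x - 1 / real (Suc n)) * 1)) (at x)"
    by (intro DERIV_cmult DERIV_diff *)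
  moreover have "k / 2 * (2 * A * 1 - 2 * B * 1) = k * (A - B)" for k A B :: real
    by (simp add: field_simps)
  ultimately show ?thesis
    unfolding ramp_int_def[abs_def] ramp_def by (simp only: diff_zero)
qed

text \<open>Past its rise, \<open>ramp n\<close> is 1, so the antiderivative is a line of slope 1.
  Its offset is half the width of the rise and is the same for all shifted ramps, so it cancels in
  combinations whose coefficients sum to 0.\<close>

lemma ramp_int_large: "x \<ge> 1 / real (Suc n) \<Longrightarrow> ramp_int n x = x - 1 / (2 * real (Suc n))"
proof -
  assume x: "x \<ge> 1 / real (Suc n)"
  have "1 / real (Suc n) > 0" by simp
  with x have mx: "max 0 x = x" "max 0 (x - 1 / real (Suc n)) = x - 1 / real (Suc n)" by linarith+
  have "k / 2 * (x\<^sup>2 - (x - 1 / k)\<^sup>2) = x - 1 / (2 * k)" if "k > 0" for k :: real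
    using that by (simp add: power2_eq_square field_simps)
  then show ?thesis
    unfolding ramp_int_def mx by (simp only: of_nat_0_less_iff zero_less_Suc)
qed

lemma ramp_int_nonpos: "x \<le> 0 \<Longrightarrow> ramp_int n x = 0"
proof -
  assume x: "x \<le> 0"
  have "1 / real (Suc n) > 0" by simp
  with x have "max 0 x = 0" "max 0 (x - 1 / real (Suc n)) = 0" by linarith+
  then show ?thesis by (simp only: ramp_int_def) simp
qed

lemma ramp_bounds: "0 \<le> ramp n x" "ramp n x \<le> 1"
proof -
  define e where "e = 1 / real (Suc n)"
  have e: "e > 0" "real (Suc n) * e = 1" by (simp_all add: e_def del: of_nat_Suc)
  have "0 \<le> max 0 x - max 0 (x - e)" "max 0 x - max 0 (x - e) \<le> e" using e(1) by linarith+
  then have "real (Suc n) * 0 \<le> real (Suc n) * (max 0 x - max 0 (x - e))"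
    "real (Suc n) * (max 0 x - max 0 (x - e)) \<le> real (Suc n) * e"
    by (intro mult_left_mono; simp)+
  then show "0 \<le> ramp n x" "ramp n x \<le> 1"
    unfolding e(2) by (simp_all only: ramp_def e_def mult_zero_right)
qed

lemma ramp_tendsto: "(\<lambda>n. ramp n x) \<longlonglongrightarrow> indicator {0<..} x"
proof (cases "x > 0")
  case True
  then obtain N where N: "inverse (real (Suc N)) < x" using reals_Archimedean by blast
  have "ramp n x = 1" if "n \<ge> N" for n
  proof -
    have "1 / real (Suc n) \<le> inverse (real (Suc N))" using that by (simp add: field_simps)
    then have "max 0 (x - 1 / real (Suc n)) = x - 1 / real (Suc n)" "max 0 x = x"
      using N True by linarith+
    then have "ramp n x = real (Suc n) * (1 / real (Suc n))" by (simp only: ramp_def) simp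
    then show ?thesis by simp
  qed
  then show ?thesis using True
    by (intro tendsto_eventually) (auto simp: eventually_sequentially)
next
  case False
  have "ramp n x = 0" for n
  proof -
    have "1 / real (Suc n) > 0" by simp
    with False have "max 0 x = 0" "max 0 (x - 1 / real (Suc n)) = 0" by linarith+
    then show ?thesis by (simp only: ramp_def) simp
  qed
  then show ?thesis using False by simp
qed

lemma continuous_on_ramp: "continuous_on S (ramp n)"
  unfolding ramp_def[abs_def] by (intro continuous_intros)

text \<open>Left of all \<open>c k\<close> every term is 0. Right of all rises the sum is
  \<open>(x - d) * \<Sum>A k - \<Sum>A k * c k\<close> with a common offset \<open>d\<close>, and
  the two conditions on \<open>A\<close> make it vanish. The condition on \<open>n\<close> lets
  every rise end before \<open>b\<close>.\<close>

lemma test_function_ramp_combination: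
  assumes c: "\<And>k. k \<in> I \<Longrightarrow> c k \<in> {a<..<b}" and I: "finite I" "I \<noteq> {}"
    and A: "(\<Sum>k\<in>I. A k) = 0" "(\<Sum>k\<in>I. A k * c k) = 0"
    and n: "\<And>k. k \<in> I \<Longrightarrow> c k + 1 / real (Suc n) < b"
  shows "test_function a b (\<lambda>x. \<Sum>k\<in>I. A k * ramp_int n (x - c k))"
    and "deriv (\<lambda>x. \<Sum>k\<in>I. A k * ramp_int n (x - c k)) x = (\<Sum>k\<in>I. A k * ramp n (x - c k))"
proof -
  let ?\<phi> = "\<lambda>x. \<Sum>k\<in>I. A k * ramp_int n (x - c k)"
  have shift: "((\<lambda>x. ramp_int n (x - c k)) has_real_derivative ramp n (x - c k)) (at x)" for k x
  proof -
    have "((\<lambda>x. x - c k) has_real_derivative 1) (at x)" by (auto intro!: derivative_eq_intros)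
    from DERIV_chain2[OF has_derivative_ramp_int this] show ?thesis by simp
  qed
  have D: "(?\<phi> has_real_derivative (\<Sum>k\<in>I. A k * ramp n (x - c k))) (at x)" for x
    by (intro DERIV_sum DERIV_cmult shift)
  then show "deriv ?\<phi> x = (\<Sum>k\<in>I. A k * ramp n (x - c k))" by (rule DERIV_imp_deriv)
  define m M where "m = Min (c ` I)" "M = Max (c ` I) + 1 / real (Suc n)"
  have mM: "a < m" "M < b" "\<And>k. k \<in> I \<Longrightarrow> m \<le> c k" "\<And>k. k \<in> I \<Longrightarrow> c k + 1 / real (Suc n) \<le> M"
  proof -
    have "m \<in> c ` I" "Max (c ` I) \<in> c ` I" unfolding m_M_def using I by (auto intro!: Min_in Max_in)
    then show "a < m" "M < b" using c n unfolding m_M_def(2) by (auto simp del: of_nat_Suc)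
    show "m \<le> c k" "c k + 1 / real (Suc n) \<le> M" if "k \<in> I" for k
      using I that by (auto simp: m_M_def)
  qed
  have "?\<phi> x = 0" if "x \<notin> {m..M}" for x
  proof (cases "x < m")
    case True
    then show ?thesis using mM by (intro sum.neutral) (force simp: ramp_int_nonpos)
  next
    case False
    then have "x > M" using that by auto
    then have "?\<phi> x = (\<Sum>k\<in>I. A k * (x - c k - 1 / (2 * real (Suc n))))"
      using mM by (intro sum.cong refl) (force simp: ramp_int_large simp del: of_nat_Suc)
    also have "\<dots> = (x - 1 / (2 * real (Suc n))) * (\<Sum>k\<in>I. A k) - (\<Sum>k\<in>I. A k * c k)"
      by (simp add: sum_distrib_left sum_subtractf sum.distrib sum_divide_distrib algebra_simps del: of_nat_Suc)
    finally show ?thesis using A by simp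
  qed
  then have "{x. ?\<phi> x \<noteq> 0} \<subseteq> {m..M}" by blast
  then have sub: "closure {x. ?\<phi> x \<noteq> 0} \<subseteq> {m..M}" by (simp add: closure_minimal)
  then have "compact (closure {x. ?\<phi> x \<noteq> 0})"
    by (meson bounded_closed_interval bounded_subset closed_closure compact_eq_bounded_closed)
  moreover have "?\<phi> C1_differentiable_on UNIV"
    unfolding C1_differentiable_on_def
    using D by (intro exI[of _ "\<lambda>x. \<Sum>k\<in>I. A k * ramp n (x - c k)"] conjI)
      (auto simp: has_real_derivative_iff_has_vector_derivative
         intro!: continuous_intros continuous_on_compose2[OF continuous_on_ramp[of UNIV]])
  ultimately show "test_function a b ?\<phi>"
    using sub mM by (force simp: test_function_def)
qed

lemma AE_lebesgue_on_Icc_iff_Ioo: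
  fixes a b :: real
  shows "(AE s in lebesgue_on {a..b}. P s) \<longleftrightarrow> (AE s in lebesgue_on {a<..<b}. P s)"
proof -
  have "negligible {a, b}" by simp
  then have "AE s in lebesgue. s \<notin> {a, b}"
    by (simp only: negligible_iff_null_sets AE_not_in)
  then have "(AE s in lebesgue. s \<in> {a..b} \<longrightarrow> P s) \<longleftrightarrow> (AE s in lebesgue. s \<in> {a<..<b} \<longrightarrow> P s)"
    by (intro eventually_subst) (erule eventually_mono, auto)
  then show ?thesis
    by (simp add: AE_restrict_space_iff)
qed

lemma continuous_on_UNIV_borel_measurable_lebesgue_on:
  fixes f :: "real \<Rightarrow> real"
  shows "continuous_on UNIV f \<Longrightarrow> f \<in> borel_measurable (lebesgue_on S)"
  by (intro measurable_restrict_space1 measurable_completion) (simp add: borel_measurable_continuous_onI)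

text \<open>Integration by parts where one factor is only a primitive of an integrable function.
  Fubini on the triangle \<open>r \<le> s\<close> replaces the product rule: the inner integral
  becomes that of \<open>deriv \<phi>\<close> over \<open>{r..b}\<close>, which is
  \<open>- \<phi> r\<close> since \<open>\<phi>\<close> vanishes at \<open>b\<close>.\<close>

lemma integral_deriv_test_function_times_indefinite_integral:
  fixes v :: "real \<Rightarrow> real"
  assumes v: "integrable (lebesgue_on {a..b}) v" and \<phi>: "test_function a b \<phi>"
  shows "(LINT s|lebesgue_on {a..b}. deriv \<phi> s * integral {a..s} v) = - (LINT s|lebesgue_on {a..b}. \<phi> s * v s)"
proof -
  define M where "M = lebesgue_on {a..b}"
  note D = test_functionD[OF \<phi>]
  have zero: "\<phi> b = 0" using D(3) by auto
  have [measurable]: "deriv \<phi> \<in> borel_measurable M" "(\<lambda>x. x) \<in> borel_measurable M"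
    unfolding M_def using D(2)
    by (auto intro!: continuous_on_UNIV_borel_measurable_lebesgue_on continuous_on_id)
  have v': "integrable M v" using v by (simp add: M_def)
  then have [measurable]: "v \<in> borel_measurable M" by auto
  interpret finite_measure M
    unfolding M_def by (rule finite_measure_lebesgue_on) simp
  interpret pair_sigma_finite M M ..
  have d: "integrable M (deriv \<phi>)"
    unfolding M_def using continuous_imp_integrable_real[of a b "deriv \<phi>"] D(2) continuous_on_subset by blast
  \<comment> \<open>On the square the integrand is a product of two integrable functions of separate
    variables; it dominates the integrand on the triangle and so justifies the exchange of
    integrals.\<close>
  have g: "integrable (M \<Otimes>\<^sub>M M) (\<lambda>p. deriv \<phi> (fst p) * v (snd p))"
    by (rule Fubini_integrable) (use d v' in \<open>auto simp: abs_mult\<close>)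
  have f: "integrable (M \<Otimes>\<^sub>M M) (\<lambda>(s, r). deriv \<phi> s * (if r \<in> {..s} then v r else 0))"
  proof (rule Bochner_Integration.integrable_bound[OF g])
    show "(\<lambda>(s, r). deriv \<phi> s * (if r \<in> {..s} then v r else 0)) \<in> borel_measurable (M \<Otimes>\<^sub>M M)"
      unfolding atMost_iff by measurable
    show "AE p in M \<Otimes>\<^sub>M M. norm (case p of (s, r) \<Rightarrow> deriv \<phi> s * (if r \<in> {..s} then v r else 0))
        \<le> norm (deriv \<phi> (fst p) * v (snd p))"
      by (rule AE_I2) (auto split: prod.split)
  qed
  have "(LINT s|M. deriv \<phi> s * integral {a..s} v) = (LINT s|M. LINT r|M. deriv \<phi> s * (if r \<in> {..s} then v r else 0))"
  proof (rule Bochner_Integration.integral_cong[OF refl])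
    fix s assume "s \<in> space M"
    then have s: "s \<in> {a..b}" by (simp add: M_def)
    have "integrable M (\<lambda>r. if r \<in> {..s} then v r else 0)"
      by (rule Bochner_Integration.integrable_bound[OF v']) auto
    then have "(LINT r|M. (if r \<in> {..s} then v r else 0)) = integral {a..b} (\<lambda>r. if r \<in> {..s} then v r else 0)"
      unfolding M_def by (intro lebesgue_integral_eq_integral) auto
    also have "\<dots> = integral ({..s} \<inter> {a..b}) v" by (rule integral_restrict_Int)
    also have "{..s} \<inter> {a..b} = {a..s}" using s by auto
    finally show "deriv \<phi> s * integral {a..s} v = (LINT r|M. deriv \<phi> s * (if r \<in> {..s} then v r else 0))"
      by simp
  qed
  also have "\<dots> = (LINT r|M. LINT s|M. deriv \<phi> s * (if r \<in> {..s} then v r else 0))"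
    using Fubini_integral[OF f] by simp
  also have "\<dots> = (LINT r|M. - (\<phi> r * v r))"
  proof (rule Bochner_Integration.integral_cong[OF refl])
    fix r assume "r \<in> space M"
    then have r: "r \<in> {a..b}" by (simp add: M_def)
    have "integrable M (\<lambda>s. if s \<in> {r..} then deriv \<phi> s else 0)"
      by (rule Bochner_Integration.integrable_bound[OF d]) auto
    then have "(LINT s|M. (if s \<in> {r..} then deriv \<phi> s else 0)) = integral {a..b} (\<lambda>s. if s \<in> {r..} then deriv \<phi> s else 0)"
      unfolding M_def by (intro lebesgue_integral_eq_integral) auto
    also have "\<dots> = integral ({r..} \<inter> {a..b}) (deriv \<phi>)" by (rule integral_restrict_Int)
    also have "{r..} \<inter> {a..b} = {r..b}" using r by auto
    also have "integral {r..b} (deriv \<phi>) = \<phi> b - \<phi> r"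
      using r D(1) by (intro integral_unique fundamental_theorem_of_calculus)
        (auto simp: has_real_derivative_iff_has_vector_derivative[symmetric] intro: has_field_derivative_at_within)
    finally have "(LINT s|M. (if s \<in> {r..} then deriv \<phi> s else 0)) = - \<phi> r" using zero by simp
    moreover have "deriv \<phi> s * (if r \<in> {..s} then v r else 0) = v r * (if s \<in> {r..} then deriv \<phi> s else 0)" for s
      by simp
    ultimately show "(LINT s|M. deriv \<phi> s * (if r \<in> {..s} then v r else 0)) = - (\<phi> r * v r)"
      by (simp del: atLeast_iff atMost_iff mult_cancel_left mult_eq_0_iff)
  qed
  finally show ?thesis by (simp add: M_def)
qed

text \<open>In the limit of Heaviside functions the hypothesis becomes a linear relation between the
  values of the primitive \<open>Z\<close> of \<open>w\<close> at two fixed points and an arbitrary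
  third one. It says that \<open>Z\<close> is affine on the open interval, so \<open>w\<close>, its
  derivative almost everywhere, is constant.\<close>

lemma integral_deriv_test_function_zero_imp_AE_const:
  fixes w :: "real \<Rightarrow> real"
  assumes w: "integrable (lebesgue_on {a..b}) w" and ab: "a < b"
    and weak: "\<And>\<phi>. test_function a b \<phi> \<Longrightarrow> (LINT s|lebesgue_on {a..b}. deriv \<phi> s * w s) = 0"
  shows "\<exists>c. AE s in lebesgue_on {a..b}. w s = c"
proof -
  define M where "M = lebesgue_on {a..b}"
  define Z where "Z = (\<lambda>x. integral {a..x} w)"
  \<comment> \<open>Two anchors inside the interval, at one third and two thirds. What counts is
    that they differ, since \<open>c2 - c1\<close> becomes a denominator.\<close>
  define c1 c2 where "c1 = (2 * a + b) / 3" "c2 = (a + 2 * b) / 3"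
  have c12: "a < c1" "c1 < c2" "c2 < b" using ab by (auto simp: c1_c2_def)
  have wM: "integrable M w" using w by (simp add: M_def)
  then have [measurable]: "w \<in> borel_measurable M" by auto
  have wi: "w integrable_on {a..b}" by (rule integrable_on_lebesgue_on[OF w]) simp
  have [measurable]: "(\<lambda>x. x) \<in> borel_measurable M"
    unfolding M_def by (intro continuous_on_UNIV_borel_measurable_lebesgue_on continuous_on_id)
  have [measurable]: "ramp n \<in> borel_measurable borel" for n
    by (intro borel_measurable_continuous_onI continuous_on_ramp)
  have Z: "(LINT s|M. indicator {0<..} (s - c) * w s) = Z b - Z c"
    and Zi: "integrable M (\<lambda>s. indicator {0<..} (s - c) * w s)" if c: "c \<in> {a<..<b}" for c
  proof -
    have "integrable M (\<lambda>s. indicator {0<..} (s - c) * w s)"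
      by (rule Bochner_Integration.integrable_bound[OF wM]) (auto simp: indicator_def)
    then show i: "integrable M (\<lambda>s. indicator {0<..} (s - c) * w s)" .
    have "(LINT s|M. indicator {0<..} (s - c) * w s) = integral {a..b} (\<lambda>s. indicator {0<..} (s - c) * w s)"
      using i unfolding M_def by (intro lebesgue_integral_eq_integral) auto
    also have "\<dots> = integral {a..b} (\<lambda>s. if s \<in> {c<..} then w s else 0)"
      by (intro Henstock_Kurzweil_Integration.integral_cong) (auto simp: indicator_def)
    also have "\<dots> = integral ({c<..} \<inter> {a..b}) w" by (rule integral_restrict_Int)
    also have "\<dots> = integral {c..b} w"
      by (rule integral_spike_set; rule negligible_subset[of "{c}"]) (use c in auto)
    also have "\<dots> = Z b - Z c"
      unfolding Z_def using c Henstock_Kurzweil_Integration.integral_combine[of a c b w] wi by auto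
    finally show "(LINT s|M. indicator {0<..} (s - c) * w s) = Z b - Z c" .
  qed
  have lin: "(c2 - x) * Z c1 + (x - c1) * Z c2 = (c2 - c1) * Z x" if x: "x \<in> {a<..<b}" for x
  proof -
    \<comment> \<open>The weights of the second divided difference at \<open>c1\<close>,
      \<open>c2\<close>, \<open>x\<close>, cleared of denominators; thus \<open>x\<close> may
      coincide with an anchor.\<close>
    define A where "A = (\<lambda>k::nat. if k = 0 then c2 - x else if k = 1 then x - c1 else c1 - c2)"
    define c where "c = (\<lambda>k::nat. if k = 0 then c1 else if k = 1 then c2 else x)"
    define I where "I = {0, 1, 2::nat}"
    have sumI: "(\<Sum>k\<in>I. h k) = h 0 + h 1 + h 2" for h :: "nat \<Rightarrow> real"
      by (simp add: I_def)
    have cI: "c k \<in> {a<..<b}" for k using c12 x by (auto simp: c_def)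
    define m where "m = max c2 x"
    have "m < b" using c12 x by (auto simp: m_def)
    then obtain N where N: "inverse (real (Suc N)) < b - m" using reals_Archimedean[of "b - m"] by auto
    define F where "F = (\<lambda>n s. (\<Sum>k\<in>I. A k * ramp n (s - c k)) * w s)"
    have F0: "(LINT s|M. F n s) = 0" if n: "n \<ge> N" for n
    proof -
      have "1 / real (Suc n) \<le> inverse (real (Suc N))" using n by (simp add: field_simps)
      then have nn: "c k + 1 / real (Suc n) < b" for k using N c12 by (auto simp: c_def m_def)
      have A0: "(\<Sum>k\<in>I. A k) = 0" "(\<Sum>k\<in>I. A k * c k) = 0"
        by (simp_all add: sumI A_def c_def algebra_simps)
      have I: "finite I" "I \<noteq> {}" by (auto simp: I_def)
      from weak[OF test_function_ramp_combination(1)[OF cI I A0 nn]] show ?thesis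
        unfolding F_def M_def test_function_ramp_combination(2)[OF cI I A0 nn] .
    qed
    have "(\<lambda>n. LINT s|M. F n s) \<longlonglongrightarrow> (LINT s|M. (\<Sum>k\<in>I. A k * indicator {0<..} (s - c k)) * w s)"
    proof (rule integral_dominated_convergence[where w = "\<lambda>s. (\<Sum>k\<in>I. \<bar>A k\<bar>) * \<bar>w s\<bar>"])
      show "AE s in M. (\<lambda>n. F n s) \<longlonglongrightarrow> (\<Sum>k\<in>I. A k * indicator {0<..} (s - c k)) * w s"
        unfolding F_def by (intro AE_I2 tendsto_intros ramp_tendsto)
      show "AE s in M. norm (F n s) \<le> (\<Sum>k\<in>I. \<bar>A k\<bar>) * \<bar>w s\<bar>" for n
      proof (rule AE_I2)
        fix s
        have "\<bar>\<Sum>k\<in>I. A k * ramp n (s - c k)\<bar> \<le> (\<Sum>k\<in>I. \<bar>A k * ramp n (s - c k)\<bar>)" by (rule sum_abs)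
        also have "\<dots> \<le> (\<Sum>k\<in>I. \<bar>A k\<bar>)"
          using ramp_bounds[of n] by (intro sum_mono) (simp add: abs_mult mult_left_le)
        finally show "norm (F n s) \<le> (\<Sum>k\<in>I. \<bar>A k\<bar>) * \<bar>w s\<bar>"
          by (simp add: F_def abs_mult mult_right_mono)
      qed
      show "integrable M (\<lambda>s. (\<Sum>k\<in>I. \<bar>A k\<bar>) * \<bar>w s\<bar>)" using wM by auto
    qed (unfold F_def, measurable)
    moreover have "(\<lambda>n. LINT s|M. F n s) \<longlonglongrightarrow> 0"
      using F0 by (intro tendsto_eventually) (auto simp: eventually_sequentially)
    ultimately have "(LINT s|M. (\<Sum>k\<in>I. A k * indicator {0<..} (s - c k)) * w s) = 0"
      using LIMSEQ_unique by blast
    moreover have "(LINT s|M. (\<Sum>k\<in>I. A k * indicator {0<..} (s - c k)) * w s)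
        = (\<Sum>k\<in>I. A k * (Z b - Z (c k)))"
      using Z[OF cI] Zi[OF cI]
      by (simp add: sum_distrib_right mult.assoc Bochner_Integration.integral_sum)
    ultimately have "(c2 - x) * (Z b - Z c1) + (x - c1) * (Z b - Z c2) + (c1 - c2) * (Z b - Z x) = 0"
      by (simp add: sumI A_def c_def)
    then show ?thesis by (simp add: algebra_simps)
  qed
  define \<beta> where "\<beta> = (Z c2 - Z c1) / (c2 - c1)"
  have Zx: "Z x = (c2 * Z c1 - c1 * Z c2) / (c2 - c1) + \<beta> * x" if x: "x \<in> {a<..<b}" for x
  proof -
    have "Z x = ((c2 - x) * Z c1 + (x - c1) * Z c2) / (c2 - c1)"
      using lin[OF x] c12(2) by (simp add: nonzero_eq_divide_eq mult.commute)
    also have "(c2 - x) * Z c1 + (x - c1) * Z c2 = (c2 * Z c1 - c1 * Z c2) + (Z c2 - Z c1) * x"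
      by (simp add: algebra_simps)
    finally show ?thesis by (simp add: \<beta>_def add_divide_distrib)
  qed
  have Zd: "(Z has_real_derivative \<beta>) (at x)" if x: "x \<in> {a<..<b}" for x
  proof (rule has_field_derivative_transform_within_open[where S = "{a<..<b}"])
    show "((\<lambda>x. (c2 * Z c1 - c1 * Z c2) / (c2 - c1) + \<beta> * x) has_real_derivative \<beta>) (at x)"
      by (auto intro!: derivative_eq_intros)
  qed (use Zx x in auto)
  have "{x \<in> {a<..<b}. w x \<noteq> \<beta>} \<subseteq> {x\<in>{a<..<b}. \<not> ((\<lambda>u. integral {a..u} w) has_real_derivative w x) (at x)}"
    using Zd DERIV_unique unfolding Z_def by blast
  then have "negligible {x \<in> {a<..<b}. w x \<noteq> \<beta>}"
    using lebesgue_differentiation_real[OF wi] negligible_subset by blast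
  then have "AE x in lebesgue. x \<notin> {x \<in> {a<..<b}. w x \<noteq> \<beta>}"
    by (simp only: negligible_iff_null_sets AE_not_in)
  then have "AE x in lebesgue_on {a<..<b}. w x = \<beta>"
    by (simp add: AE_restrict_space_iff) (erule eventually_mono, auto)
  then show ?thesis using AE_lebesgue_on_Icc_iff_Ioo by blast
qed

text \<open>The primitive of \<open>v\<close> has weak derivative \<open>v\<close> by the
  integration by parts above; subtracting it from \<open>u\<close> reduces the claim to weak
  derivative 0.\<close>

lemma weak_derivative_imp_AE_indefinite_integral:
  fixes u v :: "real \<Rightarrow> real"
  assumes u: "integrable (lebesgue_on {a..b}) u" and v: "integrable (lebesgue_on {a..b}) v" and ab: "a < b"
    and weak: "\<And>\<phi>. test_function a b \<phi> \<Longrightarrow>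
      (LINT s|lebesgue_on {a..b}. deriv \<phi> s * u s) = - (LINT s|lebesgue_on {a..b}. \<phi> s * v s)"
  shows "\<exists>c. AE s in lebesgue_on {a..b}. u s = c + integral {a..s} v"
proof -
  have "v integrable_on {a..b}" by (rule integrable_on_lebesgue_on[OF v]) simp
  then have c: "continuous_on {a..b} (\<lambda>s. integral {a..s} v)" by (rule indefinite_integral_continuous_1)
  then have W: "integrable (lebesgue_on {a..b}) (\<lambda>s. integral {a..s} v)" by (rule continuous_imp_integrable_real)
  have "\<exists>c. AE s in lebesgue_on {a..b}. u s - integral {a..s} v = c"
  proof (rule integral_deriv_test_function_zero_imp_AE_const[OF _ ab])
    show "integrable (lebesgue_on {a..b}) (\<lambda>s. u s - integral {a..s} v)" using u W by auto
    fix \<phi> assume \<phi>: "test_function a b \<phi>"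
    note D = test_functionD[OF \<phi>]
    have cd: "continuous_on {a..b} (deriv \<phi>)" using D(2) continuous_on_subset by blast
    have "bounded (deriv \<phi> ` {a..b})"
      using cd by (intro compact_imp_bounded compact_continuous_image) auto
    moreover have "deriv \<phi> \<in> borel_measurable (lebesgue_on {a..b})"
      using D(2) by (rule continuous_on_UNIV_borel_measurable_lebesgue_on)
    ultimately have "(\<lambda>s. deriv \<phi> s * u s) absolutely_integrable_on {a..b}"
      using u by (intro absolutely_integrable_bounded_measurable_product_real)
        (auto simp: set_integrable_def integrable_restrict_space)
    then have 1: "integrable (lebesgue_on {a..b}) (\<lambda>s. deriv \<phi> s * u s)"
      by (rule absolutely_integrable_imp_integrable) simp
    have 2: "integrable (lebesgue_on {a..b}) (\<lambda>s. deriv \<phi> s * integral {a..s} v)"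
      by (intro continuous_imp_integrable_real continuous_on_mult cd c)
    show "(LINT s|lebesgue_on {a..b}. deriv \<phi> s * (u s - integral {a..s} v)) = 0"
      unfolding right_diff_distrib Bochner_Integration.integral_diff[OF 1 2]
      using weak[OF \<phi>] integral_deriv_test_function_times_indefinite_integral[OF v \<phi>] by simp
  qed
  then obtain c where "AE s in lebesgue_on {a..b}. u s - integral {a..s} v = c" by blast
  then have "AE s in lebesgue_on {a..b}. u s = c + integral {a..s} v" by (rule eventually_mono) auto
  then show ?thesis by blast
qed

section \<open>The Euler--Lagrange equation on a half-line\<close>

lemma powr_diff_one_le:
  fixes a p :: real
  assumes "1 < p" "0 \<le> a"
  shows "a powr (p - 1) \<le> a powr p + 1"
proof (cases "a \<le> 1")
  case True
  then have "a powr (p - 1) \<le> 1" using assms by (intro powr_le1) auto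
  then show ?thesis using powr_ge_zero[of a p] by linarith
next
  case False
  then have "a powr (p - 1) \<le> a powr p" by (intro powr_mono) auto
  then show ?thesis by simp
qed

lemma le_powr_add_one:
  fixes a p :: real
  assumes "1 < p" "0 \<le> a"
  shows "a \<le> a powr p + 1"
proof (cases "a \<le> 1")
  case True
  then show ?thesis using powr_ge_zero[of a p] by linarith
next
  case False
  then have "a powr 1 \<le> a powr p" using assms by (intro powr_mono) auto
  then show ?thesis using False by simp
qed

lemma powr_add_le:
  fixes a b p :: real
  assumes "0 \<le> p" "0 \<le> a" "0 \<le> b"
  shows "(a + b) powr p \<le> 2 powr p * (a powr p + b powr p)"
proof -
  have "(a + b) powr p \<le> (2 * max a b) powr p"
    using assms by (intro powr_mono2) auto
  also have "\<dots> = 2 powr p * max a b powr p" using assms by (simp add: powr_mult)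
  also have "max a b powr p \<le> a powr p + b powr p" by (auto simp: max_def)
  finally show ?thesis by simp
qed

text \<open>The data are continuous only for nonnegative first argument and times in
  \<open>{0..T}\<close>. Clamping the arguments to this set extends them continuously to the whole
  space without changing the values along \<open>z\<close>, so they can be composed as Borel
  functions.\<close>

lemma borel_measurable_continuous_data:
  fixes F :: "real \<times> real \<times> real \<Rightarrow> real" and z a :: "real \<Rightarrow> real"
  assumes F: "continuous_on ({0..} \<times> UNIV \<times> {0..T}) F" and T: "0 \<le> T"
    and z: "z \<in> borel_measurable (lebesgue_on S)" and a: "a \<in> borel_measurable (lebesgue_on S)"
    and S: "S \<subseteq> {0..T}" and nonneg: "\<And>s. s \<in> S \<Longrightarrow> 0 \<le> z s"
  shows "(\<lambda>s. F (z s, a s, s)) \<in> borel_measurable (lebesgue_on S)"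
proof -
  define c :: "real \<times> real \<times> real \<Rightarrow> real \<times> real \<times> real"
    where "c = (\<lambda>x. (max 0 (fst x), fst (snd x), max 0 (min T (snd (snd x)))))"
  have "continuous_on UNIV c" unfolding c_def by (intro continuous_intros)
  then have "continuous_on UNIV (\<lambda>x. F (c x))"
    by (rule continuous_on_compose2[OF F]) (use T in \<open>auto simp: c_def\<close>)
  then have Fc[measurable]: "(\<lambda>x. F (c x)) \<in> borel_measurable borel"
    by (rule borel_measurable_continuous_onI)
  have s: "(\<lambda>s. s) \<in> borel_measurable (lebesgue_on S)"
    by (intro continuous_on_UNIV_borel_measurable_lebesgue_on continuous_on_id)
  have "(\<lambda>s. F (c (z s, a s, s))) \<in> borel_measurable (lebesgue_on S)"
    using z a s by (intro measurable_compose[OF _ Fc] borel_measurable_Pair)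
  then show ?thesis
    by (rule measurable_cong[THEN iffD1, rotated]) (use S nonneg T in \<open>force simp: c_def max_absorb2 min_absorb2\<close>)
qed

section \<open>Strict convexity\<close>

lemma strictly_convex_imp_convex_on:
  "strictly_convex f \<Longrightarrow> convex_on UNIV f"
proof (rule convex_onI)
  fix t x y :: real assume f: "strictly_convex f" and t: "0 < t" "t < 1"
  show "f ((1 - t) *\<^sub>R x + t *\<^sub>R y) \<le> (1 - t) * f x + t * f y"
  proof (cases "x = y")
    case True
    have "(1 - t) * y + t * y = y" "(1 - t) * f y + t * f y = f y" by (simp_all add: algebra_simps)
    then show ?thesis using True by simp
  next
    case False
    then have "f ((1 - t) * x + t * y) < (1 - t) * f x + t * f y"
      using f t unfolding strictly_convex_def by blast
    then show ?thesis by simp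
  qed
qed simp

text \<open>With the same slope at \<open>a\<close> and \<open>b\<close>, the two tangent
  inequalities force \<open>f b\<close> onto the tangent line at \<open>a\<close>. Strict convexity
  then puts the value at the midpoint below this line, against the tangent inequality there.\<close>

lemma strictly_convex_deriv_inj:
  fixes f :: "real \<Rightarrow> real"
  assumes f: "strictly_convex f" and d: "(f has_real_derivative m) (at a)" "(f has_real_derivative m) (at b)"
  shows "a = b"
proof (rule ccontr)
  assume ab: "a \<noteq> b"
  have tangent: "m * (y - x) \<le> f y - f x" if "(f has_real_derivative m) (at x)" for x y
    by (rule convex_on_imp_above_tangent[OF strictly_convex_imp_convex_on[OF f]]) (use that in auto)
  have "m * (b - a) \<le> f b - f a" "m * (a - b) \<le> f a - f b"
    using tangent d by auto
  then have e: "f b = f a + m * (b - a)" by (simp add: algebra_simps)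
  have "f ((1 - 1/2) * a + 1/2 * b) < (1 - 1/2) * f a + 1/2 * f b"
    using f[unfolded strictly_convex_def, rule_format, OF ab, of "1/2"] by simp
  moreover have "m * ((1 - 1/2) * a + 1/2 * b - a) \<le> f ((1 - 1/2) * a + 1/2 * b) - f a"
    using tangent d(1) by blast
  ultimately show False using e by (simp add: field_simps)
qed

text \<open>A single edge in isolation: the variational argument becomes one about a real function,
  the distance to the vertex, with \<open>f\<close> as the Lagrangian of the edge.\<close>

locale lagrangian =
  fixes p T :: real and f :: "real \<Rightarrow> real \<Rightarrow> real \<Rightarrow> real"
  assumes p: "1 < p" and T: "0 < T"
    and f_cont: "continuous_on ({0..} \<times> UNIV \<times> {0..T}) (\<lambda>(z, a, s). f z a s)"
    and f_diff: "\<And>s. s \<in> {0..T} \<Longrightarrow> (\<lambda>(z, a). f z a s) differentiable_on ({0..} \<times> UNIV)"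
    and f_y_cont: "continuous_on ({0..} \<times> UNIV \<times> {0..T}) (\<lambda>(z, a, s). partial_y f z a s)"
    and f_a_cont: "continuous_on ({0..} \<times> UNIV \<times> {0..T}) (\<lambda>(z, a, s). partial_a f z a s)"
    and f_lower: "\<exists>C0>0. \<forall>z\<ge>0. \<forall>a. \<forall>s\<in>{0..T}. f z a s \<ge> C0 * (\<bar>a\<bar> powr p - 1)"
    and f_growth: "\<And>r. r > 0 \<Longrightarrow> \<exists>c\<ge>0. \<forall>z\<in>{0..r}. \<forall>a. \<forall>s\<in>{0..T}.
               \<bar>partial_y f z a s\<bar> \<le> c * (\<bar>a\<bar> powr p + 1) \<and>
               \<bar>partial_a f z a s\<bar> \<le> c * (\<bar>a\<bar> powr (p - 1) + 1)"
    and f_convex: "\<And>z s. z \<ge> 0 \<Longrightarrow> s \<in> {0..T} \<Longrightarrow> strictly_convex (\<lambda>a. f z a s)"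
begin

text \<open>The total derivative is taken within the half-plane, whereas the partial derivatives are
  defined along lines. Composition with the two coordinate lines through \<open>(z, a)\<close>
  identifies them as the values of \<open>D\<close> at the basis vectors.\<close>

lemma partials_eq_derivative:
  assumes z: "0 \<le> z" and D: "((\<lambda>(z, a). f z a s) has_derivative D) (at (z, a) within {0..} \<times> UNIV)"
  shows "((\<lambda>a. f z a s) has_real_derivative partial_a f z a s) (at a)"
    and "D (h, k) = h * partial_y f z a s + k * partial_a f z a s"
proof -
  interpret D: bounded_linear D using D by (rule has_derivative_bounded_linear)
  have D1: "D (h, 0) = h *\<^sub>R D (1, 0)" and D2: "D (0, k) = k *\<^sub>R D (0, 1)" for h k
    using D.scaleR[of h "(1, 0)"] D.scaleR[of k "(0, 1)"] by simp_all
  have D1': "(\<lambda>h. D (h, 0)) = (\<lambda>h. h *\<^sub>R D (1, 0))" by (rule ext) (rule D1)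
  have D2': "(\<lambda>k. D (0, k)) = (*) (D (0, 1))"
    by (rule ext) (subst D2, simp only: real_scaleR_def mult.commute)
  have "((\<lambda>b. case (z, b) of (z, a) \<Rightarrow> f z a s) has_derivative (\<lambda>k. D (0, k))) (at a)"
  proof (rule has_derivative_in_compose[where f = "\<lambda>b. (z, b)" and f' = "\<lambda>k. (0, k)"])
    show "((\<lambda>(z, a). f z a s) has_derivative D) (at (z, a) within range (Pair z))"
      by (rule has_derivative_subset[OF D]) (use z in auto)
  qed (auto intro!: derivative_eq_intros)
  then have a: "((\<lambda>a. f z a s) has_real_derivative D (0, 1)) (at a)"
    by (simp only: has_field_derivative_def prod.case D2')
  then have a': "partial_a f z a s = D (0, 1)"
    by (simp add: partial_a_def DERIV_imp_deriv)
  with a show "((\<lambda>a. f z a s) has_real_derivative partial_a f z a s) (at a)" by simp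
  have "((\<lambda>w. case (w, a) of (z, a) \<Rightarrow> f z a s) has_derivative (\<lambda>h. D (h, 0))) (at z within {0..})"
  proof (rule has_derivative_in_compose[where f = "\<lambda>w. (w, a)" and f' = "\<lambda>h. (h, 0)"])
    show "((\<lambda>(z, a). f z a s) has_derivative D) (at (z, a) within (\<lambda>w. (w, a)) ` {0..})"
      by (rule has_derivative_subset[OF D]) auto
  qed (auto intro!: derivative_eq_intros)
  then have y: "((\<lambda>w. f w a s) has_vector_derivative D (1, 0)) (at z within {0..})"
    by (simp only: prod.case has_vector_derivative_def D1')
  \<comment> \<open>No point of \<open>{0..}\<close> is isolated, so a derivative within this set is
    unique, also at \<open>z = 0\<close>. Only then does \<open>vector_derivative\<close> return the
    derivative found above.\<close>
  have "z islimpt {z..z + 1}" by simp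
  then have "z islimpt {0..}" by (rule islimpt_subset) (use z in auto)
  then have "at z within {0..} \<noteq> bot" by (simp add: trivial_limit_within)
  then have y': "partial_y f z a s = D (1, 0)"
    unfolding partial_y_def using y by (rule vector_derivative_within)
  have "D (h, k) = D (h, 0) + D (0, k)" using D.add[of "(h, 0)" "(0, k)"] by simp
  then show "D (h, k) = h * partial_y f z a s + k * partial_a f z a s"
    unfolding a' y' D1[of h] D2[of k] by simp
qed

lemma partial_a:
  assumes "0 \<le> z" "s \<in> {0..T}"
  shows "((\<lambda>a. f z a s) has_real_derivative partial_a f z a s) (at a)"
proof -
  have "(z, a) \<in> {0..} \<times> UNIV" using assms by simp
  with f_diff[OF assms(2)] obtain D where "((\<lambda>(z, a). f z a s) has_derivative D) (at (z, a) within {0..} \<times> UNIV)"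
    unfolding differentiable_on_def differentiable_def by blast
  from partials_eq_derivative(1)[OF assms(1) this] show ?thesis .
qed

text \<open>Off its boundary the half-plane is a neighbourhood of the point, so the derivative
  within it is a full one and the chain rule applies along the line in both directions.\<close>

lemma deriv_along_line:
  assumes z: "0 < z + \<theta> * h" and s: "s \<in> {0..T}"
  shows "((\<lambda>\<theta>. f (z + \<theta> * h) (a + \<theta> * k) s) has_real_derivative
     h * partial_y f (z + \<theta> * h) (a + \<theta> * k) s + k * partial_a f (z + \<theta> * h) (a + \<theta> * k) s) (at \<theta>)"
proof -
  let ?q = "(z + \<theta> * h, a + \<theta> * k)"
  have "?q \<in> {0..} \<times> UNIV" using z by simp
  with f_diff[OF s] obtain D where D: "((\<lambda>(z, a). f z a s) has_derivative D) (at ?q within {0..} \<times> UNIV)"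
    unfolding differentiable_on_def differentiable_def by blast
  have "?q \<in> interior ({0..} \<times> UNIV)" using z by (simp add: interior_Times)
  then have D': "((\<lambda>(z, a). f z a s) has_derivative D) (at ?q)"
    using D by (simp only: at_within_interior)
  have D_eq: "D (h', k') = h' * partial_y f (z + \<theta> * h) (a + \<theta> * k) s + k' * partial_a f (z + \<theta> * h) (a + \<theta> * k) s" for h' k'
    using partials_eq_derivative(2)[OF _ D] z by simp
  have "((\<lambda>\<theta>. (z + \<theta> * h, a + \<theta> * k)) has_derivative (\<lambda>t. (t * h, t * k))) (at \<theta>)"
    by (auto intro!: derivative_eq_intros)
  from has_derivative_compose[OF this D']
  have "((\<lambda>\<theta>. f (z + \<theta> * h) (a + \<theta> * k) s) has_derivative (\<lambda>t. D (t * h, t * k))) (at \<theta>)"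
    by simp
  moreover have "(\<lambda>t. D (t * h, t * k)) = (*) (h * partial_y f (z + \<theta> * h) (a + \<theta> * k) s + k * partial_a f (z + \<theta> * h) (a + \<theta> * k) s)"
    by (rule ext) (simp add: D_eq algebra_simps)
  ultimately show ?thesis by (simp only: has_field_derivative_def)
qed

text \<open>The growth of \<open>partial_a\<close> bounds the change from \<open>a = 0\<close> by a
  multiple of \<open>(|a|^(p-1) + 1) * |a|\<close>, hence of \<open>|a|^p + 1\<close>. At
  \<open>a = 0\<close> the values are bounded by compactness.\<close>

lemma upper_bound:
  assumes r: "r > 0"
  shows "\<exists>C\<ge>0. \<forall>z\<in>{0..r}. \<forall>a. \<forall>s\<in>{0..T}. \<bar>f z a s\<bar> \<le> C * (\<bar>a\<bar> powr p + 1)"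
proof -
  obtain c where c: "c \<ge> 0" "\<And>z a s. z \<in> {0..r} \<Longrightarrow> s \<in> {0..T} \<Longrightarrow> \<bar>partial_a f z a s\<bar> \<le> c * (\<bar>a\<bar> powr (p - 1) + 1)"
    using f_growth[OF r] by blast
  have "compact ({0..r} \<times> {0} \<times> {0..T})" by (intro compact_Times) auto
  moreover have "continuous_on ({0..r} \<times> {0} \<times> {0..T}) (\<lambda>(z, a, s). f z a s)"
    by (rule continuous_on_subset[OF f_cont]) auto
  ultimately have "bounded ((\<lambda>(z, a, s). f z a s) ` ({0..r} \<times> {0} \<times> {0..T}))"
    by (intro compact_imp_bounded compact_continuous_image)
  then obtain B where B: "\<And>z s. z \<in> {0..r} \<Longrightarrow> s \<in> {0..T} \<Longrightarrow> \<bar>f z 0 s\<bar> \<le> B"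
    unfolding bounded_iff by fastforce
  have "\<bar>f 0 0 0\<bar> \<le> B" using B[of 0 0] r T by simp
  then have B0: "B \<ge> 0" by linarith
  have "\<bar>f z a s\<bar> \<le> (2 * c + B) * (\<bar>a\<bar> powr p + 1)" if z: "z \<in> {0..r}" and s: "s \<in> {0..T}" for z a s
  proof -
    have "\<bar>f z a s - f z 0 s\<bar> \<le> c * (\<bar>a\<bar> powr (p - 1) + 1) * \<bar>a - 0\<bar>"
    proof -
      have "norm (f z a s - f z 0 s) \<le> c * (\<bar>a\<bar> powr (p - 1) + 1) * norm (a - 0)"
      proof (rule field_differentiable_bound[where S = "{- \<bar>a\<bar>..\<bar>a\<bar>}" and f = "\<lambda>a. f z a s" and f' = "\<lambda>a. partial_a f z a s"])
        fix b assume b: "b \<in> {- \<bar>a\<bar>..\<bar>a\<bar>}"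
        show "((\<lambda>a. f z a s) has_real_derivative partial_a f z b s) (at b within {- \<bar>a\<bar>..\<bar>a\<bar>})"
          by (rule has_field_derivative_at_within, rule partial_a) (use z s in auto)
        have "\<bar>partial_a f z b s\<bar> \<le> c * (\<bar>b\<bar> powr (p - 1) + 1)" by (rule c(2)[OF z s])
        also have "\<dots> \<le> c * (\<bar>a\<bar> powr (p - 1) + 1)"
          using b p c(1) by (intro mult_left_mono add_right_mono powr_mono2) auto
        finally show "norm (partial_a f z b s) \<le> c * (\<bar>a\<bar> powr (p - 1) + 1)" by simp
      qed auto
      then show ?thesis by simp
    qed
    also have "\<dots> = c * (\<bar>a\<bar> * \<bar>a\<bar> powr (p - 1) + \<bar>a\<bar>)" by (simp add: algebra_simps)
    also have "\<bar>a\<bar> * \<bar>a\<bar> powr (p - 1) = \<bar>a\<bar> powr p" by (simp add: powr_mult_base)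
    also have "c * (\<bar>a\<bar> powr p + \<bar>a\<bar>) \<le> c * (2 * (\<bar>a\<bar> powr p + 1))"
    proof (rule mult_left_mono[OF _ c(1)])
      have "X + A \<le> 2 * (X + 1)" if "A \<le> X + 1" "0 \<le> X" for A X :: real using that by simp
      then show "\<bar>a\<bar> powr p + \<bar>a\<bar> \<le> 2 * (\<bar>a\<bar> powr p + 1)"
        using le_powr_add_one[OF p abs_ge_zero] powr_ge_zero by blast
    qed
    finally have 1: "\<bar>f z a s - f z 0 s\<bar> \<le> 2 * c * (\<bar>a\<bar> powr p + 1)" by (simp add: algebra_simps)
    have "B * 1 \<le> B * (\<bar>a\<bar> powr p + 1)" using B0 by (intro mult_left_mono) auto
    then have "\<bar>f z 0 s\<bar> \<le> B * (\<bar>a\<bar> powr p + 1)" using B[OF z s] by linarith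
    with 1 have "\<bar>f z a s\<bar> \<le> 2 * c * (\<bar>a\<bar> powr p + 1) + B * (\<bar>a\<bar> powr p + 1)" by linarith
    then show ?thesis by (simp only: distrib_right[of "2 * c" B])
  qed
  then show ?thesis using c(1) B0 by (intro exI[of _ "2 * c + B"]) auto
qed

text \<open>The tangent at \<open>a\<close>, evaluated at 0, gives
  \<open>f z a s \<le> f z 0 s + partial_a f z a s * a\<close>. So a bounded slope allows at most
  linear size in \<open>a\<close>, while the lower bound on \<open>f\<close> grows like
  \<open>|a|^p\<close> with \<open>p > 1\<close>.\<close>

lemma coercive:
  assumes r: "r > 0"
  shows "\<exists>K. \<forall>z\<in>{0..r}. \<forall>a. \<forall>s\<in>{0..T}. \<bar>partial_a f z a s\<bar> \<le> Q \<longrightarrow> \<bar>a\<bar> \<le> K"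
proof -
  obtain C where C: "C \<ge> 0" "\<And>z a s. z \<in> {0..r} \<Longrightarrow> s \<in> {0..T} \<Longrightarrow> \<bar>f z a s\<bar> \<le> C * (\<bar>a\<bar> powr p + 1)"
    using upper_bound[OF r] by blast
  obtain C0 where C0: "C0 > 0" "\<And>z a s. z \<ge> 0 \<Longrightarrow> s \<in> {0..T} \<Longrightarrow> f z a s \<ge> C0 * (\<bar>a\<bar> powr p - 1)"
    using f_lower by blast
  \<comment> \<open>For \<open>|a| > 1\<close> the constant \<open>C0 + C\<close> is at most
    \<open>(C0 + C) * |a|\<close>; then one factor \<open>|a|\<close> cancels and \<open>R\<close>
    bounds \<open>|a|^(p-1)\<close>.\<close>
  define R where "R = (\<bar>Q\<bar> + C0 + C) / C0"
  have "\<bar>a\<bar> \<le> max 1 (R powr (1 / (p - 1)))"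
    if z: "z \<in> {0..r}" and s: "s \<in> {0..T}" and Q: "\<bar>partial_a f z a s\<bar> \<le> Q" for z a s
  proof (cases "\<bar>a\<bar> \<le> 1")
    case False
    have "partial_a f z a s * (0 - a) \<le> f z 0 s - f z a s"
      by (rule convex_on_imp_above_tangent[OF strictly_convex_imp_convex_on[OF f_convex]])
        (use z s partial_a in auto)
    moreover have "f z 0 s \<le> C" using C(2)[OF z s, of 0] p by simp
    moreover have "C0 * (\<bar>a\<bar> powr p - 1) \<le> f z a s" using C0(2) z s by simp
    moreover have "partial_a f z a s * a \<le> \<bar>Q\<bar> * \<bar>a\<bar>"
    proof -
      have "partial_a f z a s * a \<le> \<bar>partial_a f z a s\<bar> * \<bar>a\<bar>" by (metis abs_ge_self abs_mult)
      also have "\<dots> \<le> \<bar>Q\<bar> * \<bar>a\<bar>" using Q by (intro mult_right_mono) auto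
      finally show ?thesis .
    qed
    ultimately have "C0 * \<bar>a\<bar> powr p \<le> \<bar>Q\<bar> * \<bar>a\<bar> + (C0 + C)" by (simp add: algebra_simps)
    moreover have "(C0 + C) * 1 \<le> (C0 + C) * \<bar>a\<bar>" using False C0(1) C(1) by (intro mult_left_mono) auto
    ultimately have "C0 * \<bar>a\<bar> powr p \<le> (\<bar>Q\<bar> + C0 + C) * \<bar>a\<bar>" by (simp add: algebra_simps)
    moreover have "\<bar>a\<bar> powr p = \<bar>a\<bar> * \<bar>a\<bar> powr (p - 1)" by (simp add: powr_mult_base)
    ultimately have "(C0 * \<bar>a\<bar> powr (p - 1)) * \<bar>a\<bar> \<le> (\<bar>Q\<bar> + C0 + C) * \<bar>a\<bar>"
      by (simp add: mult.assoc mult.commute[of "\<bar>a\<bar>"])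
    then have "C0 * \<bar>a\<bar> powr (p - 1) \<le> \<bar>Q\<bar> + C0 + C" using False by (simp add: mult_le_cancel_right)
    then have "\<bar>a\<bar> powr (p - 1) \<le> R" using C0(1) by (simp add: R_def field_simps)
    then have "(\<bar>a\<bar> powr (p - 1)) powr (1 / (p - 1)) \<le> R powr (1 / (p - 1))"
      using p by (intro powr_mono2) auto
    then show ?thesis using p by (simp add: powr_powr)
  qed simp
  then show ?thesis by blast
qed

text \<open>By the mean value theorem in \<open>\<theta>\<close> the quotient is a directional
  derivative at an intermediate point, where the growth bounds apply. The result is free of
  \<open>\<epsilon>\<close> and so provides the majorant for the limit in which
  \<open>\<epsilon>\<close> tends to 0.\<close>

lemma difference_quotient_bound:
  assumes r: "r > 0"
  shows "\<exists>c\<ge>0. \<forall>z h a k s M \<epsilon>. s \<in> {0..T} \<longrightarrow> \<bar>h\<bar> \<le> M \<longrightarrow> \<bar>k\<bar> \<le> M \<longrightarrow> 0 < \<epsilon> \<longrightarrow> \<epsilon> \<le> 1 \<longrightarrow>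
     (\<forall>\<theta>\<in>{0..\<epsilon>}. 0 < z + \<theta> * h \<and> z + \<theta> * h \<le> r) \<longrightarrow>
     \<bar>(f (z + \<epsilon> * h) (a + \<epsilon> * k) s - f z a s) / \<epsilon>\<bar> \<le> M * c * ((\<bar>a\<bar> + M) powr p + 1)"
proof -
  obtain c where c: "c \<ge> 0"
    "\<And>z a s. z \<in> {0..r} \<Longrightarrow> s \<in> {0..T} \<Longrightarrow> \<bar>partial_y f z a s\<bar> \<le> c * (\<bar>a\<bar> powr p + 1)"
    "\<And>z a s. z \<in> {0..r} \<Longrightarrow> s \<in> {0..T} \<Longrightarrow> \<bar>partial_a f z a s\<bar> \<le> c * (\<bar>a\<bar> powr (p - 1) + 1)"
    using f_growth[OF r] by blast
  \<comment> \<open>The constant \<open>3 * c\<close> is \<open>c\<close> for the derivative in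
    \<open>z\<close> plus \<open>2 * c\<close> for that in \<open>a\<close>, where the exponent
    \<open>p - 1\<close> is raised to \<open>p\<close> at the cost of a factor 2.\<close>
  have "\<bar>(f (z + \<epsilon> * h) (a + \<epsilon> * k) s - f z a s) / \<epsilon>\<bar> \<le> M * (3 * c) * ((\<bar>a\<bar> + M) powr p + 1)"
    if s: "s \<in> {0..T}" and h: "\<bar>h\<bar> \<le> M" and k: "\<bar>k\<bar> \<le> M" and e: "0 < \<epsilon>" "\<epsilon> \<le> 1"
      and z: "\<forall>\<theta>\<in>{0..\<epsilon>}. 0 < z + \<theta> * h \<and> z + \<theta> * h \<le> r" for z h a k s M \<epsilon>
  proof -
    define d where "d = (\<lambda>\<theta>. h * partial_y f (z + \<theta> * h) (a + \<theta> * k) s + k * partial_a f (z + \<theta> * h) (a + \<theta> * k) s)"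
    have "\<exists>\<theta>>0. \<theta> < \<epsilon> \<and> f (z + \<epsilon> * h) (a + \<epsilon> * k) s - f (z + 0 * h) (a + 0 * k) s = (\<epsilon> - 0) * d \<theta>"
      unfolding d_def using e z s by (intro MVT2 deriv_along_line) auto
    then obtain \<theta> where \<theta>: "0 < \<theta>" "\<theta> < \<epsilon>" "(f (z + \<epsilon> * h) (a + \<epsilon> * k) s - f z a s) / \<epsilon> = d \<theta>"
      using e(1) by auto
    define B where "B = (\<bar>a\<bar> + M) powr p + 1"
    have B1: "B \<ge> 1" by (simp add: B_def)
    have M: "M \<ge> 0" using h by linarith
    have zr: "z + \<theta> * h \<in> {0..r}" using z \<theta> by (auto simp: less_imp_le)
    have "\<bar>a + \<theta> * k\<bar> \<le> \<bar>a\<bar> + \<theta> * \<bar>k\<bar>" using \<theta>(1) by (metis abs_mult abs_of_pos abs_triangle_ineq)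
    also have "\<theta> * \<bar>k\<bar> \<le> 1 * M" using \<theta> e k by (intro mult_mono) auto
    finally have ak: "\<bar>a + \<theta> * k\<bar> \<le> \<bar>a\<bar> + M" by simp
    have "\<bar>partial_y f (z + \<theta> * h) (a + \<theta> * k) s\<bar> \<le> c * (\<bar>a + \<theta> * k\<bar> powr p + 1)"
      by (rule c(2)[OF zr s])
    also have "\<dots> \<le> c * B"
      unfolding B_def using ak p c(1) by (intro mult_left_mono add_right_mono powr_mono2) auto
    finally have y: "\<bar>partial_y f (z + \<theta> * h) (a + \<theta> * k) s\<bar> \<le> c * B" .
    have "\<bar>partial_a f (z + \<theta> * h) (a + \<theta> * k) s\<bar> \<le> c * (\<bar>a + \<theta> * k\<bar> powr (p - 1) + 1)"
      by (rule c(3)[OF zr s])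
    also have "\<dots> \<le> c * (2 * B)"
    proof (rule mult_left_mono[OF _ c(1)])
      have "\<bar>a + \<theta> * k\<bar> powr p \<le> (\<bar>a\<bar> + M) powr p" using ak p by (intro powr_mono2) auto
      moreover have "Y + 1 \<le> 2 * (X + 1)" if "Y \<le> Z + 1" "Z \<le> X" "0 \<le> X" for X Y Z :: real using that by simp
      ultimately show "\<bar>a + \<theta> * k\<bar> powr (p - 1) + 1 \<le> 2 * B"
        unfolding B_def using powr_diff_one_le[OF p abs_ge_zero] powr_ge_zero by blast
    qed
    finally have a: "\<bar>partial_a f (z + \<theta> * h) (a + \<theta> * k) s\<bar> \<le> c * (2 * B)" .
    have "\<bar>d \<theta>\<bar> \<le> \<bar>h\<bar> * \<bar>partial_y f (z + \<theta> * h) (a + \<theta> * k) s\<bar> + \<bar>k\<bar> * \<bar>partial_a f (z + \<theta> * h) (a + \<theta> * k) s\<bar>"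
      unfolding d_def by (metis abs_mult abs_triangle_ineq)
    also have "\<dots> \<le> M * (c * B) + M * (c * (2 * B))"
      using h k y a M by (intro add_mono mult_mono) auto
    finally show ?thesis unfolding \<theta>(3) B_def by (simp add: algebra_simps)
  qed
  then show ?thesis using c(1) by (intro exI[of _ "3 * c"]) auto
qed

lemma borel_measurable_along:
  assumes "z \<in> borel_measurable (lebesgue_on S)" "a \<in> borel_measurable (lebesgue_on S)"
    "S \<subseteq> {0..T}" "\<And>s. s \<in> S \<Longrightarrow> 0 \<le> z s"
  shows "(\<lambda>s. f (z s) (a s) s) \<in> borel_measurable (lebesgue_on S)"
    "(\<lambda>s. partial_y f (z s) (a s) s) \<in> borel_measurable (lebesgue_on S)"
    "(\<lambda>s. partial_a f (z s) (a s) s) \<in> borel_measurable (lebesgue_on S)"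
  using borel_measurable_continuous_data[OF f_cont less_imp_le[OF T] assms]
    borel_measurable_continuous_data[OF f_y_cont less_imp_le[OF T] assms]
    borel_measurable_continuous_data[OF f_a_cont less_imp_le[OF T] assms] by simp_all

end

text \<open>The part of the open interval outside \<open>C\<close> is open, and an open null set is
  empty. Closedness of \<open>C\<close> then adds the end points.\<close>

lemma AE_closed_imp_Icc_subset:
  fixes C :: "real set"
  assumes "closed C" "a < b" and ae: "AE s in lebesgue_on {a..b}. s \<in> C"
  shows "{a..b} \<subseteq> C"
proof -
  have "{a<..<b} - C = {}"
  proof (rule ccontr)
    assume ne: "{a<..<b} - C \<noteq> {}"
    have op: "open ({a<..<b} - C)" using assms(1) by (intro open_Diff) auto
    have "AE s in lebesgue. s \<notin> {a<..<b} - C"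
      using ae unfolding AE_restrict_space_iff[of "{a..b}" lebesgue, simplified]
      by (rule AE_mp) (rule AE_I2, force)
    then have "{a<..<b} - C \<in> null_sets lebesgue"
      using op by (subst (asm) AE_iff_null_sets[symmetric]) auto
    then show False using open_not_negligible[OF op ne] by (simp add: negligible_iff_null_sets)
  qed
  then have "closure {a<..<b} \<subseteq> C" using assms(1) by (intro closure_minimal) auto
  then show ?thesis using assms(2) by simp
qed

lemma AE_continuous_imp_eq:
  fixes g h :: "real \<Rightarrow> real"
  assumes g: "continuous_on {a..b} g" and h: "continuous_on {a..b} h" and ab: "a < b"
    and ae: "AE s in lebesgue_on {a..b}. g s = h s" and s: "s \<in> {a..b}"
  shows "g s = h s"
proof -
  have "closed {s \<in> {a..b}. g s - h s = 0}"
    by (intro continuous_closed_preimage_constant continuous_on_diff g h) auto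
  moreover have "AE s in lebesgue_on {a..b}. s \<in> {s \<in> {a..b}. g s - h s = 0}"
    using ae by (rule AE_mp) (rule AE_I2, simp)
  ultimately have "{a..b} \<subseteq> {s \<in> {a..b}. g s - h s = 0}" using ab by (intro AE_closed_imp_Icc_subset)
  then show ?thesis using s by auto
qed

lemma test_function_uminus:
  assumes "test_function a b \<phi>"
  shows "test_function a b (\<lambda>s. - \<phi> s)" "deriv (\<lambda>s. - \<phi> s) s = - deriv \<phi> s"
proof -
  obtain D where D: "\<And>x. (\<phi> has_vector_derivative D x) (at x)" "continuous_on UNIV D"
    using assms by (auto simp: test_function_def C1_differentiable_on_def)
  have "(\<lambda>s. - \<phi> s) C1_differentiable_on UNIV"
    unfolding C1_differentiable_on_def
    by (rule exI[of _ "\<lambda>x. - D x"]) (use D in \<open>auto intro!: has_vector_derivative_minus continuous_on_minus\<close>)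
  then show "test_function a b (\<lambda>s. - \<phi> s)" using assms by (simp add: test_function_def)
  show "deriv (\<lambda>s. - \<phi> s) s = - deriv \<phi> s"
    by (intro DERIV_imp_deriv DERIV_minus test_functionD(1)[OF assms])
qed

lemma integrable_powr_growth:
  fixes \<alpha> G :: "real \<Rightarrow> real"
  assumes \<alpha>: "integrable (lebesgue_on {a..b}) (\<lambda>s. \<bar>\<alpha> s\<bar> powr p)"
    and G: "G \<in> borel_measurable (lebesgue_on {a..b})" "\<And>s. s \<in> {a..b} \<Longrightarrow> \<bar>G s\<bar> \<le> C * (\<bar>\<alpha> s\<bar> powr p + 1)"
  shows "integrable (lebesgue_on {a..b}) G"
proof -
  interpret finite_measure "lebesgue_on {a..b}" by (rule finite_measure_lebesgue_on) simp
  have "integrable (lebesgue_on {a..b}) (\<lambda>s. C * (\<bar>\<alpha> s\<bar> powr p + 1))" using \<alpha> by simp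
  then show ?thesis
  proof (rule Bochner_Integration.integrable_bound)
    show "AE s in lebesgue_on {a..b}. norm (G s) \<le> norm (C * (\<bar>\<alpha> s\<bar> powr p + 1))"
      using G(2) by (intro AE_I2) (auto intro: order_trans[OF _ abs_ge_self])
  qed (rule G(1))
qed

lemma continuous_on_Icc_abs_bounded:
  fixes f :: "real \<Rightarrow> real"
  assumes "continuous_on {a..b} f"
  shows "\<exists>B. \<forall>s\<in>{a..b}. \<bar>f s\<bar> \<le> B"
proof -
  have "bounded (f ` {a..b})" using assms by (intro compact_imp_bounded compact_continuous_image) auto
  then show ?thesis by (simp add: bounded_iff)
qed

section \<open>First variation and velocity of a fixed arc\<close>

context lagrangian
begin

context
  fixes t1 t2 :: real and z \<alpha> :: "real \<Rightarrow> real"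
  assumes t12: "t1 < t2" "{t1..t2} \<subseteq> {0..T}"
    and z_cont: "continuous_on {t1..t2} z" and z_nonneg: "\<And>s. s \<in> {t1..t2} \<Longrightarrow> 0 \<le> z s"
begin

lemma z_bounded: "\<exists>R>0. \<forall>s\<in>{t1..t2}. z s \<le> R"
proof -
  obtain R where R: "\<forall>s\<in>{t1..t2}. \<bar>z s\<bar> \<le> R" using continuous_on_Icc_abs_bounded[OF z_cont] by blast
  have "z s \<le> max 1 R" if "s \<in> {t1..t2}" for s using bspec[OF R that] by linarith
  then show ?thesis by (intro exI[of _ "max 1 R"]) auto
qed

lemma z_measurable: "z \<in> borel_measurable (lebesgue_on {t1..t2})"
  using z_cont by (intro continuous_imp_measurable_on_sets_lebesgue) auto

text \<open>The equation \<open>partial_a f (z s) a s = q s\<close> has a solution \<open>a\<close>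
  at every \<open>s\<close>, not only where \<open>\<alpha> s\<close> is one: the solvable times
  form the projection of a compact set, which is closed, and they have full measure. Continuity
  follows because a function with closed graph and values in a compact set is continuous.\<close>

lemma optimal_velocity_continuous:
  assumes q: "continuous_on {t1..t2} q" and qP: "AE s in lebesgue_on {t1..t2}. q s = partial_a f (z s) (\<alpha> s) s"
  shows "\<exists>A. continuous_on {t1..t2} A \<and> (AE s in lebesgue_on {t1..t2}. \<alpha> s = A s)"
proof -
  obtain R where R: "R > 0" "\<And>s. s \<in> {t1..t2} \<Longrightarrow> z s \<le> R" using z_bounded by auto
  have zR: "z s \<in> {0..R}" "s \<in> {0..T}" if "s \<in> {t1..t2}" for s using R(2) z_nonneg t12(2) that by auto
  obtain Q where Q: "\<And>s. s \<in> {t1..t2} \<Longrightarrow> \<bar>q s\<bar> \<le> Q" using continuous_on_Icc_abs_bounded[OF q] by blast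
  obtain K where K: "\<And>z a s. z \<in> {0..R} \<Longrightarrow> s \<in> {0..T} \<Longrightarrow> \<bar>partial_a f z a s\<bar> \<le> Q \<Longrightarrow> \<bar>a\<bar> \<le> K"
    using coercive[OF R(1), of Q] by blast
  \<comment> \<open>The box \<open>{-K..K}\<close> makes this set compact. It excludes no solution:
    \<open>q\<close> is bounded by \<open>Q\<close>, and coercivity bounds every solution by
    \<open>K\<close>.\<close>
  define G where "G = {x \<in> {t1..t2} \<times> {-K..K}. (case (z (fst x), snd x, fst x) of (z, a, s) \<Rightarrow> partial_a f z a s) - q (fst x) = 0}"
  have "continuous_on ({t1..t2} \<times> {-K..K}) (\<lambda>x. (z (fst x), snd x, fst x))"
    by (intro continuous_intros continuous_on_compose2[OF z_cont]) auto
  then have c: "continuous_on ({t1..t2} \<times> {-K..K}) (\<lambda>x. case (z (fst x), snd x, fst x) of (z, a, s) \<Rightarrow> partial_a f z a s)"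
    by (rule continuous_on_compose2[OF f_a_cont]) (use zR in auto)
  have "continuous_on ({t1..t2} \<times> {-K..K}) (\<lambda>x. q (fst x))"
    by (rule continuous_on_compose2[OF q]) (auto intro: continuous_intros)
  from continuous_on_diff[OF c this] have "closed G"
    unfolding G_def by (intro continuous_closed_preimage_constant closed_Times) auto
  have "bounded G"
    by (rule bounded_subset[of "{t1..t2} \<times> {-K..K}"]) (auto simp: G_def intro!: bounded_Times)
  with \<open>closed G\<close> have "compact G" by (simp add: compact_eq_bounded_closed)
  then have "compact (fst ` G)" by (intro compact_continuous_image continuous_intros)
  then have clo: "closed (fst ` G)" by (rule compact_imp_closed)
  have G_iff: "(s, a) \<in> G \<longleftrightarrow> s \<in> {t1..t2} \<and> partial_a f (z s) a s = q s" for s a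
    using K[of "z s" s a] Q[of s] zR[of s] by (auto simp: G_def)
  have ae: "AE s in lebesgue_on {t1..t2}. (s, \<alpha> s) \<in> G"
    using qP by (rule AE_mp) (rule AE_I2, simp add: G_iff)
  have "AE s in lebesgue_on {t1..t2}. s \<in> fst ` G"
    using ae by (rule AE_mp) (rule AE_I2, force)
  then have all: "{t1..t2} \<subseteq> fst ` G"
    by (rule AE_closed_imp_Icc_subset[OF clo t12(1)])
  have unique: "a = b" if "(s, a) \<in> G" "(s, b) \<in> G" for s a b
  proof -
    have s: "s \<in> {t1..t2}" "partial_a f (z s) a s = q s" "partial_a f (z s) b s = q s" using that G_iff by auto
    have "0 \<le> z s" "s \<in> {0..T}" using zR[OF s(1)] by auto
    then show ?thesis
      using strictly_convex_deriv_inj[OF f_convex, of "z s" s "q s" a b] partial_a[of "z s" s a] partial_a[of "z s" s b] s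
      by simp
  qed
  define A where "A = (\<lambda>s. SOME a. (s, a) \<in> G)"
  have A: "(s, A s) \<in> G" if "s \<in> {t1..t2}" for s
    using all that unfolding A_def by (intro someI_ex[of "\<lambda>a. (s, a) \<in> G"]) force
  have graph: "(\<lambda>s. (s, A s)) ` {t1..t2} = G"
  proof
    show "G \<subseteq> (\<lambda>s. (s, A s)) ` {t1..t2}"
    proof
      fix x assume x: "x \<in> G"
      obtain s a where sa: "x = (s, a)" by (cases x)
      then have s: "s \<in> {t1..t2}" using x G_iff by auto
      then have "a = A s" using unique[of s a "A s"] A[OF s] x sa by simp
      then show "x \<in> (\<lambda>s. (s, A s)) ` {t1..t2}" using s sa by auto
    qed
  qed (use A in auto)
  have "continuous_on {t1..t2} A"
  proof (rule continuous_from_closed_graph[of "{-K..K}"])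
    show "A \<in> {t1..t2} \<rightarrow> {-K..K}" using A by (auto simp: G_def)
    show "closed ((\<lambda>s. (s, A s)) ` {t1..t2})" using \<open>closed G\<close> by (simp add: graph)
  qed simp
  moreover have "AE s in lebesgue_on {t1..t2}. \<alpha> s = A s"
    using ae by (rule AE_mp) (rule AE_I2, use A unique in auto)
  ultimately show ?thesis by blast
qed

context
  assumes \<alpha>_meas: "\<alpha> \<in> borel_measurable (lebesgue_on {t1..t2})"
    and \<alpha>_p: "integrable (lebesgue_on {t1..t2}) (\<lambda>s. \<bar>\<alpha> s\<bar> powr p)"
begin

lemma integrable_partials:
  "integrable (lebesgue_on {t1..t2}) (\<lambda>s. partial_a f (z s) (\<alpha> s) s)"
  "integrable (lebesgue_on {t1..t2}) (\<lambda>s. partial_y f (z s) (\<alpha> s) s)"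
proof -
  obtain R where R: "R > 0" "\<And>s. s \<in> {t1..t2} \<Longrightarrow> z s \<le> R" using z_bounded by auto
  have zR: "z s \<in> {0..R}" "s \<in> {0..T}" if "s \<in> {t1..t2}" for s using R(2) z_nonneg t12(2) that by auto
  obtain c where c: "c \<ge> 0"
    "\<And>z a s. z \<in> {0..R} \<Longrightarrow> s \<in> {0..T} \<Longrightarrow> \<bar>partial_y f z a s\<bar> \<le> c * (\<bar>a\<bar> powr p + 1)"
    "\<And>z a s. z \<in> {0..R} \<Longrightarrow> s \<in> {0..T} \<Longrightarrow> \<bar>partial_a f z a s\<bar> \<le> c * (\<bar>a\<bar> powr (p - 1) + 1)"
    using f_growth[OF R(1)] by blast
  show "integrable (lebesgue_on {t1..t2}) (\<lambda>s. partial_y f (z s) (\<alpha> s) s)"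
    by (rule integrable_powr_growth[OF \<alpha>_p borel_measurable_along(2)[OF z_measurable \<alpha>_meas t12(2) z_nonneg] c(2)[OF zR]])
  have "\<bar>partial_a f (z s) (\<alpha> s) s\<bar> \<le> (2 * c) * (\<bar>\<alpha> s\<bar> powr p + 1)" if s: "s \<in> {t1..t2}" for s
  proof -
    have "Y + 1 \<le> 2 * (X + 1)" if "Y \<le> X + 1" "0 \<le> X" for X Y :: real using that by simp
    then have "\<bar>\<alpha> s\<bar> powr (p - 1) + 1 \<le> 2 * (\<bar>\<alpha> s\<bar> powr p + 1)"
      using powr_diff_one_le[OF p abs_ge_zero] powr_ge_zero by blast
    then have "c * (\<bar>\<alpha> s\<bar> powr (p - 1) + 1) \<le> c * (2 * (\<bar>\<alpha> s\<bar> powr p + 1))"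
      using c(1) by (rule mult_left_mono)
    with c(3)[OF zR[OF s], of "\<alpha> s"] show ?thesis by (simp only: mult.assoc mult.left_commute[of 2 c])
  qed
  from integrable_powr_growth[OF \<alpha>_p borel_measurable_along(3)[OF z_measurable \<alpha>_meas t12(2) z_nonneg] this]
  show "integrable (lebesgue_on {t1..t2}) (\<lambda>s. partial_a f (z s) (\<alpha> s) s)" .
qed

context
  assumes z_pos: "\<And>s. s \<in> {t1<..<t2} \<Longrightarrow> 0 < z s"
    and minimal: "\<And>\<phi> \<epsilon>. test_function t1 t2 \<phi> \<Longrightarrow> 0 < \<epsilon> \<Longrightarrow> (\<forall>s\<in>{t1<..<t2}. 0 < z s + \<epsilon> * \<phi> s) \<Longrightarrow>
      0 \<le> (LINT s|lebesgue_on {t1..t2}. f (z s + \<epsilon> * \<phi> s) (\<alpha> s + \<epsilon> * deriv \<phi> s) s - f (z s) (\<alpha> s) s)"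
begin

text \<open>Minimality is stated for \<open>\<epsilon> > 0\<close> only, so the limit of the
  difference quotients yields an inequality. It becomes an equality by applying it to
  \<open>- \<phi>\<close> as well.\<close>

lemma first_variation_nonneg:
  assumes \<phi>: "test_function t1 t2 \<phi>"
  shows "0 \<le> (LINT s|lebesgue_on {t1..t2}. \<phi> s * partial_y f (z s) (\<alpha> s) s + deriv \<phi> s * partial_a f (z s) (\<alpha> s) s)"
proof -
  define L where "L = lebesgue_on {t1..t2}"
  note D = test_functionD[OF \<phi>]
  obtain M where M: "M > 0" "\<And>s. \<bar>\<phi> s\<bar> \<le> M" "\<And>s. \<bar>deriv \<phi> s\<bar> \<le> M"
    using test_function_bounded[OF \<phi>] by blast
  obtain K where K: "compact K" "K \<subseteq> {t1<..<t2}" "\<And>s. s \<notin> K \<Longrightarrow> \<phi> s = 0"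
    using D(3) by auto
  obtain R where R: "R > 0" "\<And>s. s \<in> {t1..t2} \<Longrightarrow> z s \<le> R" using z_bounded by auto
  have K': "K \<subseteq> {t1..t2}" using K(2) by auto
  \<comment> \<open>The arc may reach 0 at \<open>t1\<close> and \<open>t2\<close>; a positive lower
    bound is available only on the compact set off which \<open>\<phi>\<close> vanishes.\<close>
  have "\<exists>\<delta>>0. \<forall>s\<in>K. \<delta> \<le> z s"
  proof (cases "K = {}")
    case False
    obtain s0 where "s0 \<in> K" "\<And>s. s \<in> K \<Longrightarrow> z s0 \<le> z s"
      using continuous_attains_inf[OF K(1) False continuous_on_subset[OF z_cont K']] by blast
    then show ?thesis using z_pos K(2) by (intro exI[of _ "z s0"]) auto
  qed (auto intro: exI[of _ 1])
  then obtain \<delta> where \<delta>: "\<delta> > 0" "\<And>s. s \<in> K \<Longrightarrow> \<delta> \<le> z s" by blast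
  \<comment> \<open>With \<open>\<delta> / (2 * M)\<close> the perturbation uses up at most half of
    the margin \<open>\<delta>\<close>. The bound 1 is what the estimate of the difference quotients
    asks for.\<close>
  define \<epsilon>1 where "\<epsilon>1 = min 1 (\<delta> / (2 * M))"
  have \<epsilon>1: "0 < \<epsilon>1" "\<epsilon>1 \<le> 1" "\<epsilon>1 * M \<le> \<delta> / 2"
    using \<delta>(1) M(1) by (auto simp: \<epsilon>1_def min_def field_simps)
  have small: "\<bar>\<theta> * \<phi> s\<bar> \<le> \<epsilon>1 * M" if "0 \<le> \<theta>" "\<theta> \<le> \<epsilon>1" for \<theta> s
    unfolding abs_mult using that M(2)[of s] \<epsilon>1(1) by (intro mult_mono) auto
  have pos: "0 < z s + \<theta> * \<phi> s" if s: "s \<in> {t1<..<t2}" and \<theta>: "0 \<le> \<theta>" "\<theta> \<le> \<epsilon>1" for s \<theta>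
  proof (cases "s \<in> K")
    case True
    then show ?thesis using small[OF \<theta>, of s] \<delta>(2)[OF True] \<epsilon>1(3) \<delta>(1) by linarith
  qed (use K(3) z_pos s in auto)
  have nonneg: "0 \<le> z s + \<theta> * \<phi> s" if "s \<in> {t1..t2}" and \<theta>: "0 \<le> \<theta>" "\<theta> \<le> \<epsilon>1" for s \<theta>
  proof (cases "s \<in> {t1<..<t2}")
    case False
    then have "s \<notin> K" using K(2) by auto
    then show ?thesis using K(3) z_nonneg that(1) by simp
  qed (use pos[OF _ \<theta>] in force)
  define r where "r = R + M"
  have "\<epsilon>1 * M \<le> 1 * M" using \<epsilon>1 M(1) by (intro mult_right_mono) auto
  then have le_r: "z s + \<theta> * \<phi> s \<le> r" if "s \<in> {t1..t2}" and \<theta>: "0 \<le> \<theta>" "\<theta> \<le> \<epsilon>1" for s \<theta>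
    using small[OF \<theta>, of s] R(2)[OF that(1)] unfolding r_def by linarith
  have "r > 0" using R(1) M(1) by (simp add: r_def)
  from difference_quotient_bound[OF this] obtain c where
    c: "\<And>z h a k s M \<epsilon>. s \<in> {0..T} \<Longrightarrow> \<bar>h\<bar> \<le> M \<Longrightarrow> \<bar>k\<bar> \<le> M \<Longrightarrow> 0 < \<epsilon> \<Longrightarrow> \<epsilon> \<le> 1 \<Longrightarrow>
     (\<forall>\<theta>\<in>{0..\<epsilon>}. 0 < z + \<theta> * h \<and> z + \<theta> * h \<le> r) \<Longrightarrow>
     \<bar>(f (z + \<epsilon> * h) (a + \<epsilon> * k) s - f z a s) / \<epsilon>\<bar> \<le> M * c * ((\<bar>a\<bar> + M) powr p + 1)" and c0: "c \<ge> 0" by blast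
  \<comment> \<open>Dominated convergence is about sequences, so \<open>\<epsilon>\<close> runs
    through one that tends to 0 without attaining it.\<close>
  define \<epsilon> where "\<epsilon> = (\<lambda>n. \<epsilon>1 * inverse (real (Suc n)))"
  have \<epsilon>: "0 < \<epsilon> n" "\<epsilon> n \<le> \<epsilon>1" for n
    using \<epsilon>1(1) by (auto simp: \<epsilon>_def field_simps)
  have "\<epsilon> \<longlonglongrightarrow> \<epsilon>1 * 0" unfolding \<epsilon>_def by (intro tendsto_intros LIMSEQ_inverse_real_of_nat)
  then have "\<epsilon> \<longlonglongrightarrow> 0" by simp
  then have \<epsilon>_at: "filterlim \<epsilon> (at 0) sequentially"
    by (rule filterlim_atI) (rule always_eventually, rule allI, rule less_imp_neq[OF \<epsilon>(1), symmetric])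
  define Q where "Q = (\<lambda>n s. (f (z s + \<epsilon> n * \<phi> s) (\<alpha> s + \<epsilon> n * deriv \<phi> s) s - f (z s) (\<alpha> s) s) / \<epsilon> n)"
  have [measurable]: "\<alpha> \<in> borel_measurable L" "z \<in> borel_measurable L"
    "\<phi> \<in> borel_measurable L" "deriv \<phi> \<in> borel_measurable L"
    unfolding L_def using \<alpha>_meas z_measurable D(1,2)
    by (auto intro!: continuous_on_UNIV_borel_measurable_lebesgue_on continuous_at_imp_continuous_on DERIV_isCont)
  have [measurable]: "(\<lambda>s. f (z s + \<epsilon> n * \<phi> s) (\<alpha> s + \<epsilon> n * deriv \<phi> s) s) \<in> borel_measurable L" for n
    unfolding L_def
  proof (rule borel_measurable_along(1)[OF _ _ t12(2)])
    show "0 \<le> z s + \<epsilon> n * \<phi> s" if "s \<in> {t1..t2}" for s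
      using nonneg[OF that] \<epsilon>[of n] by (simp add: less_imp_le)
  qed (unfold L_def[symmetric], measurable)
  have [measurable]: "(\<lambda>s. f (z s) (\<alpha> s) s) \<in> borel_measurable L"
    unfolding L_def by (rule borel_measurable_along(1)[OF z_measurable \<alpha>_meas t12(2) z_nonneg])
  have [measurable]: "(\<lambda>s. partial_y f (z s) (\<alpha> s) s) \<in> borel_measurable L" "(\<lambda>s. partial_a f (z s) (\<alpha> s) s) \<in> borel_measurable L"
    using integrable_partials by (auto simp: L_def)
  have Q_nonneg: "0 \<le> (LINT s|L. Q n s)" for n
  proof -
    have "0 \<le> (LINT s|L. f (z s + \<epsilon> n * \<phi> s) (\<alpha> s + \<epsilon> n * deriv \<phi> s) s - f (z s) (\<alpha> s) s)"
      unfolding L_def using pos \<epsilon>[of n] by (intro minimal[OF \<phi>]) (auto simp: less_imp_le)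
    then show ?thesis unfolding Q_def using \<epsilon>(1)[of n] by simp
  qed
  \<comment> \<open>The derivative along the perturbation requires a positive base point, so the
    null set \<open>{t1, t2}\<close> is left out.\<close>
  have aeI: "AE s in L. P s" if "\<And>s. s \<in> {t1<..<t2} \<Longrightarrow> P s" for P
    unfolding L_def AE_lebesgue_on_Icc_iff_Ioo using that by (intro AE_I2) simp
  have "(\<lambda>n. LINT s|L. Q n s) \<longlonglongrightarrow> (LINT s|L. \<phi> s * partial_y f (z s) (\<alpha> s) s + deriv \<phi> s * partial_a f (z s) (\<alpha> s) s)"
  proof (rule integral_dominated_convergence[where w = "\<lambda>s. M * c * (2 powr p * (\<bar>\<alpha> s\<bar> powr p + M powr p) + 1)"])
    interpret finite_measure L unfolding L_def by (rule finite_measure_lebesgue_on) simp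
    show "integrable L (\<lambda>s. M * c * (2 powr p * (\<bar>\<alpha> s\<bar> powr p + M powr p) + 1))"
      using \<alpha>_p by (simp add: L_def[symmetric])
    show "AE s in L. norm (Q n s) \<le> M * c * (2 powr p * (\<bar>\<alpha> s\<bar> powr p + M powr p) + 1)" for n
    proof (rule aeI)
      fix s assume s: "s \<in> {t1<..<t2}"
      then have s': "s \<in> {t1..t2}" "s \<in> {0..T}" using t12(2) by auto
      have "\<bar>Q n s\<bar> \<le> M * c * ((\<bar>\<alpha> s\<bar> + M) powr p + 1)"
        unfolding Q_def
      proof (rule c[OF s'(2) M(2) M(3)])
        show "\<epsilon> n \<le> 1" using \<epsilon>(2)[of n] \<epsilon>1(2) by linarith
        show "\<forall>\<theta>\<in>{0..\<epsilon> n}. 0 < z s + \<theta> * \<phi> s \<and> z s + \<theta> * \<phi> s \<le> r"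
          using pos[OF s] le_r[OF s'(1)] \<epsilon>(2)[of n] by auto
      qed (rule \<epsilon>)
      also have "\<dots> \<le> M * c * (2 powr p * (\<bar>\<alpha> s\<bar> powr p + M powr p) + 1)"
        using powr_add_le[of p "\<bar>\<alpha> s\<bar>" M] p M(1) c0 by (intro mult_left_mono add_right_mono) auto
      finally show "norm (Q n s) \<le> M * c * (2 powr p * (\<bar>\<alpha> s\<bar> powr p + M powr p) + 1)" by simp
    qed
    show "AE s in L. (\<lambda>n. Q n s) \<longlonglongrightarrow> \<phi> s * partial_y f (z s) (\<alpha> s) s + deriv \<phi> s * partial_a f (z s) (\<alpha> s) s"
    proof (rule aeI)
      fix s assume s: "s \<in> {t1<..<t2}"
      then have sT: "s \<in> {0..T}" using t12(2) by auto
      have "0 < z s + 0 * \<phi> s" using z_pos[OF s] by simp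
      from deriv_along_line[OF this sT, of "\<alpha> s" "deriv \<phi> s"]
      have "((\<lambda>h. (f (z s + h * \<phi> s) (\<alpha> s + h * deriv \<phi> s) s - f (z s) (\<alpha> s) s) / h) \<longlongrightarrow>
         \<phi> s * partial_y f (z s) (\<alpha> s) s + deriv \<phi> s * partial_a f (z s) (\<alpha> s) s) (at 0)"
        by (simp add: DERIV_def)
      from filterlim_compose[OF this \<epsilon>_at]
      show "(\<lambda>n. Q n s) \<longlonglongrightarrow> \<phi> s * partial_y f (z s) (\<alpha> s) s + deriv \<phi> s * partial_a f (z s) (\<alpha> s) s"
        by (simp add: Q_def)
    qed
  qed (unfold Q_def, measurable)
  then show ?thesis
    unfolding L_def[symmetric] using Q_nonneg by (intro LIMSEQ_le_const) auto
qed

lemma euler_lagrange_weak: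
  assumes \<phi>: "test_function t1 t2 \<phi>"
  shows "(LINT s|lebesgue_on {t1..t2}. deriv \<phi> s * partial_a f (z s) (\<alpha> s) s)
    = - (LINT s|lebesgue_on {t1..t2}. \<phi> s * partial_y f (z s) (\<alpha> s) s)"
proof -
  note D = test_functionD[OF \<phi>]
  obtain M where M: "M > 0" "\<And>s. \<bar>\<phi> s\<bar> \<le> M" "\<And>s. \<bar>deriv \<phi> s\<bar> \<le> M"
    using test_function_bounded[OF \<phi>] by blast
  have m: "\<phi> \<in> borel_measurable (lebesgue_on {t1..t2})" "deriv \<phi> \<in> borel_measurable (lebesgue_on {t1..t2})"
    using D(1,2)
    by (auto intro!: continuous_on_UNIV_borel_measurable_lebesgue_on continuous_at_imp_continuous_on DERIV_isCont)
  have prod: "integrable (lebesgue_on {t1..t2}) (\<lambda>s. \<psi> s * u s)"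
    if "integrable (lebesgue_on {t1..t2}) u" "\<psi> \<in> borel_measurable (lebesgue_on {t1..t2})" "\<And>s. \<bar>\<psi> s\<bar> \<le> M"
    for u \<psi> :: "real \<Rightarrow> real"
  proof (rule Bochner_Integration.integrable_bound)
    show "integrable (lebesgue_on {t1..t2}) (\<lambda>s. M * u s)" using that(1) by simp
    show "(\<lambda>s. \<psi> s * u s) \<in> borel_measurable (lebesgue_on {t1..t2})" using that(1,2) by auto
    show "AE s in lebesgue_on {t1..t2}. norm (\<psi> s * u s) \<le> norm (M * u s)"
      using that(3) M(1) by (intro AE_I2) (auto simp: abs_mult intro!: mult_right_mono)
  qed
  note ia = prod[OF integrable_partials(1) m(2) M(3)]
  note iy = prod[OF integrable_partials(2) m(1) M(2)]
  have "(LINT s|lebesgue_on {t1..t2}. - \<phi> s * partial_y f (z s) (\<alpha> s) s + - deriv \<phi> s * partial_a f (z s) (\<alpha> s) s)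
     = - (LINT s|lebesgue_on {t1..t2}. \<phi> s * partial_y f (z s) (\<alpha> s) s + deriv \<phi> s * partial_a f (z s) (\<alpha> s) s)"
    unfolding Bochner_Integration.integral_minus[symmetric] by (rule Bochner_Integration.integral_cong) auto
  then have "(LINT s|lebesgue_on {t1..t2}. \<phi> s * partial_y f (z s) (\<alpha> s) s + deriv \<phi> s * partial_a f (z s) (\<alpha> s) s) = 0"
    using first_variation_nonneg[OF \<phi>] first_variation_nonneg[OF test_function_uminus(1)[OF \<phi>]]
    unfolding test_function_uminus(2)[OF \<phi>] by linarith
  then show ?thesis using Bochner_Integration.integral_add[OF iy ia] by linarith
qed

end
end
end
end

context lagrangian
begin

lemma euler_lagrange_regularity:
  assumes t12: "t1 < t2" "{t1..t2} \<subseteq> {0..T}"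
    and z_cont: "continuous_on {t1..t2} z" and z_nonneg: "\<And>s. s \<in> {t1..t2} \<Longrightarrow> 0 \<le> z s"
    and \<alpha>_meas: "\<alpha> \<in> borel_measurable (lebesgue_on {t1..t2})"
    and \<alpha>_p: "integrable (lebesgue_on {t1..t2}) (\<lambda>s. \<bar>\<alpha> s\<bar> powr p)"
    and z_pos: "\<And>s. s \<in> {t1<..<t2} \<Longrightarrow> 0 < z s"
    and minimal: "\<And>\<phi> \<epsilon>. test_function t1 t2 \<phi> \<Longrightarrow> 0 < \<epsilon> \<Longrightarrow> (\<forall>s\<in>{t1<..<t2}. 0 < z s + \<epsilon> * \<phi> s) \<Longrightarrow>
      0 \<le> (LINT s|lebesgue_on {t1..t2}. f (z s + \<epsilon> * \<phi> s) (\<alpha> s + \<epsilon> * deriv \<phi> s) s - f (z s) (\<alpha> s) s)"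
    and z_int: "\<And>s. s \<in> {t1..t2} \<Longrightarrow> z s = z t1 + integral {t1..s} \<alpha>"
  shows "\<exists>q. (AE s in lebesgue_on {t1..t2}. q s = partial_a f (z s) (\<alpha> s) s) \<and>
      abs_continuous_on {t1..t2} q \<and>
      (AE s in lebesgue_on {t1..t2}. (q has_real_derivative partial_y f (z s) (\<alpha> s) s) (at s))"
    and "\<exists>A. continuous_on {t1..t2} A \<and> (\<forall>s\<in>{t1..t2}. (z has_real_derivative A s) (at s within {t1..t2}))"
proof -
  let ?P = "\<lambda>s. partial_a f (z s) (\<alpha> s) s" and ?H = "\<lambda>s. partial_y f (z s) (\<alpha> s) s"
  have int: "integrable (lebesgue_on {t1..t2}) ?P" "integrable (lebesgue_on {t1..t2}) ?H"
    by (rule integrable_partials[OF t12 z_cont z_nonneg \<alpha>_meas \<alpha>_p]; assumption)+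
  have weak: "(LINT s|lebesgue_on {t1..t2}. deriv \<phi> s * ?P s) = - (LINT s|lebesgue_on {t1..t2}. \<phi> s * ?H s)"
    if "test_function t1 t2 \<phi>" for \<phi>
    by (rule euler_lagrange_weak[OF t12 z_cont z_nonneg \<alpha>_meas \<alpha>_p z_pos minimal that])
  have "\<exists>c. AE s in lebesgue_on {t1..t2}. ?P s = c + integral {t1..s} ?H"
    by (rule weak_derivative_imp_AE_indefinite_integral[OF int t12(1) weak])
  then obtain c where c: "AE s in lebesgue_on {t1..t2}. ?P s = c + integral {t1..s} ?H" by blast
  define q where "q = (\<lambda>s. c + integral {t1..s} ?H)"
  have qP: "AE s in lebesgue_on {t1..t2}. q s = ?P s"
    using c by (rule AE_mp) (rule AE_I2, simp add: q_def)
  have Hi: "?H integrable_on {t1..t2}" by (rule integrable_on_lebesgue_on[OF int(2)]) simp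
  have "?H absolutely_integrable_on {t1..t2}"
    using int(2) by (simp add: set_integrable_def integrable_restrict_space)
  then have q_ac: "abs_continuous_on {t1..t2} q"
    unfolding q_def by (rule abs_continuous_on_add_const_indefinite_integral)
  have "{s\<in>{t1<..<t2}. \<not> ((\<lambda>u. integral {t1..u} ?H) has_real_derivative ?H s) (at s)} \<in> null_sets lebesgue"
    using lebesgue_differentiation_real[OF Hi] by (simp only: negligible_iff_null_sets)
  then have "AE s in lebesgue. s \<notin> {s\<in>{t1<..<t2}. \<not> ((\<lambda>u. integral {t1..u} ?H) has_real_derivative ?H s) (at s)}"
    by (rule AE_not_in)
  then have "AE s in lebesgue. s \<in> {t1<..<t2} \<longrightarrow> (q has_real_derivative ?H s) (at s)"
  proof (rule AE_mp, intro AE_I2 impI)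
    fix s assume "s \<notin> {s\<in>{t1<..<t2}. \<not> ((\<lambda>u. integral {t1..u} ?H) has_real_derivative ?H s) (at s)}" "s \<in> {t1<..<t2}"
    then have "((\<lambda>u. integral {t1..u} ?H) has_real_derivative ?H s) (at s)" by blast
    then have "((\<lambda>u. c + integral {t1..u} ?H) has_real_derivative 0 + ?H s) (at s)"
      by (intro DERIV_add DERIV_const)
    then show "(q has_real_derivative ?H s) (at s)" by (simp add: q_def)
  qed
  then have "AE s in lebesgue_on {t1<..<t2}. (q has_real_derivative ?H s) (at s)"
    by (simp add: AE_restrict_space_iff)
  then have qd: "AE s in lebesgue_on {t1..t2}. (q has_real_derivative ?H s) (at s)"
    by (simp only: AE_lebesgue_on_Icc_iff_Ioo)
  show "\<exists>q. (AE s in lebesgue_on {t1..t2}. q s = ?P s) \<and> abs_continuous_on {t1..t2} q \<and>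
      (AE s in lebesgue_on {t1..t2}. (q has_real_derivative ?H s) (at s))"
    by (rule exI[of _ q]) (intro conjI qP q_ac qd)
  have q_cont: "continuous_on {t1..t2} q"
    unfolding q_def by (intro continuous_on_add continuous_on_const indefinite_integral_continuous_1 Hi)
  have "\<exists>A. continuous_on {t1..t2} A \<and> (AE s in lebesgue_on {t1..t2}. \<alpha> s = A s)"
    by (rule optimal_velocity_continuous[OF t12 z_cont z_nonneg q_cont qP])
  then obtain A where A: "continuous_on {t1..t2} A" "AE s in lebesgue_on {t1..t2}. \<alpha> s = A s" by blast
  have "AE s in lebesgue. s \<in> {t1..t2} \<longrightarrow> \<alpha> s = A s"
    using A(2) by (simp add: AE_restrict_space_iff)
  then obtain N where N: "negligible N" "\<And>s. s \<in> {t1..t2} \<Longrightarrow> s \<notin> N \<Longrightarrow> \<alpha> s = A s"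
    unfolding eventually_ae_filter_negligible by blast
  \<comment> \<open>Here \<open>z_int\<close> ties the velocity to the arc: a null set does not
    affect the integral, so \<open>z\<close> is a primitive of the continuous \<open>A\<close>. This
    gives a derivative at every point, one-sided at the end points.\<close>
  have zA: "z s = z t1 + integral {t1..s} A" if s: "s \<in> {t1..t2}" for s
  proof -
    have "integral {t1..s} \<alpha> = integral {t1..s} A"
      by (rule integral_spike[OF N(1)]) (use N(2) s in auto)
    then show ?thesis using z_int[OF s] by simp
  qed
  have "(z has_real_derivative A s) (at s within {t1..t2})" if s: "s \<in> {t1..t2}" for s
  proof (rule has_field_derivative_transform_within[OF _ zero_less_one s])
    have "((\<lambda>u. z t1 + integral {t1..u} A) has_real_derivative 0 + A s) (at s within {t1..t2})"
      by (intro DERIV_add DERIV_const integral_has_real_derivative A(1) s)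
    then show "((\<lambda>u. z t1 + integral {t1..u} A) has_real_derivative A s) (at s within {t1..t2})" by simp
  qed (rule zA[symmetric])
  then show "\<exists>A. continuous_on {t1..t2} A \<and> (\<forall>s\<in>{t1..t2}. (z has_real_derivative A s) (at s within {t1..t2}))"
    using A(1) by blast
qed

end

section \<open>Weak derivatives\<close>

lemma vanishing_lebesgue_on:
  fixes g :: "real \<Rightarrow> 'a::euclidean_space"
  assumes "S \<in> sets lebesgue" "\<And>s. s \<notin> S \<Longrightarrow> g s = 0"
  shows "integral\<^sup>L (lebesgue_on S) g = integral\<^sup>L lebesgue g"
    "integrable (lebesgue_on S) g \<longleftrightarrow> integrable lebesgue g"
proof -
  have "(\<lambda>x. if x \<in> S then g x else 0) = g" using assms(2) by auto
  then show "integral\<^sup>L (lebesgue_on S) g = integral\<^sup>L lebesgue g"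
    "integrable (lebesgue_on S) g \<longleftrightarrow> integrable lebesgue g"
    using Lebesgue_Measure.integral_restrict_UNIV[OF assms(1), of g] Lebesgue_Measure.integrable_restrict_UNIV[OF assms(1), of g] by simp_all
qed

lemma integrable_lebesgue_on_subset:
  fixes u :: "real \<Rightarrow> 'a::euclidean_space"
  assumes "integrable (lebesgue_on S) u" "S \<in> sets lebesgue" "K \<in> sets lebesgue" "K \<subseteq> S"
  shows "integrable (lebesgue_on K) u"
  using set_integrable_subset[of lebesgue S u K] assms
  by (simp add: set_integrable_def integrable_restrict_space)

lemma locally_integrable_if_integrable:
  fixes u :: "real \<Rightarrow> 'a::euclidean_space"
  assumes "integrable (lebesgue_on {a<..<b}) u"
  shows "locally_integrable a b u"
  unfolding locally_integrable_def
proof (intro allI impI)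
  fix K :: "real set" assume K: "compact K" "K \<subseteq> {a<..<b}"
  have "K \<in> sets lebesgue" using compact_imp_closed[OF K(1)] by simp
  then show "integrable (lebesgue_on K) u" using assms K(2) by (intro integrable_lebesgue_on_subset[OF assms]) auto
qed

lemma test_function_integrable:
  fixes u :: "real \<Rightarrow> 'a::euclidean_space"
  assumes u: "locally_integrable a b u" and \<phi>: "test_function a b \<phi>"
  shows "integrable lebesgue (\<lambda>s. \<phi> s *\<^sub>R u s)" "integrable lebesgue (\<lambda>s. deriv \<phi> s *\<^sub>R u s)"
proof -
  note D = test_functionD[OF \<phi>]
  obtain K where K: "compact K" "K \<subseteq> {a<..<b}" "\<And>s. s \<notin> K \<Longrightarrow> \<phi> s = 0" "\<And>s. s \<notin> K \<Longrightarrow> deriv \<phi> s = 0"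
    using D(3) by blast
  obtain M where M: "M > 0" "\<And>s. \<bar>\<phi> s\<bar> \<le> M" "\<And>s. \<bar>deriv \<phi> s\<bar> \<le> M"
    using test_function_bounded[OF \<phi>] by blast
  have uK: "integrable (lebesgue_on K) u" using u K(1,2) by (simp add: locally_integrable_def)
  have KS: "K \<in> sets lebesgue" using compact_imp_closed[OF K(1)] by simp
  have *: "integrable lebesgue (\<lambda>s. \<psi> s *\<^sub>R u s)"
    if c: "continuous_on UNIV \<psi>" and 0: "\<And>s. s \<notin> K \<Longrightarrow> \<psi> s = 0" and B: "\<And>s. \<bar>\<psi> s\<bar> \<le> M" for \<psi> :: "real \<Rightarrow> real"
  proof -
    have "integrable (lebesgue_on K) (\<lambda>s. \<psi> s *\<^sub>R u s)"
    proof (rule Bochner_Integration.integrable_bound)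
      show "integrable (lebesgue_on K) (\<lambda>s. M *\<^sub>R u s)" using uK by simp
      show "(\<lambda>s. \<psi> s *\<^sub>R u s) \<in> borel_measurable (lebesgue_on K)"
        using uK continuous_on_UNIV_borel_measurable_lebesgue_on[OF c] by (intro borel_measurable_scaleR) auto
      show "AE s in lebesgue_on K. norm (\<psi> s *\<^sub>R u s) \<le> norm (M *\<^sub>R u s)"
        using B M(1) by (intro AE_I2) (auto intro!: mult_right_mono)
    qed
    then show ?thesis by (subst (asm) vanishing_lebesgue_on(2)[OF KS]) (auto simp: 0)
  qed
  have "continuous_on UNIV \<phi>" using D(1) by (auto intro!: continuous_at_imp_continuous_on DERIV_isCont)
  then show "integrable lebesgue (\<lambda>s. \<phi> s *\<^sub>R u s)" by (rule *) (use K M in auto)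
  show "integrable lebesgue (\<lambda>s. deriv \<phi> s *\<^sub>R u s)" by (rule *[OF D(2)]) (use K M in auto)
qed

lemma test_function_vanishing:
  assumes "test_function a b \<phi>" "s \<notin> {a<..<b}"
  shows "\<phi> s = 0" "deriv \<phi> s = 0"
  using test_functionD(3)[OF assms(1)] assms(2) by blast+

text \<open>Written over the whole line, the integrals no longer mention the interval. Passing to
  another interval is then only a matter of which functions are test functions.\<close>

lemma has_weak_deriv_iff:
  "has_weak_deriv a b u v \<longleftrightarrow> locally_integrable a b u \<and> locally_integrable a b v \<and>
     (\<forall>\<phi>. test_function a b \<phi> \<longrightarrow>
        (LINT s|lebesgue. deriv \<phi> s *\<^sub>R u s) = - (LINT s|lebesgue. \<phi> s *\<^sub>R v s))"
proof -
  have "(LINT s|lebesgue_on {a<..<b}. deriv \<phi> s *\<^sub>R u s) = (LINT s|lebesgue. deriv \<phi> s *\<^sub>R u s)"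
    "(LINT s|lebesgue_on {a<..<b}. \<phi> s *\<^sub>R v s) = (LINT s|lebesgue. \<phi> s *\<^sub>R v s)"
    if "test_function a b \<phi>" for \<phi>
    using test_function_vanishing[OF that] by (auto intro!: vanishing_lebesgue_on(1))
  then show ?thesis unfolding has_weak_deriv_def by auto
qed

lemma locally_integrable_add:
  "locally_integrable a b u \<Longrightarrow> locally_integrable a b v \<Longrightarrow> locally_integrable a b (\<lambda>s. u s + v s)"
  by (simp add: locally_integrable_def)

lemma has_weak_deriv_add:
  assumes u: "has_weak_deriv a b u u'" and v: "has_weak_deriv a b v v'"
  shows "has_weak_deriv a b (\<lambda>s. u s + v s) (\<lambda>s. u' s + v' s)"
proof -
  note U = u[unfolded has_weak_deriv_iff] and V = v[unfolded has_weak_deriv_iff]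
  have "(LINT s|lebesgue. deriv \<phi> s *\<^sub>R (u s + v s)) = - (LINT s|lebesgue. \<phi> s *\<^sub>R (u' s + v' s))"
    if \<phi>: "test_function a b \<phi>" for \<phi>
    using U V \<phi> by (simp add: scaleR_add_right test_function_integrable[OF _ \<phi>])
  then show ?thesis using U V by (simp add: has_weak_deriv_iff locally_integrable_add)
qed

text \<open>Covers negation, scalar multiples, the inner product with a fixed vector, and the
  embedding of a real perturbation along an axis.\<close>

lemma has_weak_deriv_bounded_linear:
  assumes L: "bounded_linear L" and u: "has_weak_deriv a b u u'"
  shows "has_weak_deriv a b (\<lambda>s. L (u s)) (\<lambda>s. L (u' s))"
proof -
  interpret L: bounded_linear L by (rule L)
  note U = u[unfolded has_weak_deriv_iff]
  have loc: "locally_integrable a b (\<lambda>s. L (w s))" if "locally_integrable a b w" for w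
    using that by (auto simp: locally_integrable_def intro: integrable_bounded_linear[OF L])
  have "(LINT s|lebesgue. deriv \<phi> s *\<^sub>R L (u s)) = - (LINT s|lebesgue. \<phi> s *\<^sub>R L (u' s))"
    if \<phi>: "test_function a b \<phi>" for \<phi>
  proof -
    have "(LINT s|lebesgue. L (deriv \<phi> s *\<^sub>R u s)) = L (LINT s|lebesgue. deriv \<phi> s *\<^sub>R u s)"
      using U \<phi> by (intro integral_bounded_linear[OF L] test_function_integrable) auto
    moreover have "(LINT s|lebesgue. L (\<phi> s *\<^sub>R u' s)) = L (LINT s|lebesgue. \<phi> s *\<^sub>R u' s)"
      using U \<phi> by (intro integral_bounded_linear[OF L] test_function_integrable) auto
    ultimately show ?thesis using U \<phi> by (simp add: L.scaleR linear_neg[OF bounded_linear.linear[OF L]])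
  qed
  then show ?thesis using U loc by (simp add: has_weak_deriv_iff)
qed

lemma test_function_mono:
  assumes "test_function c d \<phi>" "a \<le> c" "d \<le> b"
  shows "test_function a b \<phi>"
proof -
  have "{c<..<d} \<subseteq> {a<..<b}" using assms by auto
  then show ?thesis using assms(1) unfolding test_function_def by blast
qed

text \<open>By the fundamental theorem \<open>\<phi>\<close> is the primitive of its derivative, so
  integration by parts for primitives applies, with \<open>\<psi>\<close> as the test
  function.\<close>

lemma has_weak_deriv_test_function:
  assumes \<phi>: "test_function a b \<phi>"
  shows "has_weak_deriv a b \<phi> (deriv \<phi>)"
proof -
  note D = test_functionD[OF \<phi>]
  have cont: "continuous_on UNIV \<phi>" using D(1) by (auto intro!: continuous_at_imp_continuous_on DERIV_isCont)
  have "continuous_on {a..b} \<phi>" "continuous_on {a..b} (deriv \<phi>)"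
    by (auto intro: continuous_on_subset[OF cont] continuous_on_subset[OF D(2)])
  then have int: "integrable (lebesgue_on {a..b}) \<phi>" "integrable (lebesgue_on {a..b}) (deriv \<phi>)"
    by (auto intro: continuous_imp_integrable_real)
  have loc: "locally_integrable a b \<phi>" "locally_integrable a b (deriv \<phi>)"
    by (intro locally_integrable_if_integrable integrable_lebesgue_on_subset[OF int(1)] integrable_lebesgue_on_subset[OF int(2)]; force)+
  have FTC: "integral {a..s} (deriv \<phi>) = \<phi> s" if "s \<in> {a..b}" for s
  proof -
    have "(deriv \<phi> has_integral \<phi> s - \<phi> a) {a..s}"
      using that by (intro fundamental_theorem_of_calculus)
        (auto simp: has_real_derivative_iff_has_vector_derivative[symmetric] intro: has_field_derivative_at_within[OF D(1)])
    moreover have "\<phi> a = 0" by (rule test_function_vanishing(1)[OF \<phi>]) simp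
    ultimately show ?thesis by (simp add: integral_unique)
  qed
  have "(LINT s|lebesgue. deriv \<psi> s *\<^sub>R \<phi> s) = - (LINT s|lebesgue. \<psi> s *\<^sub>R deriv \<phi> s)"
    if \<psi>: "test_function a b \<psi>" for \<psi>
  proof -
    have "(LINT s|lebesgue. deriv \<psi> s *\<^sub>R \<phi> s) = (LINT s|lebesgue_on {a..b}. deriv \<psi> s *\<^sub>R \<phi> s)"
      by (rule vanishing_lebesgue_on(1)[symmetric]) (use test_function_vanishing[OF \<psi>] in auto)
    also have "\<dots> = (LINT s|lebesgue_on {a..b}. deriv \<psi> s * integral {a..s} (deriv \<phi>))"
      by (rule Bochner_Integration.integral_cong) (auto simp: FTC)
    also have "\<dots> = - (LINT s|lebesgue_on {a..b}. \<psi> s * deriv \<phi> s)"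
      by (rule integral_deriv_test_function_times_indefinite_integral[OF int(2) \<psi>])
    also have "(LINT s|lebesgue_on {a..b}. \<psi> s * deriv \<phi> s) = (LINT s|lebesgue. \<psi> s * deriv \<phi> s)"
      by (rule vanishing_lebesgue_on(1)) (use test_function_vanishing[OF \<psi>] in auto)
    finally show ?thesis by simp
  qed
  then show ?thesis using loc by (simp add: has_weak_deriv_iff)
qed

text \<open>A weak derivative comes with integrability on compact subsets of the open interval only.
  Assuming it on \<open>{c..d}\<close> includes the cases \<open>c = a\<close> and
  \<open>d = b\<close>.\<close>

lemma has_weak_deriv_imp_AE_indefinite_integral:
  fixes u v :: "real \<Rightarrow> real"
  assumes uv: "has_weak_deriv a b u v"
    and u: "integrable (lebesgue_on {c..d}) u" and v: "integrable (lebesgue_on {c..d}) v"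
    and cd: "a \<le> c" "c < d" "d \<le> b"
  shows "\<exists>k. AE s in lebesgue_on {c..d}. u s = k + integral {c..s} v"
proof (rule weak_derivative_imp_AE_indefinite_integral[OF u v cd(2)])
  fix \<phi> assume \<phi>: "test_function c d \<phi>"
  note z = test_function_vanishing[OF \<phi>]
  have "(LINT s|lebesgue_on {c..d}. deriv \<phi> s * u s) = (LINT s|lebesgue. deriv \<phi> s * u s)"
    by (rule vanishing_lebesgue_on(1)) (use z in auto)
  also have "\<dots> = - (LINT s|lebesgue. \<phi> s * v s)"
    using uv test_function_mono[OF \<phi> cd(1,3)] by (simp add: has_weak_deriv_iff)
  also have "(LINT s|lebesgue. \<phi> s * v s) = (LINT s|lebesgue_on {c..d}. \<phi> s * v s)"
    by (rule vanishing_lebesgue_on(1)[symmetric]) (use z in auto)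
  finally show "(LINT s|lebesgue_on {c..d}. deriv \<phi> s * u s) = - (LINT s|lebesgue_on {c..d}. \<phi> s * v s)" .
qed

text \<open>As \<open>w\<close> is only locally integrable, a primitive starting at \<open>a\<close>
  need not exist. On each compact subinterval the primitive of \<open>w\<close> is constant, so
  \<open>w\<close> is 0 almost everywhere there, and countably many such intervals exhaust the open
  one.\<close>

lemma has_weak_deriv_zero_imp_AE_zero:
  fixes w :: "real \<Rightarrow> real"
  assumes w: "has_weak_deriv a b (\<lambda>_. 0) w"
  shows "AE s in lebesgue_on {a<..<b}. w s = 0"
proof -
  have part: "AE s in lebesgue. s \<in> {c<..<d} \<longrightarrow> w s = 0" if cd: "a < c" "d < b" for c d
  proof (cases "c < d")
    case True
    have "compact {c..d}" "{c..d} \<subseteq> {a<..<b}" using cd by auto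
    then have wi: "integrable (lebesgue_on {c..d}) w"
      using w unfolding has_weak_deriv_def locally_integrable_def by blast
    have wi': "w integrable_on {c..d}" by (rule integrable_on_lebesgue_on[OF wi]) simp
    obtain k where k: "AE s in lebesgue_on {c..d}. 0 = k + integral {c..s} w"
      using has_weak_deriv_imp_AE_indefinite_integral[OF w _ wi] cd True by auto
    have all: "0 = k + integral {c..s} w" if "s \<in> {c..d}" for s
      by (rule AE_continuous_imp_eq[OF continuous_on_const _ True k that])
         (intro continuous_on_add continuous_on_const indefinite_integral_continuous_1 wi')
    then have I: "integral {c..s} w = - k" if "s \<in> {c<..<d}" for s
    proof -
      have "s \<in> {c..d}" using that by simp
      from all[OF this] show ?thesis by linarith
    qed
    have D: "((\<lambda>u. integral {c..u} w) has_real_derivative 0) (at s)" if s: "s \<in> {c<..<d}" for s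
      by (rule has_field_derivative_transform_within_open[OF DERIV_const[of "- k"] open_greaterThanLessThan s])
         (simp add: I)
    have "{s\<in>{c<..<d}. w s \<noteq> 0} \<subseteq> {s\<in>{c<..<d}. \<not> ((\<lambda>u. integral {c..u} w) has_real_derivative w s) (at s)}"
    proof
      fix s assume s: "s \<in> {s\<in>{c<..<d}. w s \<noteq> 0}"
      then have "\<not> ((\<lambda>u. integral {c..u} w) has_real_derivative w s) (at s)"
        using DERIV_unique[OF D[of s], of "w s"] by auto
      then show "s \<in> {s\<in>{c<..<d}. \<not> ((\<lambda>u. integral {c..u} w) has_real_derivative w s) (at s)}" using s by simp
    qed
    then have "negligible {s\<in>{c<..<d}. w s \<noteq> 0}"
      by (rule negligible_subset[OF lebesgue_differentiation_real[OF wi']])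
    then have "AE s in lebesgue. s \<notin> {s\<in>{c<..<d}. w s \<noteq> 0}"
      by (simp only: negligible_iff_null_sets AE_not_in)
    then show ?thesis by (rule AE_mp) (rule AE_I2, simp)
  qed simp
  have "AE s in lebesgue. \<forall>n. s \<in> {a + inverse (real (Suc n))<..<b - inverse (real (Suc n))} \<longrightarrow> w s = 0"
    unfolding AE_all_countable by (intro allI part) auto
  then have "AE s in lebesgue. s \<in> {a<..<b} \<longrightarrow> w s = 0"
  proof (rule AE_mp, intro AE_I2 impI)
    fix s assume all: "\<forall>n. s \<in> {a + inverse (real (Suc n))<..<b - inverse (real (Suc n))} \<longrightarrow> w s = 0" and s: "s \<in> {a<..<b}"
    then have "0 < min (s - a) (b - s)" by auto
    then obtain n where "inverse (real (Suc n)) < min (s - a) (b - s)" using reals_Archimedean by blast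
    then show "w s = 0" using spec[OF all, of n] by (auto simp del: of_nat_Suc)
  qed
  then show ?thesis by (simp add: AE_restrict_space_iff)
qed

text \<open>Makes the choice behind \<open>weak_deriv\<close> harmless: any weak derivative that can
  be exhibited agrees with the chosen one up to a null set.\<close>

lemma has_weak_deriv_unique:
  fixes u v w :: "real \<Rightarrow> real"
  assumes v: "has_weak_deriv a b u v" and w: "has_weak_deriv a b u w"
  shows "AE s in lebesgue_on {a<..<b}. v s = w s"
proof -
  have "has_weak_deriv a b (\<lambda>s. u s + - u s) (\<lambda>s. v s + - w s)"
    by (rule has_weak_deriv_add[OF v has_weak_deriv_bounded_linear[OF _ w]])
       (rule bounded_linear_minus[OF bounded_linear_ident])
  then have "AE s in lebesgue_on {a<..<b}. v s + - w s = 0"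
    by (intro has_weak_deriv_zero_imp_AE_zero) simp
  then show ?thesis by (rule AE_mp) (rule AE_I2, simp)
qed

lemma has_weak_deriv_cong:
  assumes u: "has_weak_deriv a b u v" and eq: "\<And>s. s \<in> {a<..<b} \<Longrightarrow> u s = u' s"
  shows "has_weak_deriv a b u' v"
proof -
  have "integrable (lebesgue_on K) u'" if "integrable (lebesgue_on K) u" "K \<subseteq> {a<..<b}" for K
    by (rule Bochner_Integration.integrable_cong[THEN iffD1, OF refl _ that(1)]) (use that(2) eq in auto)
  then have "locally_integrable a b u'"
    using u by (simp add: has_weak_deriv_def locally_integrable_def)
  moreover have "(LINT s|lebesgue_on {a<..<b}. deriv \<phi> s *\<^sub>R u' s) = (LINT s|lebesgue_on {a<..<b}. deriv \<phi> s *\<^sub>R u s)" for \<phi>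
    by (rule Bochner_Integration.integral_cong) (use eq in auto)
  ultimately show ?thesis using u by (simp add: has_weak_deriv_def)
qed

section \<open>Membership in Lp\<close>

lemma Lp_on_add:
  assumes u: "Lp_on p S u" and v: "Lp_on p S v" and p: "0 \<le> p"
  shows "Lp_on p S (\<lambda>s. u s + v s)"
  unfolding Lp_on_def
proof
  have m[measurable]: "u \<in> borel_measurable (lebesgue_on S)" "v \<in> borel_measurable (lebesgue_on S)"
    using u v by (auto simp: Lp_on_def)
  then show "(\<lambda>s. u s + v s) \<in> borel_measurable (lebesgue_on S)" by measurable
  show "integrable (lebesgue_on S) (\<lambda>s. norm (u s + v s) powr p)"
  proof (rule Bochner_Integration.integrable_bound)
    show "integrable (lebesgue_on S) (\<lambda>s. 2 powr p * (norm (u s) powr p + norm (v s) powr p))"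
      using u v by (simp add: Lp_on_def)
    show "AE s in lebesgue_on S. norm (norm (u s + v s) powr p) \<le> norm (2 powr p * (norm (u s) powr p + norm (v s) powr p))"
    proof (rule AE_I2)
      fix s
      have "norm (u s + v s) powr p \<le> (norm (u s) + norm (v s)) powr p"
        using p by (intro powr_mono2 norm_triangle_ineq) auto
      also have "\<dots> \<le> 2 powr p * (norm (u s) powr p + norm (v s) powr p)"
        using p by (intro powr_add_le) auto
      finally show "norm (norm (u s + v s) powr p) \<le> norm (2 powr p * (norm (u s) powr p + norm (v s) powr p))"
        by simp
    qed
  qed measurable
qed

lemma Lp_on_bounded:
  fixes u :: "real \<Rightarrow> 'a::euclidean_space"
  assumes u: "u \<in> borel_measurable (lebesgue_on {a<..<b})" and B: "\<And>s. norm (u s) \<le> B" and p: "0 \<le> p"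
  shows "Lp_on p {a<..<b} u"
proof -
  interpret finite_measure "lebesgue_on {a<..<b}" by (rule finite_measure_lebesgue_on) simp
  have "integrable (lebesgue_on {a<..<b}) (\<lambda>s. norm (u s) powr p)"
    by (rule integrable_const_bound[of _ "B powr p"]) (use u B p in \<open>auto intro!: AE_I2 powr_mono2\<close>)
  then show ?thesis using u by (simp add: Lp_on_def)
qed

section \<open>Trajectories and costs on the junction\<close>

lemma edge_iff: "y \<in> edge i \<longleftrightarrow> 0 \<le> y $ i \<and> y = (y $ i) *\<^sub>R axis i 1"
proof
  assume "y \<in> edge i"
  then obtain r where "0 \<le> r" "y = r *\<^sub>R axis i 1" by (auto simp: edge_def)
  then show "0 \<le> y $ i \<and> y = (y $ i) *\<^sub>R axis i 1" by simp
next
  assume "0 \<le> y $ i \<and> y = (y $ i) *\<^sub>R axis i 1"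
  then show "y \<in> edge i" unfolding edge_def by blast
qed

lemma norm_edge:
  assumes "y \<in> edge i"
  shows "norm y = y $ i"
proof -
  have "norm y = norm ((y $ i) *\<^sub>R (axis i 1 :: real ^ 'a))"
    using assms unfolding edge_iff by (intro arg_cong[of _ _ norm]) (rule conjunct2)
  then show ?thesis using assms by (simp add: edge_iff)
qed

lemma edge_eq_norm_scaleR: "y \<in> edge i \<Longrightarrow> y = norm y *\<^sub>R axis i 1"
  unfolding norm_edge by (simp only: edge_iff)

lemma scaleR_axis_in_edge: "0 \<le> r \<Longrightarrow> r *\<^sub>R axis i 1 \<in> edge i"
  by (auto simp: edge_def)

lemma edge_unique:
  assumes y: "y \<in> edge i - {0}" "y \<in> edge j"
  shows "i = j"
proof (rule ccontr)
  assume ij: "i \<noteq> j"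
  have "y $ i = ((y $ j) *\<^sub>R axis j 1) $ i"
    using y(2) unfolding edge_iff by (intro arg_cong[of _ _ "\<lambda>v. v $ i"]) (rule conjunct2)
  then have "y $ i = 0" using ij by (simp add: axis_def)
  then show False using y(1) norm_edge[of y i] by simp
qed

lemma closed_edge: "closed (edge i)"
proof -
  have "edge i = {y. 0 \<le> y $ i} \<inter> {y. y = (y $ i) *\<^sub>R axis i 1}"
    by (rule set_eqI) (simp only: edge_iff Int_iff mem_Collect_eq)
  moreover have "closed {y :: real ^ 'a. 0 \<le> y $ i}"
    by (intro closed_Collect_le continuous_intros)
  moreover have "closed {y :: real ^ 'a. y = (y $ i) *\<^sub>R axis i 1}"
    by (intro closed_Collect_eq continuous_intros)
  ultimately show ?thesis by (simp only: closed_Int)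
qed

text \<open>Here \<open>1\<close> is the vector whose entries are all 1. A point of the junction has
  at most one nonzero coordinate, and that one is positive, so the norm is the restriction of a
  linear function. This gives the weak derivative of \<open>|y|\<close> without a chain rule for the
  norm.\<close>

lemma norm_junction:
  fixes y :: "real ^ 'n::finite"
  assumes "y \<in> junction"
  shows "norm y = y \<bullet> 1"
proof -
  obtain i where i: "y \<in> edge i" using assms by (auto simp: junction_def)
  have "y \<bullet> 1 = norm y * ((axis i 1 :: real ^ 'n) \<bullet> 1)"
    using arg_cong[OF edge_eq_norm_scaleR[OF i], of "\<lambda>v. v \<bullet> 1"] by (simp only: inner_scaleR_left)
  then show ?thesis by (simp add: inner_axis')
qed

lemma running_cost_edge:
  assumes y: "y \<in> edge i - {0}"
  shows "running_cost l lstar y a \<tau> = l i (norm y) a \<tau>"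
proof -
  have ind: "indicator (edge j - {0}) y = (if j = i then 1 else (0::real))" for j
  proof (cases "j = i")
    case False
    then have "y \<notin> edge j" using edge_unique[OF y, of j] by blast
    then show ?thesis using False by simp
  qed (use y in simp)
  have "(\<Sum>j\<in>UNIV. l j (norm y) a \<tau> * indicator (edge j - {0}) y) = (\<Sum>j\<in>UNIV. if j = i then l j (norm y) a \<tau> else 0)"
    by (rule sum.cong) (simp_all add: ind)
  then show ?thesis using y by (simp add: running_cost_def)
qed

lemma continuous_on_MIN:
  fixes f :: "'i \<Rightarrow> 'a::topological_space \<Rightarrow> real"
  assumes "finite I" "I \<noteq> {}" "\<And>i. i \<in> I \<Longrightarrow> continuous_on S (f i)"
  shows "continuous_on S (\<lambda>x. MIN i\<in>I. f i x)"
  using assms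
proof (induction I rule: finite_ne_induct)
  case (insert i I)
  then have "continuous_on S (\<lambda>x. min (f i x) (MIN i\<in>I. f i x))"
    by (intro continuous_on_min) auto
  then show ?case using insert.hyps by simp
qed simp

text \<open>If \<open>v\<close> is the weak derivative of \<open>y\<close>, then \<open>|y|\<close>
  has the weak derivative \<open>v \<bullet> 1\<close>, so there is something to choose. The chosen
  \<open>\<alpha>\<close> agrees with it almost everywhere and inherits measurability and
  integrability.\<close>

lemma trajectory_speed:
  fixes y :: "real \<Rightarrow> real ^ 'n::finite"
  assumes y: "y \<in> trajectories p T t x" and p: "1 < p"
  defines "\<alpha> \<equiv> weak_deriv t T (\<lambda>s. norm (y s))"
  shows "has_weak_deriv t T (\<lambda>s. norm (y s)) \<alpha>"
    and "\<alpha> \<in> borel_measurable (lebesgue_on {t..T})"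
    and "integrable (lebesgue_on {t..T}) (\<lambda>s. \<bar>\<alpha> s\<bar> powr p)"
proof -
  obtain v where v: "Lp_on p {t<..<T} v" "has_weak_deriv t T y v"
    using y by (auto simp: trajectories_def sobolev_W1p_def)
  define w where "w = (\<lambda>s. v s \<bullet> 1)"
  have "has_weak_deriv t T (\<lambda>s. y s \<bullet> 1) w"
    unfolding w_def by (rule has_weak_deriv_bounded_linear[OF bounded_linear_inner_left v(2)])
  then have w: "has_weak_deriv t T (\<lambda>s. norm (y s)) w"
    by (rule has_weak_deriv_cong) (use y in \<open>auto simp: trajectories_def image_subset_iff norm_junction\<close>)
  then show \<alpha>: "has_weak_deriv t T (\<lambda>s. norm (y s)) \<alpha>"
    unfolding \<alpha>_def weak_deriv_def by (rule someI[where P = "has_weak_deriv t T (\<lambda>s. norm (y s))"])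
  have wm: "w \<in> borel_measurable (lebesgue_on {t<..<T})"
    using v(1) unfolding w_def Lp_on_def by (intro borel_measurable_inner) auto
  have "integrable (lebesgue_on {t<..<T}) (\<lambda>s. \<bar>w s\<bar> powr p)"
  proof (rule Bochner_Integration.integrable_bound)
    show "integrable (lebesgue_on {t<..<T}) (\<lambda>s. norm (1 :: real ^ 'n) powr p * norm (v s) powr p)"
      using v(1) by (simp add: Lp_on_def)
    show "AE s in lebesgue_on {t<..<T}. norm (\<bar>w s\<bar> powr p) \<le> norm (norm (1 :: real ^ 'n) powr p * norm (v s) powr p)"
    proof (rule AE_I2)
      fix s
      have "\<bar>w s\<bar> \<le> norm (1 :: real ^ 'n) * norm (v s)"
        unfolding w_def by (metis Cauchy_Schwarz_ineq2 mult.commute)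
      then have "\<bar>w s\<bar> powr p \<le> (norm (1 :: real ^ 'n) * norm (v s)) powr p" using p by (intro powr_mono2) auto
      then show "norm (\<bar>w s\<bar> powr p) \<le> norm (norm (1 :: real ^ 'n) powr p * norm (v s) powr p)"
        by (simp add: powr_mult)
    qed
  qed (use wm in measurable)
  then have wi: "integrable lebesgue (\<lambda>s. if s \<in> {t<..<T} then \<bar>w s\<bar> powr p else 0)"
    by (subst Lebesgue_Measure.integrable_restrict_UNIV) auto
  \<comment> \<open>Extended by 0 to the whole line, the two functions agree almost everywhere, and
    completeness of Lebesgue measure carries measurability from one to the other. They may differ at
    \<open>t\<close> and \<open>T\<close>, since \<open>w0\<close> is cut off on the open interval
    and \<open>\<alpha>0\<close> on the closed one.\<close>
  define w0 where "w0 = (\<lambda>s. if s \<in> {t<..<T} then w s else 0)"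
  define \<alpha>0 where "\<alpha>0 = (\<lambda>s. if s \<in> {t..T} then \<alpha> s else 0)"
  have w0: "w0 \<in> borel_measurable lebesgue"
    unfolding w0_def using wm by (subst borel_measurable_if) auto
  have "AE s in lebesgue_on {t..T}. w s = \<alpha> s"
    unfolding AE_lebesgue_on_Icc_iff_Ioo by (rule has_weak_deriv_unique[OF w \<alpha>])
  then have "AE s in lebesgue. s \<in> {t..T} \<longrightarrow> w s = \<alpha> s" by (simp add: AE_restrict_space_iff)
  moreover have "AE s in lebesgue. s \<notin> {t, T}"
    by (rule AE_not_in) (simp add: negligible_iff_null_sets[symmetric])
  ultimately have ae: "AE s in lebesgue. w0 s = \<alpha>0 s"
    by (rule AE_mp[OF _ AE_mp]) (rule AE_I2, auto simp: w0_def \<alpha>0_def)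
  have \<alpha>0: "\<alpha>0 \<in> borel_measurable lebesgue" by (rule borel_measurable_AE[OF w0 ae])
  then show "\<alpha> \<in> borel_measurable (lebesgue_on {t..T})"
    unfolding \<alpha>0_def by (subst (asm) borel_measurable_if) auto
  have "integrable lebesgue (\<lambda>s. \<bar>w0 s\<bar> powr p)"
    using wi by (rule Bochner_Integration.integrable_cong[THEN iffD1, rotated 2]) (auto simp: w0_def)
  then have "integrable lebesgue (\<lambda>s. \<bar>\<alpha>0 s\<bar> powr p)"
  proof (rule integrable_cong_AE_imp)
    show "(\<lambda>s. \<bar>\<alpha>0 s\<bar> powr p) \<in> borel_measurable lebesgue" using \<alpha>0 by measurable
    show "AE s in lebesgue. \<bar>w0 s\<bar> powr p = \<bar>\<alpha>0 s\<bar> powr p"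
      using ae by (rule AE_mp) (rule AE_I2, simp)
  qed
  then have "integrable lebesgue (\<lambda>s. if s \<in> {t..T} then \<bar>\<alpha> s\<bar> powr p else 0)"
    by (rule Bochner_Integration.integrable_cong[THEN iffD1, rotated 2]) (auto simp: \<alpha>0_def)
  then show "integrable (lebesgue_on {t..T}) (\<lambda>s. \<bar>\<alpha> s\<bar> powr p)"
    by (subst (asm) Lebesgue_Measure.integrable_restrict_UNIV) auto
qed

text \<open>On the edge the trajectory is \<open>|y|\<close> times a unit vector, so the
  perturbation moves the distance to the vertex linearly, and positivity keeps it on the same side.
  At all other times \<open>\<phi>\<close> is 0 and nothing changes, in particular not the initial
  point.\<close>

lemma competitor_trajectory:
  fixes y :: "real \<Rightarrow> real ^ 'n::finite"
  assumes y: "y \<in> trajectories p T t x" and p: "1 < p" and t12: "t \<le> t1" "t2 \<le> T"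
    and edge: "\<And>s. s \<in> {t1<..<t2} \<Longrightarrow> y s \<in> edge i - {0}"
    and \<phi>: "test_function t1 t2 \<phi>" and pos: "\<And>s. s \<in> {t1<..<t2} \<Longrightarrow> 0 < norm (y s) + \<epsilon> * \<phi> s"
  defines "z \<equiv> \<lambda>s. y s + (\<epsilon> * \<phi> s) *\<^sub>R axis i 1"
  shows "z \<in> trajectories p T t x"
    and "\<And>s. norm (z s) = norm (y s) + \<epsilon> * \<phi> s"
    and "\<And>s. s \<in> {t1<..<t2} \<Longrightarrow> z s \<in> edge i - {0}"
proof -
  note D = test_functionD[OF \<phi>]
  have z_eq: "z s = (norm (y s) + \<epsilon> * \<phi> s) *\<^sub>R axis i 1" if "s \<in> {t1<..<t2}" for s
  proof -
    have "y s \<in> edge i" using edge[OF that] by simp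
    from edge_eq_norm_scaleR[OF this] show ?thesis
      unfolding z_def scaleR_add_left by (rule arg_cong)
  qed
  have z_out: "z s = y s" "\<phi> s = 0" if "s \<notin> {t1<..<t2}" for s
    using test_function_vanishing(1)[OF \<phi> that] by (simp_all add: z_def)
  show n: "norm (z s) = norm (y s) + \<epsilon> * \<phi> s" for s
  proof (cases "s \<in> {t1<..<t2}")
    case True
    then show ?thesis using pos[OF True] by (simp add: z_eq)
  qed (simp add: z_out)
  show e: "z s \<in> edge i - {0}" if "s \<in> {t1<..<t2}" for s
    using z_eq[OF that] pos[OF that] n[of s] scaleR_axis_in_edge[of "norm (y s) + \<epsilon> * \<phi> s" i] by auto
  obtain M where M: "M > 0" "\<And>s. \<bar>\<phi> s\<bar> \<le> M" "\<And>s. \<bar>deriv \<phi> s\<bar> \<le> M"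
    using test_function_bounded[OF \<phi>] by blast
  have cont: "continuous_on UNIV \<phi>" using D(1) by (auto intro!: continuous_at_imp_continuous_on DERIV_isCont)
  have \<phi>': "test_function t T \<phi>" by (rule test_function_mono[OF \<phi> t12])
  define L where "L = (\<lambda>r::real. (\<epsilon> * r) *\<^sub>R (axis i 1 :: real ^ 'n))"
  have L: "bounded_linear L"
    unfolding L_def by (intro bounded_linear_scaleR_left[THEN bounded_linear_compose] bounded_linear_mult_right)
  have Lb: "norm (L r) \<le> \<bar>\<epsilon>\<bar> * M" if "\<bar>r\<bar> \<le> M" for r
    using that by (simp add: L_def abs_mult mult_left_mono)
  have Lm: "(\<lambda>s. L (\<psi> s)) \<in> borel_measurable (lebesgue_on S)" if "continuous_on UNIV \<psi>"
    for \<psi> :: "real \<Rightarrow> real" and S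
    using continuous_on_UNIV_borel_measurable_lebesgue_on[OF that] unfolding L_def by measurable
  obtain v where v: "Lp_on p {t<..<T} y" "Lp_on p {t<..<T} v" "has_weak_deriv t T y v"
    using y by (auto simp: trajectories_def sobolev_W1p_def)
  have z_L: "z = (\<lambda>s. y s + L (\<phi> s))" by (simp add: z_def L_def)
  have "sobolev_W1p p t T z"
    unfolding sobolev_W1p_def z_L
  proof (intro conjI exI)
    show "Lp_on p {t<..<T} (\<lambda>s. y s + L (\<phi> s))"
      using p by (intro Lp_on_add v(1) Lp_on_bounded[of _ _ _ "\<bar>\<epsilon>\<bar> * M"] Lm cont Lb M(2)) auto
    show "Lp_on p {t<..<T} (\<lambda>s. v s + L (deriv \<phi> s))"
      using p by (intro Lp_on_add v(2) Lp_on_bounded[of _ _ _ "\<bar>\<epsilon>\<bar> * M"] Lm D(2) Lb M(3)) auto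
    show "has_weak_deriv t T (\<lambda>s. y s + L (\<phi> s)) (\<lambda>s. v s + L (deriv \<phi> s))"
      by (intro has_weak_deriv_add v(3) has_weak_deriv_bounded_linear[OF L] has_weak_deriv_test_function \<phi>')
  qed
  moreover have "continuous_on {t..T} z"
    unfolding z_def using y continuous_on_subset[OF cont, of "{t..T}"]
    by (intro continuous_intros) (auto simp: trajectories_def)
  moreover have "z s \<in> junction" if "s \<in> {t..T}" for s
  proof (cases "s \<in> {t1<..<t2}")
    case True
    then show ?thesis using e by (auto simp: junction_def)
  next
    case False
    then show ?thesis using z_out y that by (auto simp: trajectories_def)
  qed
  moreover have "z t = x" using z_out(1)[of t] t12 y by (auto simp: trajectories_def)
  ultimately show "z \<in> trajectories p T t x" by (auto simp: trajectories_def)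
qed

section \<open>Bounds and integrability of the costs\<close>

lemma continuous_on_vertex_cost:
  assumes "continuous_on S lstar" "\<And>j. continuous_on S (\<lambda>\<tau>. l j 0 0 \<tau>)"
  shows "continuous_on S (vertex_cost l lstar)"
  unfolding vertex_cost_def[abs_def] by (intro continuous_on_min continuous_on_MIN assms) auto

lemma terminal_cost_bounded:
  assumes "\<And>j. bounded (g j ` {0..})"
  shows "\<exists>B. \<forall>y. \<bar>terminal_cost g gstar y\<bar> \<le> B"
proof -
  have "\<exists>B. \<forall>r\<ge>0. \<bar>g j r\<bar> \<le> B" for j
    using assms[of j] by (auto simp: bounded_iff)
  then obtain B where B: "\<And>j r. 0 \<le> r \<Longrightarrow> \<bar>g j r\<bar> \<le> B j" by metis
  have "\<bar>terminal_cost g gstar y\<bar> \<le> (\<Sum>j\<in>UNIV. B j) + \<bar>min gstar (MIN j. g j 0)\<bar>" for y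
  proof -
    have "\<bar>\<Sum>j\<in>UNIV. g j (norm y) * indicator (edge j - {0}) y\<bar> \<le> (\<Sum>j\<in>UNIV. \<bar>g j (norm y) * indicator (edge j - {0}) y\<bar>)"
      by (rule sum_abs)
    also have "\<dots> \<le> (\<Sum>j\<in>UNIV. B j)"
    proof (rule sum_mono)
      fix j
      have "\<bar>g j (norm y)\<bar> \<le> B j" by (rule B) simp
      then show "\<bar>g j (norm y) * indicator (edge j - {0}) y\<bar> \<le> B j"
        by (auto simp: indicator_def)
    qed
    moreover have "\<bar>min gstar (MIN j. g j 0) * indicator {0} y\<bar> \<le> \<bar>min gstar (MIN j. g j 0)\<bar>"
      by (simp add: indicator_def)
    ultimately show ?thesis unfolding terminal_cost_def by linarith
  qed
  then show ?thesis by blast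
qed

locale junction_lagrangian =
  fixes p T :: real and l :: "'n::finite \<Rightarrow> real \<Rightarrow> real \<Rightarrow> real \<Rightarrow> real" and lstar :: "real \<Rightarrow> real"
  assumes edge_lagrangian: "\<And>j. lagrangian p T (l j)"
    and lstar_cont: "continuous_on {0..T} lstar"
begin

sublocale edge: lagrangian p T "l j" for j
  by (rule edge_lagrangian)

lemma vertex_cost_cont: "continuous_on {0..T} (vertex_cost l lstar)"
proof (intro continuous_on_vertex_cost lstar_cont)
  fix j
  have "continuous_on {0..T} (\<lambda>\<tau>. case (0, 0, \<tau>) of (z, a, s) \<Rightarrow> l j z a s)"
    by (rule continuous_on_compose2[OF edge.f_cont]) (auto intro!: continuous_intros)
  then show "continuous_on {0..T} (\<lambda>\<tau>. l j 0 0 \<tau>)" by simp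
qed

text \<open>Not a formality: the integral of a non-integrable function is 0 by convention, so costs
  could not be compared by subtraction otherwise. As \<open>z\<close> is bounded, each edge
  contributes at most a multiple of \<open>|\<alpha>|^p + 1\<close>.\<close>

lemma running_cost_integrable:
  fixes z :: "real \<Rightarrow> real ^ 'n"
  assumes t: "t \<in> {0..T}" and z: "continuous_on {t..T} z"
    and \<alpha>: "\<alpha> \<in> borel_measurable (lebesgue_on {t..T})" "integrable (lebesgue_on {t..T}) (\<lambda>s. \<bar>\<alpha> s\<bar> powr p)"
  shows "integrable (lebesgue_on {t..T}) (\<lambda>\<tau>. running_cost l lstar (z \<tau>) (\<alpha> \<tau>) \<tau>)"
proof -
  have sub: "{t..T} \<subseteq> {0..T}" using t by auto
  have zm: "z \<in> borel_measurable (lebesgue_on {t..T})"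
    using z by (intro continuous_imp_measurable_on_sets_lebesgue) auto
  have nm: "(\<lambda>s. norm (z s)) \<in> borel_measurable (lebesgue_on {t..T})" using zm by measurable
  have ind: "(\<lambda>s. indicator A (z s) :: real) \<in> borel_measurable (lebesgue_on {t..T})" if "A \<in> sets borel" for A
    using measurable_compose[OF zm borel_measurable_indicator[OF that]] .
  have nc: "continuous_on {t..T} (\<lambda>s. norm (z s))" using z by (intro continuous_intros)
  obtain R where R: "\<And>s. s \<in> {t..T} \<Longrightarrow> \<bar>norm (z s)\<bar> \<le> R" using continuous_on_Icc_abs_bounded[OF nc] by blast
  define r where "r = max 1 R"
  have r: "r > 0" "norm (z s) \<in> {0..r}" if "s \<in> {t..T}" for s using R[OF that] by (auto simp: r_def)
  have r0: "r > 0" by (simp add: r_def)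
  have edge_int: "integrable (lebesgue_on {t..T}) (\<lambda>s. l j (norm (z s)) (\<alpha> s) s * indicator (edge j - {0}) (z s))" for j
  proof -
    obtain C where C: "C \<ge> 0" "\<And>z a s. z \<in> {0..r} \<Longrightarrow> s \<in> {0..T} \<Longrightarrow> \<bar>l j z a s\<bar> \<le> C * (\<bar>a\<bar> powr p + 1)"
      using edge.upper_bound[OF r0] by blast
    show ?thesis
    proof (rule integrable_powr_growth[OF \<alpha>(2), where C = C])
      have "edge j - {0} \<in> sets borel" using closed_edge by (intro sets.Diff borel_closed) auto
      then show "(\<lambda>s. l j (norm (z s)) (\<alpha> s) s * indicator (edge j - {0}) (z s)) \<in> borel_measurable (lebesgue_on {t..T})"
        by (intro borel_measurable_times ind edge.borel_measurable_along(1)[OF nm \<alpha>(1) sub]) auto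
      fix s assume s: "s \<in> {t..T}"
      have "\<bar>l j (norm (z s)) (\<alpha> s) s * indicator (edge j - {0}) (z s)\<bar> \<le> \<bar>l j (norm (z s)) (\<alpha> s) s\<bar>"
        by (simp add: indicator_def)
      also have "\<dots> \<le> C * (\<bar>\<alpha> s\<bar> powr p + 1)" by (rule C(2)[OF r(2)[OF s] subsetD[OF sub s]])
      finally show "\<bar>l j (norm (z s)) (\<alpha> s) s * indicator (edge j - {0}) (z s)\<bar> \<le> C * (\<bar>\<alpha> s\<bar> powr p + 1)" .
    qed
  qed
  have vc: "continuous_on {t..T} (vertex_cost l lstar)" by (rule continuous_on_subset[OF vertex_cost_cont sub])
  obtain V where V: "\<And>s. s \<in> {t..T} \<Longrightarrow> \<bar>vertex_cost l lstar s\<bar> \<le> V" using continuous_on_Icc_abs_bounded[OF vc] by blast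
  have "integrable (lebesgue_on {t..T}) (\<lambda>s. vertex_cost l lstar s * indicator {0} (z s))"
  proof (rule Bochner_Integration.integrable_bound[OF continuous_imp_integrable_real[OF vc]])
    show "(\<lambda>s. vertex_cost l lstar s * indicator {0} (z s)) \<in> borel_measurable (lebesgue_on {t..T})"
      using vc by (intro borel_measurable_times ind continuous_imp_measurable_on_sets_lebesgue) auto
  qed (auto intro!: AE_I2 simp: indicator_def)
  then show ?thesis unfolding running_cost_def
    by (intro Bochner_Integration.integrable_add Bochner_Integration.integrable_sum edge_int)
qed

lemma running_cost_lower:
  "\<exists>c. \<forall>y a. \<forall>\<tau>\<in>{0..T}. - c \<le> running_cost l lstar y a \<tau>"
proof -
  have "\<exists>C0. \<forall>j. C0 j > 0 \<and> (\<forall>z\<ge>0. \<forall>a. \<forall>s\<in>{0..T}. l j z a s \<ge> C0 j * (\<bar>a\<bar> powr p - 1))"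
    by (rule choice) (use edge.f_lower in blast)
  then obtain C0 where C0: "\<And>j. C0 j > 0" "\<And>j z a s. z \<ge> 0 \<Longrightarrow> s \<in> {0..T} \<Longrightarrow> C0 j * (\<bar>a\<bar> powr p - 1) \<le> l j z a s"
    by blast
  obtain V where V: "\<And>s. s \<in> {0..T} \<Longrightarrow> \<bar>vertex_cost l lstar s\<bar> \<le> V"
    using continuous_on_Icc_abs_bounded[OF vertex_cost_cont] by blast
  \<comment> \<open>Every summand of the running cost is bounded below separately, whether or not
    its indicator is 1. Hence the sum over all edges, which spares a case distinction on the
    position of \<open>y\<close>.\<close>
  have "- ((\<Sum>j\<in>UNIV. C0 j) + V) \<le> running_cost l lstar y a \<tau>" if \<tau>: "\<tau> \<in> {0..T}" for y a \<tau>
  proof -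
    have "(\<Sum>j\<in>UNIV. - C0 j) \<le> (\<Sum>j\<in>UNIV. l j (norm y) a \<tau> * indicator (edge j - {0}) y)"
    proof (rule sum_mono)
      fix j
      have "C0 j * (- 1) \<le> C0 j * (\<bar>a\<bar> powr p - 1)" using C0(1)[of j] by (intro mult_left_mono) auto
      also have "\<dots> \<le> l j (norm y) a \<tau>" by (rule C0(2)[OF norm_ge_zero \<tau>])
      finally show "- C0 j \<le> l j (norm y) a \<tau> * indicator (edge j - {0}) y"
        using C0(1)[of j] by (auto simp: indicator_def)
    qed
    moreover have "- V \<le> vertex_cost l lstar \<tau> * indicator {0} y"
      using V[OF \<tau>] by (auto simp: indicator_def)
    ultimately show ?thesis unfolding running_cost_def sum_negf by linarith
  qed
  then show ?thesis by blast
qed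

text \<open>A real infimum is known to be a lower bound only when the set is bounded below. This is
  what lets optimality say that no competitor is cheaper.\<close>

lemma total_cost_bdd_below:
  assumes t: "t \<in> {0..T}" and g: "\<And>j. bounded (g j ` {0..})"
  shows "bdd_below (total_cost T l lstar g gstar t ` trajectories p T t x)"
proof -
  obtain c where c: "\<And>y a \<tau>. \<tau> \<in> {0..T} \<Longrightarrow> - c \<le> running_cost l lstar y a \<tau>" using running_cost_lower by blast
  obtain B where B: "\<And>y. \<bar>terminal_cost g gstar y\<bar> \<le> B" using terminal_cost_bounded[of g gstar, OF g] by blast
  interpret finite_measure "lebesgue_on {t..T}" by (rule finite_measure_lebesgue_on) simp
  show ?thesis
  proof (rule bdd_belowI2)
    fix z assume z: "z \<in> trajectories p T t x"
    have "(LINT \<tau>|lebesgue_on {t..T}. - c) \<le> (LINT \<tau>|lebesgue_on {t..T}. running_cost l lstar (z \<tau>) (weak_deriv t T (\<lambda>s. norm (z s)) \<tau>) \<tau>)"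
    proof (rule Bochner_Integration.integral_mono)
      show "integrable (lebesgue_on {t..T}) (\<lambda>\<tau>. running_cost l lstar (z \<tau>) (weak_deriv t T (\<lambda>s. norm (z s)) \<tau>) \<tau>)"
        by (rule running_cost_integrable[OF t _ trajectory_speed(2,3)[OF z edge.p]])
          (use z in \<open>simp add: trajectories_def\<close>)
      show "- c \<le> running_cost l lstar (z \<tau>) (weak_deriv t T (\<lambda>s. norm (z s)) \<tau>) \<tau>" if "\<tau> \<in> space (lebesgue_on {t..T})" for \<tau>
        by (rule c) (use that t in auto)
    qed simp
    moreover have "- B \<le> terminal_cost g gstar (z T)" using B[of "z T"] by linarith
    ultimately show "(LINT \<tau>|lebesgue_on {t..T}. - c) - B \<le> total_cost T l lstar g gstar t z"
      unfolding total_cost_def by linarith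
  qed
qed

text \<open>The competitor coincides with \<open>y\<close> outside \<open>(t1, t2)\<close>, so the
  terminal costs are equal and the comparison of total costs localises to the time spent on the
  edge, where only \<open>l i\<close> enters.\<close>

lemma optimal_trajectory_minimal_on_edge:
  assumes t: "t \<in> {0..T}" and g: "\<And>j. bounded (g j ` {0..})"
    and y_opt: "y \<in> optimal_trajectories p T l lstar g gstar t x"
    and t12: "t \<le> t1" "t1 < t2" "t2 \<le> T"
    and edge: "\<And>s. s \<in> {t1<..<t2} \<Longrightarrow> y s \<in> edge i - {0}"
    and \<phi>: "test_function t1 t2 \<phi>" and pos: "\<And>s. s \<in> {t1<..<t2} \<Longrightarrow> 0 < norm (y s) + \<epsilon> * \<phi> s"
  defines "\<alpha> \<equiv> weak_deriv t T (\<lambda>s. norm (y s))"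
  shows "0 \<le> (LINT s|lebesgue_on {t1..t2}.
    l i (norm (y s) + \<epsilon> * \<phi> s) (\<alpha> s + \<epsilon> * deriv \<phi> s) s - l i (norm (y s)) (\<alpha> s) s)"
proof -
  have y: "y \<in> trajectories p T t x" using y_opt by (simp add: optimal_trajectories_def)
  note \<alpha> = trajectory_speed[OF y edge.p, folded \<alpha>_def]
  define z where "z = (\<lambda>s. y s + (\<epsilon> * \<phi> s) *\<^sub>R axis i 1)"
  have z: "z \<in> trajectories p T t x" "\<And>s. norm (z s) = norm (y s) + \<epsilon> * \<phi> s"
    "\<And>s. s \<in> {t1<..<t2} \<Longrightarrow> z s \<in> edge i - {0}"
    unfolding z_def by (rule competitor_trajectory[OF y edge.p t12(1,3) edge \<phi> pos]; assumption)+
  define \<beta> where "\<beta> = weak_deriv t T (\<lambda>s. norm (z s))"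
  note \<beta> = trajectory_speed[OF z(1) edge.p, folded \<beta>_def]
  \<comment> \<open>The cost of the competitor involves a choice \<open>\<beta>\<close> of its own;
    uniqueness identifies it almost everywhere with the perturbed velocity.\<close>
  have "has_weak_deriv t T (\<lambda>s. norm (y s) + \<epsilon> * \<phi> s) (\<lambda>s. \<alpha> s + \<epsilon> * deriv \<phi> s)"
    by (intro has_weak_deriv_add \<alpha>(1) has_weak_deriv_bounded_linear[OF bounded_linear_mult_right]
       has_weak_deriv_test_function test_function_mono[OF \<phi> t12(1,3)])
  then have "AE s in lebesgue_on {t<..<T}. \<beta> s = \<alpha> s + \<epsilon> * deriv \<phi> s"
    using has_weak_deriv_unique[OF \<beta>(1)] by (simp add: z(2))
  then have ae: "AE s in lebesgue_on {t..T}. \<beta> s = \<alpha> s + \<epsilon> * deriv \<phi> s"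
    by (simp only: AE_lebesgue_on_Icc_iff_Ioo)
  define D where "D = (\<lambda>s. l i (norm (z s)) (\<alpha> s + \<epsilon> * deriv \<phi> s) s - l i (norm (y s)) (\<alpha> s) s)"
  define Ry where "Ry = (\<lambda>s. running_cost l lstar (y s) (\<alpha> s) s)"
  define Rz where "Rz = (\<lambda>s. running_cost l lstar (z s) (\<beta> s) s)"
  have cont: "continuous_on {t..T} y" "continuous_on {t..T} z"
    using y z(1) by (simp_all add: trajectories_def)
  have Ri: "integrable (lebesgue_on {t..T}) Ry" "integrable (lebesgue_on {t..T}) Rz"
    unfolding Ry_def Rz_def
    by (rule running_cost_integrable[OF t cont(1) \<alpha>(2,3)], rule running_cost_integrable[OF t cont(2) \<beta>(2,3)])
  have out: "z s = y s" "\<phi> s = 0" "deriv \<phi> s = 0" if "s \<notin> {t1<..<t2}" for s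
    using test_function_vanishing[OF \<phi> that] by (simp_all add: z_def)
  \<comment> \<open>Outside the open interval position and velocity agree, so the running costs
    cancel, also at the vertex. As \<open>D\<close> is 0 at \<open>t1\<close> and \<open>t2\<close>,
    the closed interval may be used on the right.\<close>
  have diff: "Rz s - Ry s = (if s \<in> {t1..t2} then D s else 0)" if "\<beta> s = \<alpha> s + \<epsilon> * deriv \<phi> s" for s
  proof (cases "s \<in> {t1<..<t2}")
    case True
    then have "Rz s = l i (norm (z s)) (\<beta> s) s" "Ry s = l i (norm (y s)) (\<alpha> s) s"
      unfolding Rz_def Ry_def by (intro running_cost_edge z(3) edge; simp)+
    then show ?thesis using True that by (simp add: D_def)
  next
    case False
    then show ?thesis using that out[OF False] by (simp add: D_def Rz_def Ry_def)
  qed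
  have sub: "{t1..t2} \<subseteq> {t..T}" "{t1..t2} \<subseteq> {0..T}" using t12 t by auto
  have Dm: "D \<in> borel_measurable (lebesgue_on {t1..t2})"
  proof -
    have m: "\<alpha> \<in> borel_measurable (lebesgue_on {t1..t2})"
      by (rule measurable_restrict_mono[OF \<alpha>(2) sub(1)])
    have "deriv \<phi> \<in> borel_measurable (lebesgue_on {t1..t2})"
      by (rule continuous_on_UNIV_borel_measurable_lebesgue_on[OF test_functionD(2)[OF \<phi>]])
    with m have m2: "(\<lambda>s. \<alpha> s + \<epsilon> * deriv \<phi> s) \<in> borel_measurable (lebesgue_on {t1..t2})" by measurable
    have n: "(\<lambda>s. norm (w s)) \<in> borel_measurable (lebesgue_on {t1..t2})" if "continuous_on {t..T} w" for w :: "real \<Rightarrow> real ^ 'n"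
      using that sub(1) by (intro continuous_imp_measurable_on_sets_lebesgue continuous_intros)
        (auto intro: continuous_on_subset)
    show ?thesis unfolding D_def
      by (intro borel_measurable_diff edge.borel_measurable_along(1)[OF n[OF cont(2)] m2 sub(2)]
         edge.borel_measurable_along(1)[OF n[OF cont(1)] m sub(2)] norm_ge_zero)
  qed
  have "total_cost T l lstar g gstar t y \<le> total_cost T l lstar g gstar t z"
    using y_opt cINF_lower[OF total_cost_bdd_below[OF t g] z(1)] by (simp add: optimal_trajectories_def)
  moreover have "z T = y T" using t12 by (intro out(1)) auto
  ultimately have "integral\<^sup>L (lebesgue_on {t..T}) Ry \<le> integral\<^sup>L (lebesgue_on {t..T}) Rz"
    by (simp add: total_cost_def Ry_def Rz_def \<alpha>_def \<beta>_def)
  then have "0 \<le> (LINT s|lebesgue_on {t..T}. Rz s - Ry s)"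
    using Ri by simp
  also have "\<dots> = (LINT s|lebesgue_on {t..T}. (if s \<in> {t1..t2} then D s else 0))"
  proof (rule integral_cong_AE)
    show "(\<lambda>s. Rz s - Ry s) \<in> borel_measurable (lebesgue_on {t..T})" using Ri by auto
    show "(\<lambda>s. if s \<in> {t1..t2} then D s else 0) \<in> borel_measurable (lebesgue_on {t..T})"
      using Dm by (intro measurable_restrict_space1, subst borel_measurable_if) auto
    show "AE s in lebesgue_on {t..T}. Rz s - Ry s = (if s \<in> {t1..t2} then D s else 0)"
      using ae by (rule AE_mp) (rule AE_I2, use diff in blast)
  qed
  also have "\<dots> = integral\<^sup>L (lebesgue_on {t1..t2}) D"
    by (rule Lebesgue_Measure.integral_restrict[OF sub(1)]) auto
  finally show ?thesis by (simp add: D_def z(2))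
qed

end

text \<open>Since \<open>\<alpha>\<close> is determined up to null sets only, so is its composition
  with \<open>partial_a (l i)\<close>; \<open>q\<close> is the absolutely continuous representative
  of this composition, and its classical derivative expresses the Euler--Lagrange equation.\<close>

theorem lemma2p15:
  fixes T p gstar t t1 t2 :: real
    and g :: "'n::finite \<Rightarrow> real \<Rightarrow> real"
    and lstar :: "real \<Rightarrow> real"
    and l :: "'n \<Rightarrow> real \<Rightarrow> real \<Rightarrow> real \<Rightarrow> real"
    and x :: "real ^ 'n" and y :: "real \<Rightarrow> real ^ 'n" and i :: 'n
  assumes N: "CARD('n) > 1" and T: "T > 0" and p: "p > 1"
    and g_cont: "\<And>j. continuous_on {0..} (g j)"
    and g_bdd: "\<And>j. bounded (g j ` {0..})"
    and lstar_cont: "continuous_on {0..T} lstar"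
    and l_cont: "\<And>j. continuous_on ({0..} \<times> UNIV \<times> {0..T}) (\<lambda>(z, a, s). l j z a s)"
    and l_diff: "\<And>j s. s \<in> {0..T} \<Longrightarrow> (\<lambda>(z, a). l j z a s) differentiable_on ({0..} \<times> UNIV)"
    and l_y_cont: "\<And>j. continuous_on ({0..} \<times> UNIV \<times> {0..T}) (\<lambda>(z, a, s). partial_y (l j) z a s)"
    and l_a_cont: "\<And>j. continuous_on ({0..} \<times> UNIV \<times> {0..T}) (\<lambda>(z, a, s). partial_a (l j) z a s)"
    and H1: "\<And>j. \<exists>C0>0. (\<forall>z\<ge>0. \<forall>a. \<forall>s\<in>{0..T}. l j z a s \<ge> C0 * (\<bar>a\<bar> powr p - 1)) \<and>
                           (\<forall>s\<in>{0..T}. lstar s \<ge> - C0)"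
    and H2: "\<And>j r. r > 0 \<Longrightarrow> \<exists>\<omega>. modulus_of_continuity \<omega> \<and>
               (\<forall>z\<in>{0..r}. \<forall>a. \<forall>s1\<in>{0..T}. \<forall>s2\<in>{0..T}.
                  \<bar>l j z a s1 - l j z a s2\<bar> \<le> (1 + \<bar>a\<bar> powr p) * \<omega> \<bar>s1 - s2\<bar>)"
    and H3: "\<And>j r. r > 0 \<Longrightarrow> \<exists>c\<ge>0. \<forall>z\<in>{0..r}. \<forall>a. \<forall>s\<in>{0..T}.
               \<bar>partial_y (l j) z a s\<bar> \<le> c * (\<bar>a\<bar> powr p + 1) \<and>
               \<bar>partial_a (l j) z a s\<bar> \<le> c * (\<bar>a\<bar> powr (p - 1) + 1)"
    and H4: "\<And>j z s. z \<ge> 0 \<Longrightarrow> s \<in> {0..T} \<Longrightarrow> strictly_convex (\<lambda>a. l j z a s)"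
    and x: "x \<in> junction" and t: "t \<in> {0..T}"
    and y_opt: "y \<in> optimal_trajectories p T l lstar g gstar t x"
    and t12: "t1 \<in> {t..T}" "t2 \<in> {t..T}" "t1 < t2"
    and y_edge: "\<And>s. s \<in> {t1<..<t2} \<Longrightarrow> y s \<in> edge i - {0}"
  shows "let ybar = (\<lambda>s. norm (y s)); \<alpha> = weak_deriv t T ybar in
           (\<exists>q. (AE s in lebesgue_on {t1..t2}. q s = partial_a (l i) (ybar s) (\<alpha> s) s) \<and>
                abs_continuous_on {t1..t2} q \<and>
                (AE s in lebesgue_on {t1..t2}.
                   (q has_real_derivative partial_y (l i) (ybar s) (\<alpha> s) s) (at s))) \<and>
           (\<exists>C. C-lipschitz_on {t1..t2} y) \<and>
           y C1_differentiable_on {t1<..<t2}"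
proof -
  have lag: "lagrangian p T (l j)" for j
  proof
    show "\<exists>C0>0. \<forall>z\<ge>0. \<forall>a. \<forall>s\<in>{0..T}. C0 * (\<bar>a\<bar> powr p - 1) \<le> l j z a s" using H1[of j] by blast
  qed (rule p T l_cont l_diff l_y_cont l_a_cont H3 H4; assumption)+
  interpret junction_lagrangian p T l lstar
    by (rule junction_lagrangian.intro[OF lag lstar_cont])
  define ybar where "ybar = (\<lambda>s. norm (y s))"
  define \<alpha> where "\<alpha> = weak_deriv t T ybar"
  have y: "y \<in> trajectories p T t x" using y_opt by (simp add: optimal_trajectories_def)
  note speed = trajectory_speed[OF y p, folded ybar_def, folded \<alpha>_def]
  have t12': "t \<le> t1" "t1 < t2" "t2 \<le> T" "t < T" using t12 by auto
  have sub: "{t1..t2} \<subseteq> {t..T}" "{t1..t2} \<subseteq> {0..T}" using t12' t by auto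
  have yc: "continuous_on {t..T} y" using y by (simp add: trajectories_def)
  then have ybc: "continuous_on {t..T} ybar" unfolding ybar_def by (intro continuous_intros)
  \<comment> \<open>On a bounded interval \<open>|a| \<le> |a|^p + 1\<close> turns integrability of
    the power into integrability of \<open>\<alpha>\<close>.\<close>
  have \<alpha>i: "integrable (lebesgue_on {t..T}) \<alpha>"
    by (rule integrable_powr_growth[OF speed(3,2), where C = 1]) (use le_powr_add_one[OF p] in auto)
  then have \<alpha>i': "\<alpha> integrable_on {t..T}" by (rule integrable_on_lebesgue_on) simp
  obtain k where k: "AE s in lebesgue_on {t..T}. ybar s = k + integral {t..s} \<alpha>"
    using has_weak_deriv_imp_AE_indefinite_integral[OF speed(1) continuous_imp_integrable_real[OF ybc] \<alpha>i] t12'(4) by auto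
  \<comment> \<open>Both sides are continuous, so they agree everywhere: the distance to the vertex
    is a genuine primitive of the speed.\<close>
  have yk: "ybar s = k + integral {t..s} \<alpha>" if "s \<in> {t..T}" for s
    by (rule AE_continuous_imp_eq[OF ybc _ t12'(4) k that])
       (intro continuous_on_add continuous_on_const indefinite_integral_continuous_1 \<alpha>i')
  have y_int: "ybar s = ybar t1 + integral {t1..s} \<alpha>" if s: "s \<in> {t1..t2}" for s
  proof -
    have "integral {t..t1} \<alpha> + integral {t1..s} \<alpha> = integral {t..s} \<alpha>"
      using s t12' by (intro Henstock_Kurzweil_Integration.integral_combine integrable_on_subinterval[OF \<alpha>i']) auto
    moreover have "s \<in> {t..T}" "t1 \<in> {t..T}" using s t12' by auto
    ultimately show ?thesis using yk[of s] yk[of t1] by linarith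
  qed
  have m: "\<alpha> \<in> borel_measurable (lebesgue_on {t1..t2})"
    by (rule measurable_restrict_mono[OF speed(2) sub(1)])
  have pi: "integrable (lebesgue_on {t1..t2}) (\<lambda>s. \<bar>\<alpha> s\<bar> powr p)"
    by (rule integrable_lebesgue_on_subset[OF speed(3) _ _ sub(1)]) auto
  have nonneg: "0 \<le> ybar s" for s by (simp add: ybar_def)
  have pos: "0 < ybar s" if "s \<in> {t1<..<t2}" for s using y_edge[OF that] by (simp add: ybar_def)
  have minimal: "0 \<le> (LINT s|lebesgue_on {t1..t2}. l i (ybar s + \<epsilon> * \<phi> s) (\<alpha> s + \<epsilon> * deriv \<phi> s) s - l i (ybar s) (\<alpha> s) s)"
    if "test_function t1 t2 \<phi>" "0 < \<epsilon>" "\<forall>s\<in>{t1<..<t2}. 0 < ybar s + \<epsilon> * \<phi> s" for \<phi> \<epsilon>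
    unfolding ybar_def \<alpha>_def
    by (rule optimal_trajectory_minimal_on_edge[OF t g_bdd y_opt t12'(1-3) y_edge that(1)])
       (use that(3) in \<open>auto simp: ybar_def\<close>)
  note reg = edge.euler_lagrange_regularity[OF t12'(2) sub(2) continuous_on_subset[OF ybc sub(1)] nonneg m pi pos minimal y_int]
  obtain A where A: "continuous_on {t1..t2} A" "\<And>s. s \<in> {t1..t2} \<Longrightarrow> (ybar has_real_derivative A s) (at s within {t1..t2})"
    using reg(2) by blast
  obtain K where K: "\<And>s. s \<in> {t1..t2} \<Longrightarrow> \<bar>A s\<bar> \<le> K" using continuous_on_Icc_abs_bounded[OF A(1)] by blast
  have cl: "closure {t1<..<t2} = {t1..t2}" using t12'(2) by simp
  \<comment> \<open>The edge is closed, so the trajectory lies on it also at \<open>t1\<close> and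
    \<open>t2\<close>, where it may be at the vertex. The Lipschitz bound needs these two
    times.\<close>
  have "y ` closure {t1<..<t2} \<subseteq> edge i"
    using y_edge continuous_on_subset[OF yc sub(1)] by (intro image_closure_subset closed_edge) (auto simp: cl)
  then have "y s \<in> edge i" if "s \<in> {t1..t2}" for s using that unfolding cl by blast
  then have y_eq: "y s = ybar s *\<^sub>R axis i 1" if "s \<in> {t1..t2}" for s
    unfolding ybar_def using that by (intro edge_eq_norm_scaleR)
  \<comment> \<open>The maximum with 0 provides the nonnegativity that belongs to a Lipschitz
    constant.\<close>
  have "(max K 0)-lipschitz_on {t1..t2} y"
  proof (rule lipschitz_onI)
    fix r s assume rs: "r \<in> {t1..t2}" "s \<in> {t1..t2}"
    have "norm (ybar r - ybar s) \<le> max K 0 * norm (r - s)"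
      by (rule field_differentiable_bound[OF _ A(2) _ rs]) (use K in \<open>force simp: max_def\<close>)+
    moreover have "dist (y r) (y s) = norm (ybar r - ybar s)"
      unfolding dist_norm y_eq[OF rs(1)] y_eq[OF rs(2)] scaleR_diff_left[symmetric] by simp
    ultimately show "dist (y r) (y s) \<le> max K 0 * dist r s" by (simp add: dist_norm)
  qed simp
  then have lip: "\<exists>C. C-lipschitz_on {t1..t2} y" by blast
  have "y C1_differentiable_on {t1<..<t2}"
    unfolding C1_differentiable_on_def
  proof (intro exI conjI ballI)
    show "continuous_on {t1<..<t2} (\<lambda>s. A s *\<^sub>R (axis i 1 :: real ^ 'n))"
      by (intro continuous_intros continuous_on_subset[OF A(1)]) auto
    fix s assume s: "s \<in> {t1<..<t2}"
    then have "(ybar has_real_derivative A s) (at s)"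
      using A(2)[of s] by (simp add: at_within_Icc_at)
    then have "((\<lambda>s. ybar s *\<^sub>R (axis i 1 :: real ^ 'n)) has_vector_derivative A s *\<^sub>R axis i 1) (at s)"
      using has_vector_derivative_scaleR[OF _ has_vector_derivative_const, of ybar "A s" s UNIV "axis i 1"] by simp
    then show "(y has_vector_derivative A s *\<^sub>R axis i 1) (at s)"
      by (rule has_vector_derivative_transform_within_open[OF _ open_greaterThanLessThan s])
         (simp add: y_eq)
  qed
  with reg(1) lip show ?thesis
    unfolding Let_def \<alpha>_def ybar_def by blast
qed

end
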